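(* Let $p$ be an odd prime and define $s(p):=\Gamma_p\left(\frac{1}{4}\right)\Gamma_p\left(\frac{3}{4}\right)\Gamma_p\left(\frac{1}{2}\right)^2=(-1)^{\left\lfloor \frac{p-1}{4} \right\rfloor+\left\lfloor \frac{p-1}{2} \right\rfloor}$. Then \begin{equation*} {_{4}G_{4}} \biggl[ \begin{array}{cccc} \frac{1}{2} & \frac{1}{2} & \frac{1}{4} & \frac{3}{4} \\ 1 & 1 & 1 & 1 \end{array} \Big| \; 1 \; \biggr]_p - s(p) \cdot p =\omega^{\frac{p-1}{2}}(-1) \left[ \, {_{4}G_{4}} \biggl[ \begin{array}{cccc} \frac{1}{2} & \frac{1}{2} & \frac{1}{2} & \frac{1}{2} \\ 1 & 1 & 1 & 1 \end{array} \Big| \; 1 \; \biggr]_p -p \, \right], \end{equation*} where $\omega$ is the Teichm\"{u}ller character.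
   Context: $\Gamma_p$ denotes Morita's $p$-adic gamma function and $\omega$ the Teichmüller character of $\mathbb{F}_p$ (with $\omega(x)\equiv x \pmod p$), $\bar\omega$ its inverse. For $x\in\mathbb{Q}$, $\lfloor x\rfloor$ is the floor and $\langle x\rangle = x-\lfloor x\rfloor$. For $s\in\mathbb{F}_p$ and $a_i,b_i\in\mathbb{Q}\cap\mathbb{Z}_p$, ${_{n}G_{n}}[a_1,\dots,a_n; b_1,\dots,b_n \mid s]_p := \frac{-1}{p-1}\sum_{j=0}^{p-2}(-1)^{jn}\bar\omega^j(s)\prod_{i=1}^n \frac{\Gamma_p(\langle a_i - \frac{j}{p-1}\rangle)}{\Gamma_p(\langle a_i\rangle)}\frac{\Gamma_p(\langle -b_i + \frac{j}{p-1}\rangle)}{\Gamma_p(\langle -b_i\rangle)}(-p)^{-\lfloor \langle a_i\rangle - \frac{j}{p-1}\rfloor - \lfloor \langle -b_i\rangle + \frac{j}{p-1}\rfloor}$. *)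

theory Defs
  imports "HOL-Analysis.Analysis" "Berlekamp_Zassenhaus.Finite_Field"
begin

section \<open>The p-adic absolute value on the rationals\<close>

definition rat_pabs :: "nat \<Rightarrow> rat \<Rightarrow> real" where
  "rat_pabs p q = (if q = 0 then 0
     else inverse (real p) powi
       (int (multiplicity (int p) (fst (quotient_of q))) - int (multiplicity (int p) (snd (quotient_of q)))))"

lemma rat_pabs_0 [simp]: "rat_pabs p 0 = 0"
  by (simp add: rat_pabs_def)

lemma rat_pabs_fraction:
  assumes p: "prime p" and ab: "a \<noteq> 0" "b \<noteq> 0"
  shows "rat_pabs p (of_int a / of_int b) =
    inverse (real p) powi (int (multiplicity (int p) a) - int (multiplicity (int p) b))"
proof -
  have pe: "prime_elem (int p)" using p by simp
  obtain c d where q: "quotient_of (of_int a / of_int b) = (c, d)" by (cases "quotient_of (of_int a / of_int b)")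
  have d: "d > 0" using quotient_of_denom_pos[OF q] .
  have e: "(of_int a / of_int b :: rat) = of_int c / of_int d" using quotient_of_div[OF q] .
  with ab d have "c \<noteq> 0" by auto
  from e ab d have "(of_int (a * d) :: rat) = of_int (c * b)" by (simp add: field_simps)
  then have "a * d = c * b" by (simp only: of_int_eq_iff)
  then have "multiplicity (int p) (a * d) = multiplicity (int p) (c * b)" by simp
  then have "multiplicity (int p) a + multiplicity (int p) d = multiplicity (int p) c + multiplicity (int p) b"
    using ab d \<open>c \<noteq> 0\<close> pe by (simp add: prime_elem_multiplicity_mult_distrib)
  then have "int (multiplicity (int p) c) - int (multiplicity (int p) d) =
      int (multiplicity (int p) a) - int (multiplicity (int p) b)" by linarith
  then show ?thesis using ab q by (simp add: rat_pabs_def)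
qed

lemma rat_pabs_mult:
  assumes p: "prime p" shows "rat_pabs p (x * y) = rat_pabs p x * rat_pabs p y"
proof (cases "x = 0 \<or> y = 0")
  case False
  have pe: "prime_elem (int p)" using p by simp
  have p0: "inverse (real p) \<noteq> 0" using p by (simp add: prime_gt_0_nat)
  obtain a b where x: "x = of_int a / of_int b" "a \<noteq> 0" "b \<noteq> 0"
    using False by (cases x) (auto simp: Fract_of_int_quotient)
  obtain c d where y: "y = of_int c / of_int d" "c \<noteq> 0" "d \<noteq> 0"
    using False by (cases y) (auto simp: Fract_of_int_quotient)
  have xy: "x * y = of_int (a * c) / of_int (b * d)" by (simp add: x y)
  have "rat_pabs p (x * y) = inverse (real p) powi
      ((int (multiplicity (int p) a) - int (multiplicity (int p) b)) +
       (int (multiplicity (int p) c) - int (multiplicity (int p) d)))"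
    unfolding xy using x y pe
    by (subst rat_pabs_fraction[OF p]) (simp_all add: prime_elem_multiplicity_mult_distrib algebra_simps)
  also have "\<dots> = rat_pabs p x * rat_pabs p y"
    unfolding x(1) y(1) rat_pabs_fraction[OF p x(2,3)] rat_pabs_fraction[OF p y(2,3)]
    using p0 by (intro power_int_add) blast
  finally show ?thesis .
qed auto

lemma rat_pabs_pos: "prime p \<Longrightarrow> x \<noteq> 0 \<Longrightarrow> rat_pabs p x > 0"
  by (simp add: rat_pabs_def prime_gt_0_nat)

lemma rat_pabs_nonneg [simp]: "rat_pabs p x \<ge> 0"
  by (simp add: rat_pabs_def)

lemma rat_pabs_eq_0_iff: "prime p \<Longrightarrow> rat_pabs p x = 0 \<longleftrightarrow> x = 0"
  using rat_pabs_pos[of p x] by (cases "x = 0") auto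

lemma rat_pabs_1 [simp]: "rat_pabs p 1 = 1"
  by (simp add: rat_pabs_def)

lemma rat_pabs_minus [simp]: "rat_pabs p (- x) = rat_pabs p x"
proof -
  have "multiplicity (int p) (- a) = multiplicity (int p) a" for a
    using multiplicity_times_unit_right[of "-1" "int p" a] by simp
  then show ?thesis by (simp add: rat_pabs_def rat_uminus_code Let_def case_prod_beta)
qed

lemma rat_pabs_minus_commute: "rat_pabs p (x - y) = rat_pabs p (y - x)"
  using rat_pabs_minus[of p "x - y"] by simp

lemma rat_pabs_inverse:
  assumes p: "prime p" shows "rat_pabs p (inverse x) = inverse (rat_pabs p x)"
proof (cases "x = 0")
  case False
  then have "rat_pabs p x * rat_pabs p (inverse x) = 1" by (simp flip: rat_pabs_mult[OF p])
  then show ?thesis by (rule inverse_unique[symmetric])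
qed simp

lemma rat_pabs_ultra:
  assumes p: "prime p" shows "rat_pabs p (x + y) \<le> max (rat_pabs p x) (rat_pabs p y)"
proof -
  have *: "rat_pabs p (1 + z) \<le> 1" if z: "rat_pabs p z \<le> 1" for z
  proof (cases "z = 0 \<or> 1 + z = 0")
    case False
    obtain a b where q: "quotient_of z = (a, b)" by (cases "quotient_of z")
    have b: "b > 0" using quotient_of_denom_pos[OF q] .
    have zz: "z = of_int a / of_int b" using quotient_of_div[OF q] .
    have co: "coprime a b" using quotient_of_coprime[OF q] .
    have a: "a \<noteq> 0" using zz False by auto
    have p1: "real p > 1" using p prime_gt_1_nat by fastforce
    have nu: "\<not> is_unit (int p)" using prime_gt_1_nat[OF p] by simp
    have nd: "\<not> int p dvd b"
    proof
      assume d: "int p dvd b"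
      then have "\<not> int p dvd a" using co nu coprime_common_divisor by blast
      then have "multiplicity (int p) a = 0" by (rule not_dvd_imp_multiplicity_0)
      moreover have "multiplicity (int p) b > 0"
        using d b nu by (subst multiplicity_gt_zero_iff) auto
      ultimately have "rat_pabs p z = real p ^ multiplicity (int p) b"
        using b unfolding zz by (subst rat_pabs_fraction[OF p a]) (auto simp: power_int_minus power_inverse)
      also have "\<dots> > 1" using p1 \<open>multiplicity (int p) b > 0\<close> by (simp add: one_less_power)
      finally show False using z by simp
    qed
    have e: "1 + z = of_int (a + b) / of_int b" using b by (simp add: zz field_simps)
    with False have "a + b \<noteq> 0" by auto
    then have "rat_pabs p (1 + z) = inverse (real p) ^ multiplicity (int p) (a + b)"
      unfolding e using b nd by (subst rat_pabs_fraction[OF p]) (auto simp: not_dvd_imp_multiplicity_0)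
    also have "\<dots> \<le> 1" using p1 by (intro power_le_one) (auto simp: field_simps)
    finally show ?thesis .
  qed auto
  have **: "rat_pabs p (u + v) \<le> rat_pabs p u" if uv: "rat_pabs p v \<le> rat_pabs p u" for u v
  proof (cases "u = 0")
    case False
    have "rat_pabs p (v / u) \<le> 1"
      using uv rat_pabs_pos[OF p False] rat_pabs_mult[OF p, of v "inverse u"]
      by (simp add: rat_pabs_inverse[OF p] flip: divide_inverse)
    then have "rat_pabs p (1 + v / u) \<le> 1" by (rule *)
    then have "rat_pabs p u * rat_pabs p (1 + v / u) \<le> rat_pabs p u"
      by (simp add: mult_left_le)
    also have "rat_pabs p u * rat_pabs p (1 + v / u) = rat_pabs p (u * (1 + v / u))"
      by (simp only: rat_pabs_mult[OF p])
    also have "u * (1 + v / u) = u + v" using False by (simp add: field_simps)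
    finally show ?thesis .
  next
    case True
    then have "v = 0" using uv rat_pabs_eq_0_iff[OF p, of v] rat_pabs_nonneg[of p v] by simp
    then show ?thesis using True by simp
  qed
  show ?thesis using **[of x y] **[of y x] by (cases "rat_pabs p x \<le> rat_pabs p y") (auto simp: add.commute)
qed

lemma rat_pabs_triangle: "prime p \<Longrightarrow> rat_pabs p (x + y) \<le> rat_pabs p x + rat_pabs p y"
  using rat_pabs_ultra[of p x y] rat_pabs_nonneg[of p x] rat_pabs_nonneg[of p y] by linarith

lemma rat_pabs_triangle_diff:
  assumes p: "prime p" shows "\<bar>rat_pabs p x - rat_pabs p y\<bar> \<le> rat_pabs p (x - y)"
  using rat_pabs_triangle[OF p, of "x - y" y] rat_pabs_triangle[OF p, of "y - x" x]
  by (simp add: rat_pabs_minus_commute[of p y x])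


section \<open>The field of p-adic numbers as the completion of the rationals\<close>

definition padic_Cauchy :: "nat \<Rightarrow> (nat \<Rightarrow> rat) \<Rightarrow> bool" where
  "padic_Cauchy p X \<longleftrightarrow> (\<forall>e>0. \<exists>k. \<forall>m\<ge>k. \<forall>n\<ge>k. rat_pabs p (X m - X n) < e)"

definition padic_null :: "nat \<Rightarrow> (nat \<Rightarrow> rat) \<Rightarrow> bool" where
  "padic_null p X \<longleftrightarrow> (\<lambda>n. rat_pabs p (X n)) \<longlonglongrightarrow> 0"

definition padic_rel :: "nat \<Rightarrow> (nat \<Rightarrow> rat) \<Rightarrow> (nat \<Rightarrow> rat) \<Rightarrow> bool" where
  "padic_rel p X Y \<longleftrightarrow> padic_Cauchy p X \<and> padic_Cauchy p Y \<and> padic_null p (\<lambda>n. X n - Y n)"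

lemma padic_Cauchy_const: "padic_Cauchy p (\<lambda>n. c)"
  by (simp add: padic_Cauchy_def)

context
  fixes p :: nat
  assumes p: "prime p"
begin

lemma padic_null_le:
  assumes "\<And>n. rat_pabs p (X n) \<le> f n" "f \<longlonglongrightarrow> 0" shows "padic_null p X"
  unfolding padic_null_def
  by (rule tendsto_sandwich[OF _ _ tendsto_const assms(2)]) (auto simp: assms)

lemma padic_null_add:
  assumes "padic_null p X" "padic_null p Y" shows "padic_null p (\<lambda>n. X n + Y n)"
  using assms unfolding padic_null_def
  by (intro padic_null_le[unfolded padic_null_def, of _ "\<lambda>n. rat_pabs p (X n) + rat_pabs p (Y n)"])
     (auto simp: rat_pabs_triangle[OF p] intro: tendsto_add_zero)

lemma padic_null_minus: "padic_null p X \<Longrightarrow> padic_null p (\<lambda>n. - X n)"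
  by (simp add: padic_null_def)

lemma padic_Cauchy_convergent:
  assumes "padic_Cauchy p X" shows "convergent (\<lambda>n. rat_pabs p (X n))"
proof -
  have "Cauchy (\<lambda>n. rat_pabs p (X n))"
  proof (rule metric_CauchyI)
    fix e :: real assume "e > 0"
    then obtain k where "\<forall>m\<ge>k. \<forall>n\<ge>k. rat_pabs p (X m - X n) < e"
      using assms unfolding padic_Cauchy_def by blast
    then show "\<exists>M. \<forall>m\<ge>M. \<forall>n\<ge>M. dist (rat_pabs p (X m)) (rat_pabs p (X n)) < e"
      using rat_pabs_triangle_diff[OF p] unfolding dist_real_def by (meson le_less_trans)
  qed
  then show ?thesis by (simp add: Cauchy_convergent_iff)
qed

lemma padic_Cauchy_bounded:
  assumes "padic_Cauchy p X" obtains B where "B > 0" "\<And>n. rat_pabs p (X n) \<le> B"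
proof -
  have "Bseq (\<lambda>n. rat_pabs p (X n))"
    using padic_Cauchy_convergent[OF assms] by (rule convergent_imp_Bseq)
  then show ?thesis using that by (auto simp: Bseq_def)
qed

lemma padic_Cauchy_not_null:
  assumes "padic_Cauchy p X" "\<not> padic_null p X"
  obtains b k where "b > 0" "\<And>n. n \<ge> k \<Longrightarrow> rat_pabs p (X n) > b"
proof -
  obtain L where L: "(\<lambda>n. rat_pabs p (X n)) \<longlonglongrightarrow> L"
    using padic_Cauchy_convergent[OF assms(1)] by (auto simp: convergent_def)
  have "L \<ge> 0" by (rule LIMSEQ_le_const[OF L]) auto
  moreover have "L \<noteq> 0" using L assms(2) by (auto simp: padic_null_def)
  ultimately have "L > 0" by simp
  then have "\<forall>\<^sub>F n in sequentially. rat_pabs p (X n) > L / 2" by (intro order_tendstoD(1)[OF L]) auto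
  then obtain k where "\<And>n. n \<ge> k \<Longrightarrow> rat_pabs p (X n) > L / 2" by (auto simp: eventually_sequentially)
  then show ?thesis using that[of "L / 2" k] \<open>L > 0\<close> by auto
qed

lemma padic_Cauchy_add:
  assumes "padic_Cauchy p X" "padic_Cauchy p Y" shows "padic_Cauchy p (\<lambda>n. X n + Y n)"
  unfolding padic_Cauchy_def
proof (intro allI impI)
  fix e :: real assume "e > 0"
  then obtain k l where "\<forall>m\<ge>k. \<forall>n\<ge>k. rat_pabs p (X m - X n) < e" "\<forall>m\<ge>l. \<forall>n\<ge>l. rat_pabs p (Y m - Y n) < e"
    using assms unfolding padic_Cauchy_def by meson
  moreover have "rat_pabs p (X m + Y m - (X n + Y n)) \<le> max (rat_pabs p (X m - X n)) (rat_pabs p (Y m - Y n))" for m n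
    using rat_pabs_ultra[OF p, of "X m - X n" "Y m - Y n"] by (simp add: algebra_simps)
  ultimately show "\<exists>k. \<forall>m\<ge>k. \<forall>n\<ge>k. rat_pabs p (X m + Y m - (X n + Y n)) < e"
    by (intro exI[of _ "max k l"]) (smt (verit) max.bounded_iff)
qed

lemma padic_Cauchy_minus:
  assumes "padic_Cauchy p X" shows "padic_Cauchy p (\<lambda>n. - X n)"
proof -
  have "rat_pabs p (- X m - - X n) = rat_pabs p (X m - X n)" for m n
    using rat_pabs_minus[of p "X m - X n"] by (simp add: algebra_simps)
  then show ?thesis using assms by (simp add: padic_Cauchy_def)
qed

lemma padic_Cauchy_mult:
  assumes X: "padic_Cauchy p X" and Y: "padic_Cauchy p Y" shows "padic_Cauchy p (\<lambda>n. X n * Y n)"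
  unfolding padic_Cauchy_def
proof (intro allI impI)
  fix e :: real assume e: "e > 0"
  obtain A where A: "A > 0" "\<And>n. rat_pabs p (X n) \<le> A" using padic_Cauchy_bounded[OF X] by blast
  obtain B where B: "B > 0" "\<And>n. rat_pabs p (Y n) \<le> B" using padic_Cauchy_bounded[OF Y] by blast
  obtain k where k: "\<forall>m\<ge>k. \<forall>n\<ge>k. rat_pabs p (X m - X n) < e / (2 * B)"
    using X e B unfolding padic_Cauchy_def by (meson divide_pos_pos mult_pos_pos zero_less_numeral)
  obtain l where l: "\<forall>m\<ge>l. \<forall>n\<ge>l. rat_pabs p (Y m - Y n) < e / (2 * A)"
    using Y e A unfolding padic_Cauchy_def by (meson divide_pos_pos mult_pos_pos zero_less_numeral)
  have "rat_pabs p (X m * Y m - X n * Y n) < e" if "m \<ge> max k l" "n \<ge> max k l" for m n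
  proof -
    have "X m * Y m - X n * Y n = X m * (Y m - Y n) + (X m - X n) * Y n" by (simp add: algebra_simps)
    then have "rat_pabs p (X m * Y m - X n * Y n) \<le>
        rat_pabs p (X m) * rat_pabs p (Y m - Y n) + rat_pabs p (X m - X n) * rat_pabs p (Y n)"
      by (metis rat_pabs_triangle[OF p] rat_pabs_mult[OF p])
    also have "\<dots> \<le> A * rat_pabs p (Y m - Y n) + rat_pabs p (X m - X n) * B"
      by (intro add_mono mult_right_mono mult_left_mono A B) auto
    also have "\<dots> < A * (e / (2 * A)) + e / (2 * B) * B"
      using that k l A B by (intro add_strict_mono mult_strict_left_mono mult_strict_right_mono) auto
    also have "\<dots> = e" using A B by (simp add: field_simps)
    finally show ?thesis .
  qed
  then show "\<exists>k. \<forall>m\<ge>k. \<forall>n\<ge>k. rat_pabs p (X m * Y m - X n * Y n) < e" by blast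
qed

lemma padic_null_mult:
  assumes X: "padic_Cauchy p X" and Y: "padic_null p Y" shows "padic_null p (\<lambda>n. X n * Y n)"
proof -
  obtain A where A: "A > 0" "\<And>n. rat_pabs p (X n) \<le> A" using padic_Cauchy_bounded[OF X] by blast
  show ?thesis
    using Y unfolding padic_null_def
    by (intro padic_null_le[unfolded padic_null_def, of _ "\<lambda>n. A * rat_pabs p (Y n)"])
       (auto simp: rat_pabs_mult[OF p] A mult_right_mono intro: tendsto_mult_right_zero)
qed

lemma padic_inverse_aux:
  assumes X: "padic_Cauchy p X" "\<not> padic_null p X" and Y: "padic_Cauchy p Y" "\<not> padic_null p Y"
  obtains C k where "C > 0"
    "\<And>m n. m \<ge> k \<Longrightarrow> n \<ge> k \<Longrightarrow>
      rat_pabs p (inverse (X m) - inverse (Y n)) \<le> C * rat_pabs p (X m - Y n)"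
proof -
  obtain b k where b: "b > 0" "\<And>n. n \<ge> k \<Longrightarrow> rat_pabs p (X n) > b"
    using padic_Cauchy_not_null[OF X] by blast
  obtain c l where c: "c > 0" "\<And>n. n \<ge> l \<Longrightarrow> rat_pabs p (Y n) > c"
    using padic_Cauchy_not_null[OF Y] by blast
  have "rat_pabs p (inverse (X m) - inverse (Y n)) \<le> inverse (b * c) * rat_pabs p (X m - Y n)"
    if mn: "m \<ge> max k l" "n \<ge> max k l" for m n
  proof -
    have m: "rat_pabs p (X m) > b" and n: "rat_pabs p (Y n) > c" using b c mn by auto
    then have "X m \<noteq> 0" "Y n \<noteq> 0" using b c by auto
    then have "inverse (X m) - inverse (Y n) = inverse (X m * Y n) * (Y n - X m)"
      by (simp add: field_simps)
    then have "rat_pabs p (inverse (X m) - inverse (Y n)) =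
        inverse (rat_pabs p (X m) * rat_pabs p (Y n)) * rat_pabs p (X m - Y n)"
      using rat_pabs_minus_commute[of p "Y n" "X m"] by (simp only: rat_pabs_mult[OF p] rat_pabs_inverse[OF p])
    also have "\<dots> \<le> inverse (b * c) * rat_pabs p (X m - Y n)"
      using b c m n by (intro mult_right_mono le_imp_inverse_le mult_mono) auto
    finally show ?thesis .
  qed
  then show ?thesis using that[of "inverse (b * c)" "max k l"] b c by auto
qed

lemma padic_Cauchy_inverse:
  assumes X: "padic_Cauchy p X" "\<not> padic_null p X" shows "padic_Cauchy p (\<lambda>n. inverse (X n))"
  unfolding padic_Cauchy_def
proof (intro allI impI)
  fix e :: real assume e: "e > 0"
  obtain C k where C: "C > 0" "\<And>m n. m \<ge> k \<Longrightarrow> n \<ge> k \<Longrightarrow>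
      rat_pabs p (inverse (X m) - inverse (X n)) \<le> C * rat_pabs p (X m - X n)"
    using padic_inverse_aux[OF X X] by blast
  obtain l where l: "\<forall>m\<ge>l. \<forall>n\<ge>l. rat_pabs p (X m - X n) < e / C"
    using X e C unfolding padic_Cauchy_def by (meson divide_pos_pos)
  have "rat_pabs p (inverse (X m) - inverse (X n)) < e" if "m \<ge> max k l" "n \<ge> max k l" for m n
  proof -
    have "rat_pabs p (X m - X n) < e / C" using that l by simp
    then have "C * rat_pabs p (X m - X n) < e" using C by (simp add: field_simps)
    then show ?thesis using C(2)[of m n] that by simp
  qed
  then show "\<exists>k. \<forall>m\<ge>k. \<forall>n\<ge>k. rat_pabs p (inverse (X m) - inverse (X n)) < e" by blast
qed

lemma padic_null_diff_inverse:
  assumes X: "padic_Cauchy p X" "\<not> padic_null p X" and Y: "padic_Cauchy p Y" "\<not> padic_null p Y"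
    and XY: "padic_null p (\<lambda>n. X n - Y n)"
  shows "padic_null p (\<lambda>n. inverse (X n) - inverse (Y n))"
proof -
  obtain C k where C: "C > 0" "\<And>m n. m \<ge> k \<Longrightarrow> n \<ge> k \<Longrightarrow>
      rat_pabs p (inverse (X m) - inverse (Y n)) \<le> C * rat_pabs p (X m - Y n)"
    using padic_inverse_aux[OF X Y] by blast
  have "(\<lambda>n. C * rat_pabs p (X n - Y n)) \<longlonglongrightarrow> 0"
    using XY unfolding padic_null_def by (rule tendsto_mult_right_zero)
  then show ?thesis unfolding padic_null_def
    by (rule tendsto_sandwich[OF _ _ tendsto_const, rotated 2])
       (auto simp: eventually_sequentially intro!: exI[of _ k] C)
qed

lemma padic_null_cong:
  assumes "padic_rel p X Y" shows "padic_null p X \<longleftrightarrow> padic_null p Y"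
proof
  assume "padic_null p X"
  from padic_null_add[OF this padic_null_minus[of "\<lambda>n. X n - Y n"]] assms show "padic_null p Y"
    by (simp add: padic_rel_def)
next
  assume "padic_null p Y"
  from padic_null_add[OF this, of "\<lambda>n. X n - Y n"] assms show "padic_null p X"
    by (simp add: padic_rel_def)
qed

lemma padic_rel_refl: "padic_Cauchy p X \<Longrightarrow> padic_rel p X X"
  by (simp add: padic_rel_def padic_null_def)

lemma part_equivp_padic_rel: "part_equivp (padic_rel p)"
proof (rule part_equivpI)
  show "\<exists>X. padic_rel p X X" using padic_rel_refl[OF padic_Cauchy_const] by blast
  show "symp (padic_rel p)"
    by (rule sympI) (auto simp: padic_rel_def padic_null_def rat_pabs_minus_commute)
  show "transp (padic_rel p)"
  proof (rule transpI)
    fix X Y Z assume "padic_rel p X Y" "padic_rel p Y Z"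
    then show "padic_rel p X Z"
      using padic_null_add[of "\<lambda>n. X n - Y n" "\<lambda>n. Y n - Z n"] by (simp add: padic_rel_def)
  qed
qed

lemma lim_rat_pabs:
  assumes "padic_Cauchy p X"
  shows "(\<lambda>n. rat_pabs p (X n)) \<longlonglongrightarrow> lim (\<lambda>n. rat_pabs p (X n))"
  using padic_Cauchy_convergent[OF assms] by (simp add: convergent_LIMSEQ_iff)

end

typedef ('p::prime_card) padic =
    "{c. \<exists>X. padic_rel CARD('p) X X \<and> c = Collect (padic_rel CARD('p) X)}"
  morphisms class_of_padic padic_of_class
  using padic_rel_refl[OF prime_card padic_Cauchy_const] by blast

definition abs_padic :: "(nat \<Rightarrow> rat) \<Rightarrow> 'p::prime_card padic" where
  "abs_padic X = padic_of_class (Collect (padic_rel CARD('p) X))"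

definition rep_padic :: "'p::prime_card padic \<Rightarrow> nat \<Rightarrow> rat" where
  "rep_padic x = (SOME X. X \<in> class_of_padic x)"

definition cr_padic :: "(nat \<Rightarrow> rat) \<Rightarrow> 'p::prime_card padic \<Rightarrow> bool" where
  "cr_padic \<equiv> \<lambda>X x. padic_rel CARD('p) X X \<and> abs_padic X = x"

lemma Quotient_padic:
  "Quotient (padic_rel CARD('p)) abs_padic rep_padic (cr_padic :: _ \<Rightarrow> 'p::prime_card padic \<Rightarrow> bool)"
proof -
  interpret quot_type "padic_rel CARD('p)" "padic_of_class :: _ \<Rightarrow> 'p padic" class_of_padic
    by unfold_locales
      (use class_of_padic in \<open>auto simp: class_of_padic_inverse padic_of_class_inverse class_of_padic_inject
        intro!: part_equivp_padic_rel[OF prime_card]\<close>)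
  have "abs = abs_padic" "rep = rep_padic"
    by (simp_all add: fun_eq_iff abs_def rep_def abs_padic_def rep_padic_def)
  then show ?thesis
    using Quotient3_to_Quotient[OF Quotient] by (simp add: cr_padic_def)
qed

setup_lifting Quotient_padic

lemma abs_padic_eq_iff:
  "padic_Cauchy CARD('p) X \<Longrightarrow> padic_Cauchy CARD('p) Y \<Longrightarrow>
    (abs_padic X :: 'p::prime_card padic) = abs_padic Y \<longleftrightarrow> padic_rel CARD('p) X Y"
  using Quotient_rel[OF Quotient_padic[where ?'p = 'p], of X Y] by (simp add: padic_rel_refl[OF prime_card])

instantiation padic :: (prime_card) field
begin

lift_definition zero_padic :: "'a padic" is "\<lambda>n. 0"
  by (simp add: padic_rel_refl padic_Cauchy_const prime_card)

lift_definition one_padic :: "'a padic" is "\<lambda>n. 1"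
  by (simp add: padic_rel_refl padic_Cauchy_const prime_card)

lift_definition plus_padic :: "'a padic \<Rightarrow> 'a padic \<Rightarrow> 'a padic" is "\<lambda>X Y n. X n + Y n"
  unfolding padic_rel_def add_diff_add
  by (simp add: padic_Cauchy_add padic_null_add prime_card)

lift_definition uminus_padic :: "'a padic \<Rightarrow> 'a padic" is "\<lambda>X n. - X n"
  unfolding padic_rel_def minus_diff_minus
  by (simp only: padic_Cauchy_minus padic_null_minus prime_card simp_thms)

lift_definition times_padic :: "'a padic \<Rightarrow> 'a padic \<Rightarrow> 'a padic" is "\<lambda>X Y n. X n * Y n"
proof -
  fix f1 f2 f3 f4
  assume "padic_rel CARD('a) f1 f2" "padic_rel CARD('a) f3 f4"
  moreover from this have "padic_null CARD('a) (\<lambda>n. f1 n * (f3 n - f4 n) + f4 n * (f1 n - f2 n))"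
    by (intro padic_null_add padic_null_mult prime_card) (auto simp: padic_rel_def)
  ultimately show "padic_rel CARD('a) (\<lambda>n. f1 n * f3 n) (\<lambda>n. f2 n * f4 n)"
    by (simp add: padic_rel_def padic_Cauchy_mult[OF prime_card] algebra_simps)
qed

lift_definition inverse_padic :: "'a padic \<Rightarrow> 'a padic"
  is "\<lambda>X. if padic_null CARD('a) X then (\<lambda>n. 0) else (\<lambda>n. inverse (X n))"
proof -
  fix X Y assume XY: "padic_rel CARD('a) X Y"
  have "padic_null CARD('a) X \<longleftrightarrow> padic_null CARD('a) Y"
    by (rule padic_null_cong[OF prime_card XY])
  with XY show "?thesis X Y"
    by (auto simp: padic_rel_refl[OF prime_card] padic_Cauchy_const)
      (auto simp: padic_rel_def padic_Cauchy_inverse[OF prime_card] padic_null_diff_inverse[OF prime_card])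
qed

definition "x - y = x + - y" for x y :: "'a padic"

definition "x div y = x * inverse y" for x y :: "'a padic"

instance
proof
  note r = padic_rel_def padic_null_def
    padic_Cauchy_add[OF prime_card] padic_Cauchy_mult[OF prime_card]
    padic_Cauchy_minus[OF prime_card] padic_Cauchy_const
  fix a b c :: "'a padic"
  show "a + b = b + a" by transfer (simp add: ac_simps r)
  show "(a + b) + c = a + (b + c)" by transfer (simp add: ac_simps r)
  show "0 + a = a" by transfer (simp add: r)
  show "- a + a = 0" by transfer (simp add: r)
  show "a - b = a + - b" by (rule minus_padic_def)
  show "(a * b) * c = a * (b * c)" by transfer (simp add: ac_simps r)
  show "a * b = b * a" by transfer (simp add: ac_simps r)
  show "1 * a = a" by transfer (simp add: r)
  show "(a + b) * c = a * c + b * c" by transfer (simp add: distrib_right r)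
  show "(0::'a padic) \<noteq> 1" by transfer (simp add: r LIMSEQ_const_iff)
  have *: "padic_null CARD('a) (\<lambda>n. inverse (X n) * X n - 1)"
    if X: "padic_Cauchy CARD('a) X" "\<not> padic_null CARD('a) X" for X
  proof -
    obtain b k where b: "b > 0" "\<And>n. n \<ge> k \<Longrightarrow> rat_pabs CARD('a) (X n) > b"
      using padic_Cauchy_not_null[OF prime_card X] by blast
    have "inverse (X n) * X n - 1 = 0" if "n \<ge> k" for n
      using b(2)[OF that] b(1) by (cases "X n = 0") auto
    then have "\<forall>\<^sub>F n in sequentially. rat_pabs CARD('a) (inverse (X n) * X n - 1) = 0"
      unfolding eventually_sequentially using rat_pabs_0 by metis
    then show ?thesis unfolding padic_null_def by (rule tendsto_eventually)
  qed
  show "inverse a * a = 1" if "a \<noteq> 0"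
    using that by transfer
      (auto simp: padic_rel_def * padic_Cauchy_const padic_Cauchy_mult[OF prime_card] padic_Cauchy_inverse[OF prime_card])
  show "a div b = a * inverse b" by (rule divide_padic_def)
  show "inverse (0::'a padic) = 0" by transfer (simp add: r)
qed

end

lift_definition padic_norm :: "'p::prime_card padic \<Rightarrow> real" is "\<lambda>X. lim (\<lambda>n. rat_pabs CARD('p) (X n))"
proof -
  fix X Y assume XY: "padic_rel CARD('p) X Y"
  note l = lim_rat_pabs[OF prime_card[where ?'a = 'p]]
  have "(\<lambda>n. rat_pabs CARD('p) (X n) - rat_pabs CARD('p) (Y n)) \<longlonglongrightarrow> 0"
    by (rule Lim_null_comparison[where g = "\<lambda>n. rat_pabs CARD('p) (X n - Y n)"])
       (use XY in \<open>auto simp: padic_rel_def padic_null_def rat_pabs_triangle_diff[OF prime_card]\<close>)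
  moreover have "(\<lambda>n. rat_pabs CARD('p) (X n) - rat_pabs CARD('p) (Y n)) \<longlonglongrightarrow>
      lim (\<lambda>n. rat_pabs CARD('p) (X n)) - lim (\<lambda>n. rat_pabs CARD('p) (Y n))"
    using XY by (intro tendsto_diff l) (auto simp: padic_rel_def)
  ultimately show "lim (\<lambda>n. rat_pabs CARD('p) (X n)) = lim (\<lambda>n. rat_pabs CARD('p) (Y n))"
    using LIMSEQ_unique by fastforce
qed

lemma padic_norm_eq_0_iff [simp]: "padic_norm x = 0 \<longleftrightarrow> x = 0"
proof (transfer fixing: , goal_cases)
  case (1 X)
  then have X: "padic_Cauchy CARD('a) X" by (simp add: padic_rel_def)
  have "lim (\<lambda>n. rat_pabs CARD('a) (X n)) = 0 \<longleftrightarrow> padic_null CARD('a) X"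
    unfolding padic_null_def
  proof
    assume "lim (\<lambda>n. rat_pabs CARD('a) (X n)) = 0"
    then show "(\<lambda>n. rat_pabs CARD('a) (X n)) \<longlonglongrightarrow> 0" using lim_rat_pabs[OF prime_card X] by simp
  qed (rule limI)
  then show ?case using X by (simp add: padic_rel_def padic_Cauchy_const)
qed

lemma padic_norm_0 [simp]: "padic_norm 0 = 0"
  by simp

lemma padic_norm_minus [simp]: "padic_norm (- x) = padic_norm x"
  by transfer simp

lemma padic_norm_minus_commute: "padic_norm (x - y) = padic_norm (y - x)"
  using padic_norm_minus[of "x - y"] by simp

lemma padic_norm_mult: "padic_norm (x * y) = padic_norm x * padic_norm y"
proof (transfer fixing: , goal_cases)
  case (1 X Y)
  then have "padic_Cauchy CARD('a) X" "padic_Cauchy CARD('a) Y" by (auto simp: padic_rel_def)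
  then show ?case
    unfolding rat_pabs_mult[OF prime_card] by (intro limI tendsto_mult lim_rat_pabs[OF prime_card])
qed

lemma padic_norm_ultra: "padic_norm (x + y) \<le> max (padic_norm x) (padic_norm y)"
proof (transfer fixing: , goal_cases)
  case (1 X Y)
  then have X: "padic_Cauchy CARD('a) X" and Y: "padic_Cauchy CARD('a) Y" by (auto simp: padic_rel_def)
  show ?case
    by (rule LIMSEQ_le[OF lim_rat_pabs[OF prime_card padic_Cauchy_add[OF prime_card X Y]]
          tendsto_max[OF lim_rat_pabs[OF prime_card X] lim_rat_pabs[OF prime_card Y]]])
       (auto simp: rat_pabs_ultra[OF prime_card])
qed

lemma padic_norm_nonneg [simp]: "padic_norm x \<ge> 0"
  using padic_norm_ultra[of x "- x"] by simp

lemma padic_of_nat: "(of_nat k :: 'p::prime_card padic) = abs_padic (\<lambda>n. of_nat k)"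
proof (induction k)
  case 0 show ?case by (simp add: zero_padic_def)
next
  case (Suc k)
  then show ?case
    by (simp add: one_padic_def plus_padic.abs_eq padic_rel_refl[OF prime_card] padic_Cauchy_const)
qed

instance padic :: (prime_card) field_char_0
proof
  show "inj (of_nat :: nat \<Rightarrow> 'a padic)"
  proof (rule injI)
    fix k l assume "(of_nat k :: 'a padic) = of_nat l"
    then have "padic_rel CARD('a) (\<lambda>n. of_nat k) (\<lambda>n. of_nat l)"
      unfolding padic_of_nat
      by (simp add: abs_padic_eq_iff padic_Cauchy_const)
    then have "rat_pabs CARD('a) (of_nat k - of_nat l) = 0"
      by (simp add: padic_rel_def padic_null_def LIMSEQ_const_iff)
    then show "k = l" by (simp add: rat_pabs_eq_0_iff[OF prime_card])
  qed
qed

instantiation padic :: (prime_card) metric_space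
begin

definition dist_padic :: "'a padic \<Rightarrow> 'a padic \<Rightarrow> real" where
  "dist_padic x y = padic_norm (x - y)"

definition uniformity_padic :: "('a padic \<times> 'a padic) filter" where
  "uniformity_padic = (INF e\<in>{0 <..}. principal {(x, y). dist x y < e})"

definition open_padic :: "'a padic set \<Rightarrow> bool" where
  "open_padic U = (\<forall>x\<in>U. eventually (\<lambda>(x', y). x' = x \<longrightarrow> y \<in> U) uniformity)"

instance
proof
  fix x y z :: "'a padic"
  show "dist x y = 0 \<longleftrightarrow> x = y" by (simp add: dist_padic_def)
  have "padic_norm (x - y) \<le> max (padic_norm (x - z)) (padic_norm (z - y))"
    using padic_norm_ultra[of "x - z" "z - y"] by simp
  then show "dist x y \<le> dist x z + dist y z"
    unfolding dist_padic_def padic_norm_minus_commute[of y z]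
    using padic_norm_nonneg[of "x - z"] padic_norm_nonneg[of "z - y"] by linarith
qed (simp_all add: uniformity_padic_def open_padic_def)

end


section \<open>Morita's p-adic gamma function\<close>

text \<open>
  On the naturals, \<open>\<Gamma>\<^sub>p(n) = (-1)\<^sup>n \<Prod> {j. 0 < j < n, p does not divide j}\<close>; on the p-adic integers
  \<open>\<Gamma>\<^sub>p(x)\<close> is the limit of these values as naturals \<open>n\<close> tend p-adically to \<open>x\<close>.
  For \<open>padic_norm x > 1\<close> the filter is trivial and the value is irrelevant.
\<close>

definition morita_factorial :: "nat \<Rightarrow> 'p::prime_card padic" where
  "morita_factorial n = (-1) ^ n * (\<Prod>j | 0 < j \<and> j < n \<and> \<not> CARD('p) dvd j. of_nat j)"

definition padic_Gamma :: "'p::prime_card padic \<Rightarrow> 'p padic" where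
  "padic_Gamma x = Lim (filtercomap of_nat (nhds x)) morita_factorial"


section \<open>The Teichmueller character\<close>

text \<open>
  Multiplicative characters of \<open>\<F>\<^sub>p\<close>, the trivial one included, vanish at 0; this is why
  \<open>character_power \<eta> 0 0 = 0\<close>.
\<close>

definition teichmueller :: "'p::prime_card mod_ring \<Rightarrow> 'p padic" where
  "teichmueller x = (if x = 0 then 0
     else THE z. z ^ (CARD('p) - 1) = 1 \<and> padic_norm (z - of_int (to_int_mod_ring x)) < 1)"

definition character_power :: "('p::prime_card mod_ring \<Rightarrow> 'p padic) \<Rightarrow> nat \<Rightarrow> 'p mod_ring \<Rightarrow> 'p padic" where
  "character_power \<eta> j x = (if x = 0 then 0 else \<eta> x ^ j)"

definition teichmueller_bar :: "'p::prime_card mod_ring \<Rightarrow> 'p padic" where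
  "teichmueller_bar x = inverse (teichmueller x)"


section \<open>The p-adic hypergeometric function\<close>

text \<open>
  \<open>padic_G as bs s\<close> is \<open>\<^sub>nG\<^sub>n[as; bs | s]\<^sub>p\<close>, where \<open>n = length as = length bs\<close>, \<open>p = CARD('p)\<close>,
  and the parameters are rationals with denominators prime to \<open>p\<close>.
\<close>

definition padic_G :: "rat list \<Rightarrow> rat list \<Rightarrow> 'p::prime_card mod_ring \<Rightarrow> 'p padic" where
  "padic_G as bs s =
    (let p = CARD('p); n = length as; \<Gamma> = (\<lambda>q::rat. padic_Gamma (of_rat q) :: 'p padic) in
     - 1 / (of_nat p - 1) *
     (\<Sum>j = 0..p - 2.
        (-1) ^ (j * n) * character_power teichmueller_bar j s *
        (\<Prod>i<n.
           let x = of_nat j / (of_nat p - 1); a = as ! i; b = bs ! i in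
           \<Gamma> (frac (a - x)) / \<Gamma> (frac a) * (\<Gamma> (frac (- b + x)) / \<Gamma> (frac (- b))) *
           (- of_nat p) powi (- \<lfloor>frac a - x\<rfloor> - \<lfloor>frac (- b) + x\<rfloor>))))"

end

theory Submission
  imports Defs "HOL-Computational_Algebra.Formal_Laurent_Series"
begin

text \<open>
  Morita's gamma function enters only through its functional equation, reflection and duplication
  formulas, and the Gross--Koblitz formula for Jacobi sums. The latter is proved inside the p-adic
  numbers: Dwork's splitting function is evaluated at a formal root \<open>\<pi>\<close> of \<open>x^(p-1) = -p\<close>, where it
  defines an additive character whose Gauss sums are computed by a telescoping of Dwork's trace.
  By Gross--Koblitz and duplication, each factor of the sums over \<open>j\<close> is the Mellin transform of an
  explicit function on \<open>\<F>\<^sub>p\<close> built from the quadratic character \<open>\<phi>\<close>; Fourier inversion then turns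
  both sides into multiple character sums. These agree up to a correction in \<open>p\<close> because both can be
  brought to a common bridge sum by rational substitutions, an elementary form of Whipple's
  quadratic transformation.
\<close>

section \<open>The field of p-adic numbers\<close>

text \<open>The obstacle is that Gauss sums in general lie outside the field of p-adic numbers: each
  is a p-adic number times a power of pi. Only Jacobi sums, in which these powers combine to powers
  of -p, remain in the end, so p - 1 coordinates of a value at pi can replace the ramified
  extension. The exponent of Dwork's series exp(x + x^p/p) vanishes at pi although the value of the
  series there is not 1: evaluation at pi commutes with exp only for smaller exponents. This is why
  a sum of Teichmueller representatives may be changed by a multiple of p without changing the
  value. The two terms linear in p come from exceptional points. With x = (1 - v)/(1 + v), the
  argument -4x/(1 + x)^2 of the quadratic transformation is v^2 - 1, so summing over v weights u =
  v^2 - 1 by 1 + phi(1 + u). The second weight gives the hypergeometric convolution, the first a sum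
  equal to -p phi(-1). The other term comes from the ramification point x = 1, where 1 + x = 2
  brings in phi(2), and s(p) = phi(2) by duplication at 1/2.\<close>

lemma abs_padic_cases:
  obtains X where "padic_Cauchy CARD('p) X" "(x :: 'p::prime_card padic) = abs_padic X"
proof -
  have "padic_rel CARD('p) (rep_padic x) (rep_padic x)"
    using Quotient_rep_reflp[OF Quotient_padic] by blast
  moreover have "abs_padic (rep_padic x) = x"
    using Quotient_abs_rep[OF Quotient_padic] by blast
  ultimately show ?thesis using that by (auto simp: padic_rel_def)
qed

lemma padic_of_int: "(of_int k :: 'p::prime_card padic) = abs_padic (\<lambda>n. of_int k)"
proof (cases k rule: int_cases2)
  case (nonneg n)
  then show ?thesis by (simp add: padic_of_nat)
next
  case (nonpos n)
  then show ?thesis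
    by (simp add: padic_of_nat uminus_padic.abs_eq padic_rel_refl[OF prime_card] padic_Cauchy_const)
qed

lemma padic_of_rat: "(of_rat q :: 'p::prime_card padic) = abs_padic (\<lambda>n. q)"
proof -
  obtain a b where q: "quotient_of q = (a, b)" by (cases "quotient_of q")
  have b: "b > 0" using quotient_of_denom_pos[OF q] .
  have e: "q = of_int a / of_int b" using quotient_of_div[OF q] .
  have "abs_padic (\<lambda>n. q) * (of_int b :: 'p padic) = abs_padic (\<lambda>n. q * of_int b)"
    unfolding padic_of_int
    by (simp add: times_padic.abs_eq padic_rel_refl[OF prime_card] padic_Cauchy_const)
  also have "q * of_int b = of_int a" using b e by simp
  also have "abs_padic (\<lambda>n. rat_of_int a) = (of_int a :: 'p padic)" by (rule padic_of_int[symmetric])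
  finally show ?thesis using b by (simp add: e of_rat_divide field_simps)
qed

lemma padic_norm_abs:
  "padic_Cauchy CARD('p) X \<Longrightarrow>
    padic_norm (abs_padic X :: 'p::prime_card padic) = lim (\<lambda>n. rat_pabs CARD('p) (X n))"
  by (simp add: padic_norm.abs_eq padic_rel_refl[OF prime_card])

lemma padic_norm_of_rat: "padic_norm (of_rat q :: 'p::prime_card padic) = rat_pabs CARD('p) q"
  unfolding padic_of_rat by (simp add: padic_norm_abs padic_Cauchy_const)

lemma padic_norm_1 [simp]: "padic_norm (1 :: 'p::prime_card padic) = 1"
  using padic_norm_of_rat[of 1] by simp

lemma padic_norm_power: "padic_norm (x ^ n) = padic_norm x ^ n"
  by (induction n) (auto simp: padic_norm_mult)

lemma padic_norm_inverse: "padic_norm (inverse x) = inverse (padic_norm x)"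
proof (cases "x = 0")
  case False
  then have "padic_norm x * padic_norm (inverse x) = 1" by (simp flip: padic_norm_mult)
  then show ?thesis by (rule inverse_unique[symmetric])
qed simp

lemma padic_norm_divide: "padic_norm (x / y) = padic_norm x / padic_norm y"
  by (simp add: divide_inverse padic_norm_mult padic_norm_inverse)

lemma padic_norm_ultra_diff: "padic_norm (x - y) \<le> max (padic_norm x) (padic_norm y)"
  using padic_norm_ultra[of x "- y"] by simp

lemma padic_norm_add_le: "padic_norm x \<le> c \<Longrightarrow> padic_norm y \<le> c \<Longrightarrow> padic_norm (x + y) \<le> c"
  using padic_norm_ultra[of x y] by linarith

lemma padic_norm_diff_le: "padic_norm x \<le> c \<Longrightarrow> padic_norm y \<le> c \<Longrightarrow> padic_norm (x - y) \<le> c"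
  using padic_norm_ultra_diff[of x y] by linarith

lemma padic_norm_diff_trans:
  "padic_norm (x - y) \<le> c \<Longrightarrow> padic_norm (y - z) \<le> c \<Longrightarrow> padic_norm (x - z) \<le> c"
  using padic_norm_add_le[of "x - y" c "y - z"] by simp

lemma padic_norm_add_less: "padic_norm x < c \<Longrightarrow> padic_norm y < c \<Longrightarrow> padic_norm (x + y) < c"
  using padic_norm_ultra[of x y] by linarith

lemma padic_norm_diff_less: "padic_norm x < c \<Longrightarrow> padic_norm y < c \<Longrightarrow> padic_norm (x - y) < c"
  using padic_norm_ultra_diff[of x y] by linarith

lemma padic_norm_sum_le:
  "c \<ge> 0 \<Longrightarrow> (\<And>i. i \<in> A \<Longrightarrow> padic_norm (f i) \<le> c) \<Longrightarrow> padic_norm (sum f A) \<le> c"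
  by (induction A rule: infinite_finite_induct) (auto intro: padic_norm_add_le)

lemma padic_norm_eq_of_diff_less:
  assumes "padic_norm (x - y) < padic_norm x" shows "padic_norm y = padic_norm x"
proof (rule antisym)
  show "padic_norm y \<le> padic_norm x"
    using padic_norm_ultra_diff[of x "x - y"] assms by simp
  show "padic_norm x \<le> padic_norm y"
    using padic_norm_ultra[of "x - y" y] assms by simp
qed

lemma padic_norm_mult_le: "padic_norm x \<le> 1 \<Longrightarrow> padic_norm y \<le> c \<Longrightarrow> padic_norm (x * y) \<le> c"
  using mult_mono[of "padic_norm x" 1 "padic_norm y" c] by (simp add: padic_norm_mult)

lemma padic_norm_power_le_1: "padic_norm x \<le> 1 \<Longrightarrow> padic_norm (x ^ n) \<le> 1"
  by (simp add: padic_norm_power power_le_one)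

section \<open>Norms of integers and divisibility by powers of p\<close>

lemma padic_norm_of_int_le_1 [simp]: "padic_norm (of_int k :: 'p::prime_card padic) \<le> 1"
proof (induction k rule: int_induct[of _ 0])
  case (step1 i)
  then show ?case by (simp add: padic_norm_add_le)
next
  case (step2 i)
  then show ?case by (simp add: padic_norm_diff_le)
qed simp

lemma padic_norm_of_nat_le_1 [simp]: "padic_norm (of_nat k :: 'p::prime_card padic) \<le> 1"
  using padic_norm_of_int_le_1[of "int k"] by simp

lemma padic_norm_of_int:
  "k \<noteq> 0 \<Longrightarrow> padic_norm (of_int k :: 'p::prime_card padic) = inverse (real CARD('p)) ^ multiplicity (int CARD('p)) k"
  using padic_norm_of_rat[of "of_int k", where ?'p = 'p]
    rat_pabs_fraction[OF prime_card, of k 1, where ?'a1 = 'p]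
  by simp

lemma prime_card_gt_1: "CARD('p::prime_card) > 1" and prime_card_ge_2: "CARD('p) \<ge> 2"
  using prime_gt_1_nat[OF prime_card[where ?'a = 'p]] by auto

lemma Suc_0_less_prime_card [simp]: "Suc 0 < CARD('p::prime_card)"
  using prime_card_gt_1 by simp

lemma prime_card_neq_Suc_0 [simp]: "CARD('p::prime_card) \<noteq> Suc 0"
  using Suc_0_less_prime_card[where ?'p = 'p] by linarith

lemma of_nat_card_minus_1_neq_0 [simp]: "(of_nat (CARD('p::prime_card) - 1) :: 'q::prime_card padic) \<noteq> 0"
  unfolding of_nat_eq_0_iff using prime_card_gt_1[where ?'p = 'p] by linarith

lemma padic_norm_card [simp]: "padic_norm (of_nat CARD('p) :: 'p::prime_card padic) = inverse (real CARD('p))"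
proof -
  have "\<not> is_unit (int CARD('p))" using prime_card_gt_1[where ?'p = 'p] by simp
  then have "multiplicity (int CARD('p)) (int CARD('p)) = 1"
    using multiplicity_self[of "int CARD('p)"] by simp
  then show ?thesis
    using padic_norm_of_int[of "int CARD('p)", where ?'p = 'p] by simp
qed

lemma padic_norm_of_int_le_iff:
  "padic_norm (of_int k :: 'p::prime_card padic) \<le> inverse (real CARD('p)) ^ n \<longleftrightarrow> int CARD('p) ^ n dvd k"
proof (cases "k = 0")
  case False
  have p: "real CARD('p) > 1" using prime_card_gt_1[where ?'p = 'p] by simp
  have "\<not> is_unit (int CARD('p))" using prime_card_gt_1[where ?'p = 'p] by simp
  then have "int CARD('p) ^ n dvd k \<longleftrightarrow> n \<le> multiplicity (int CARD('p)) k"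
    using False by (intro power_dvd_iff_le_multiplicity) auto
  also have "\<dots> \<longleftrightarrow> inverse (real CARD('p)) ^ multiplicity (int CARD('p)) k \<le> inverse (real CARD('p)) ^ n"
    using p by (subst power_decreasing_iff) (auto simp: field_simps)
  finally show ?thesis unfolding padic_norm_of_int[OF False] ..
qed auto

lemma padic_norm_of_nat_le_iff:
  "padic_norm (of_nat k :: 'p::prime_card padic) \<le> inverse (real CARD('p)) ^ n \<longleftrightarrow> CARD('p) ^ n dvd k"
proof -
  have "int CARD('p) ^ n dvd int k \<longleftrightarrow> CARD('p) ^ n dvd k"
    by (metis int_dvd_int_iff of_nat_power)
  then show ?thesis using padic_norm_of_int_le_iff[of "int k" n, where ?'p = 'p] by simp
qed

lemma padic_norm_of_int_eq_1:
  assumes "\<not> int CARD('p) dvd k" shows "padic_norm (of_int k :: 'p::prime_card padic) = 1"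
proof -
  have "k \<noteq> 0" using assms by auto
  then show ?thesis using assms by (simp add: padic_norm_of_int not_dvd_imp_multiplicity_0)
qed

lemma padic_norm_of_nat_eq_1:
  assumes "\<not> CARD('p) dvd k" shows "padic_norm (of_nat k :: 'p::prime_card padic) = 1"
  using padic_norm_of_int_eq_1[of "int k", where ?'p = 'p] assms by simp

section \<open>Limits, completeness and ultrametric series\<close>

lemma dist_padic: "dist x y = padic_norm (x - y)"
  by (rule dist_padic_def)

lemma tendsto_padic_iff:
  "((f :: _ \<Rightarrow> 'p::prime_card padic) \<longlongrightarrow> l) F \<longleftrightarrow> ((\<lambda>x. padic_norm (f x - l)) \<longlongrightarrow> 0) F"
  by (subst tendsto_dist_iff) (simp add: dist_padic)

lemma padic_tendstoI:
  assumes "\<And>n. padic_norm (f n - l) \<le> g n" "g \<longlonglongrightarrow> 0" shows "f \<longlonglongrightarrow> (l :: 'p::prime_card padic)"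
  unfolding tendsto_padic_iff
  by (rule tendsto_sandwich[OF _ _ tendsto_const assms(2)]) (auto simp: assms)

text \<open>Continuity of addition here, and of multiplication in the next instance, makes the
  generic limit rules for sums and products available.\<close>

instance padic :: (prime_card) topological_ab_group_add
proof
  fix a b :: "'a padic"
  show "((\<lambda>x. fst x + snd x) \<longlongrightarrow> a + b) (nhds a \<times>\<^sub>F nhds b)"
    unfolding tendsto_padic_iff
  proof (rule tendsto_sandwich[OF _ _ tendsto_const])
    have "((\<lambda>x. fst x) \<longlongrightarrow> a) (nhds a \<times>\<^sub>F nhds b)" "((\<lambda>x. snd x) \<longlongrightarrow> b) (nhds a \<times>\<^sub>F nhds b)"
      by (auto intro: filterlim_fst filterlim_snd)
    then show "((\<lambda>x. padic_norm (fst x - a) + padic_norm (snd x - b)) \<longlongrightarrow> 0) (nhds a \<times>\<^sub>F nhds b)"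
      unfolding tendsto_padic_iff by (rule tendsto_add_zero)
    have "padic_norm (fst x + snd x - (a + b)) \<le> padic_norm (fst x - a) + padic_norm (snd x - b)" for x
    proof -
      have e: "fst x + snd x - (a + b) = (fst x - a) + (snd x - b)" by simp
      show ?thesis unfolding e
        using padic_norm_ultra[of "fst x - a" "snd x - b"] padic_norm_nonneg[of "fst x - a"]
          padic_norm_nonneg[of "snd x - b"] by linarith
    qed
    then show "\<forall>\<^sub>F x in nhds a \<times>\<^sub>F nhds b.
      padic_norm (fst x + snd x - (a + b)) \<le> padic_norm (fst x - a) + padic_norm (snd x - b)" by simp
  qed simp
  show "(uminus \<longlongrightarrow> - a) (nhds a)"
    unfolding tendsto_padic_iff
  proof -
    have "((\<lambda>x. x) \<longlongrightarrow> a) (nhds a)" by (simp add: filterlim_ident)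
    then have "((\<lambda>x. padic_norm (x - a)) \<longlongrightarrow> 0) (nhds a)" unfolding tendsto_padic_iff .
    moreover have "padic_norm (- x - - a) = padic_norm (x - a)" for x
      using padic_norm_minus[of "x - a"] by simp
    ultimately show "((\<lambda>x. padic_norm (- x - - a)) \<longlongrightarrow> 0) (nhds a)" by simp
  qed
qed

instance padic :: (prime_card) topological_comm_monoid_mult
proof
  fix a b :: "'a padic"
  let ?F = "nhds a \<times>\<^sub>F nhds b"
  show "((\<lambda>x. fst x * snd x) \<longlongrightarrow> a * b) ?F"
    unfolding tendsto_padic_iff
  proof (rule tendsto_sandwich[OF _ _ tendsto_const])
    have "((\<lambda>x. fst x) \<longlongrightarrow> a) ?F" "((\<lambda>x. snd x) \<longlongrightarrow> b) ?F"
      by (auto intro: filterlim_fst filterlim_snd)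
    then have t: "((\<lambda>x. padic_norm (fst x - a)) \<longlongrightarrow> 0) ?F" "((\<lambda>x. padic_norm (snd x - b)) \<longlongrightarrow> 0) ?F"
      unfolding tendsto_padic_iff by auto
    show "((\<lambda>x. padic_norm (fst x - a) * padic_norm (snd x - b) + padic_norm (fst x - a) * padic_norm b
        + padic_norm a * padic_norm (snd x - b)) \<longlongrightarrow> 0) ?F"
      by (intro tendsto_add_zero tendsto_mult_zero tendsto_mult_left_zero tendsto_mult_right_zero t)
    have "padic_norm (fst x * snd x - a * b) \<le> padic_norm (fst x - a) * padic_norm (snd x - b) +
      padic_norm (fst x - a) * padic_norm b + padic_norm a * padic_norm (snd x - b)" for x
    proof -
      let ?u = "fst x - a" and ?v = "snd x - b"
      have e: "fst x * snd x - a * b = (?u * ?v + ?u * b) + a * ?v" by (simp add: algebra_simps)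
      have "padic_norm (\<dots>) \<le> max (max (padic_norm (?u * ?v)) (padic_norm (?u * b))) (padic_norm (a * ?v))"
        using padic_norm_ultra[of "?u * ?v + ?u * b" "a * ?v"] padic_norm_ultra[of "?u * ?v" "?u * b"]
        by linarith
      also have "\<dots> \<le> padic_norm (?u * ?v) + padic_norm (?u * b) + padic_norm (a * ?v)"
        using padic_norm_nonneg[of "?u * ?v"] padic_norm_nonneg[of "?u * b"] padic_norm_nonneg[of "a * ?v"]
        by linarith
      finally show ?thesis unfolding e padic_norm_mult .
    qed
    then show "\<forall>\<^sub>F x in ?F. padic_norm (fst x * snd x - a * b) \<le>
      padic_norm (fst x - a) * padic_norm (snd x - b) +
      padic_norm (fst x - a) * padic_norm b + padic_norm a * padic_norm (snd x - b)" by simp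
  qed simp
qed

lemma padic_tendsto_power:
  "(f \<longlongrightarrow> (l :: 'p::prime_card padic)) F \<Longrightarrow> ((\<lambda>x. f x ^ n) \<longlongrightarrow> l ^ n) F"
  by (induction n) (auto intro: tendsto_mult)

lemma abs_padic_limit:
  assumes X: "padic_Cauchy CARD('p) X"
  shows "(\<lambda>n. of_rat (X n)) \<longlonglongrightarrow> (abs_padic X :: 'p::prime_card padic)"
proof (rule metric_LIMSEQ_I)
  fix e :: real assume "e > 0"
  then have "e / 2 > 0" by simp
  then obtain k where k: "\<forall>m\<ge>k. \<forall>n\<ge>k. rat_pabs CARD('p) (X m - X n) < e / 2"
    using X unfolding padic_Cauchy_def by blast
  have "dist (of_rat (X n)) (abs_padic X :: 'p padic) < e" if n: "n \<ge> k" for n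
  proof -
    have C: "padic_Cauchy CARD('p) (\<lambda>m. X n - X m)"
      using padic_Cauchy_add[OF prime_card padic_Cauchy_const padic_Cauchy_minus[OF prime_card X], of "X n"]
      by simp
    have "of_rat (X n) - (abs_padic X :: 'p padic) = abs_padic (\<lambda>m. X n - X m)"
      unfolding padic_of_rat
      by (simp add: minus_padic_def uminus_padic.abs_eq plus_padic.abs_eq padic_rel_refl[OF prime_card] padic_Cauchy_const
            padic_Cauchy_minus[OF prime_card] X)
    then have "dist (of_rat (X n)) (abs_padic X :: 'p padic) = lim (\<lambda>m. rat_pabs CARD('p) (X n - X m))"
      by (simp add: dist_padic padic_norm_abs C)
    also have "\<dots> \<le> e / 2"
      by (rule LIMSEQ_le_const2[OF lim_rat_pabs[OF prime_card C]]) (use k n in \<open>auto intro!: exI[of _ k] less_imp_le\<close>)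
    finally show ?thesis using \<open>e > 0\<close> by simp
  qed
  then show "\<exists>no. \<forall>n\<ge>no. dist (of_rat (X n)) (abs_padic X :: 'p padic) < e" by blast
qed

lemma padic_rat_dense:
  assumes "e > 0" obtains q where "padic_norm ((x :: 'p::prime_card padic) - of_rat q) < e"
proof -
  obtain X where X: "padic_Cauchy CARD('p) X" "x = abs_padic X" by (rule abs_padic_cases)
  from metric_LIMSEQ_D[OF abs_padic_limit[OF X(1), folded X(2)] assms]
  obtain n where "dist (of_rat (X n)) x < e" by auto
  then show ?thesis by (intro that) (simp add: dist_padic padic_norm_minus_commute)
qed

text \<open>Each \<open>Y n\<close> is replaced by a rational within 1/(n+1). These rationals form a
  Cauchy sequence, and its class is the limit of \<open>Y\<close>.\<close>

instance padic :: (prime_card) complete_space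
proof
  fix Y :: "nat \<Rightarrow> 'a padic" assume Y: "Cauchy Y"
  have "\<exists>q. padic_norm (Y n - of_rat q) < inverse (real (Suc n))" for n
    using padic_rat_dense[of "inverse (real (Suc n))" "Y n"] by auto
  then obtain X where X: "\<And>n. padic_norm (Y n - of_rat (X n)) < inverse (real (Suc n))" by metis
  have "padic_Cauchy CARD('a) X"
    unfolding padic_Cauchy_def
  proof (intro allI impI)
    fix e :: real assume e: "e > 0"
    obtain k where k: "\<And>m n. m \<ge> k \<Longrightarrow> n \<ge> k \<Longrightarrow> dist (Y m) (Y n) < e" using Y e unfolding Cauchy_def by blast
    obtain l where l: "inverse (real (Suc l)) < e" using reals_Archimedean[OF e] by blast
    have "rat_pabs CARD('a) (X m - X n) < e" if mn: "m \<ge> max k l" "n \<ge> max k l" for m n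
    proof -
      have small: "padic_norm (Y i - of_rat (X i)) < e" if "i \<ge> l" for i
      proof -
        have "inverse (real (Suc i)) \<le> inverse (real (Suc l))" using that by (simp add: field_simps)
        then show ?thesis using X[of i] l by linarith
      qed
      have "of_rat (X m - X n) = (Y n - of_rat (X n)) - (Y m - of_rat (X m)) + (Y m - Y n)"
        by (simp add: of_rat_diff)
      then have "rat_pabs CARD('a) (X m - X n) \<le>
          max (max (padic_norm (Y n - of_rat (X n))) (padic_norm (Y m - of_rat (X m)))) (padic_norm (Y m - Y n))"
        using padic_norm_ultra[of "(Y n - of_rat (X n)) - (Y m - of_rat (X m))" "Y m - Y n"]
          padic_norm_ultra_diff[of "Y n - of_rat (X n)" "Y m - of_rat (X m)"]
        by (simp flip: padic_norm_of_rat)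
      also have "\<dots> < e" using small[of m] small[of n] k[of m n] mn by (simp add: dist_padic)
      finally show ?thesis .
    qed
    then show "\<exists>k. \<forall>m\<ge>k. \<forall>n\<ge>k. rat_pabs CARD('a) (X m - X n) < e" by blast
  qed
  then have "(\<lambda>n. of_rat (X n)) \<longlonglongrightarrow> (abs_padic X :: 'a padic)" by (rule abs_padic_limit)
  moreover have "(\<lambda>n. Y n - of_rat (X n)) \<longlonglongrightarrow> 0"
    by (rule padic_tendstoI[where g = "\<lambda>n. inverse (real (Suc n))"])
       (use less_imp_le[OF X] LIMSEQ_inverse_real_of_nat in \<open>simp_all del: of_nat_Suc\<close>)
  ultimately have "(\<lambda>n. of_rat (X n) + (Y n - of_rat (X n))) \<longlonglongrightarrow> abs_padic X + 0" by (rule tendsto_add)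
  then show "convergent Y" by (auto simp: convergent_def)
qed

lemma padic_convergentI:
  fixes f :: "nat \<Rightarrow> 'p::prime_card padic"
  assumes "\<And>n m. n \<le> m \<Longrightarrow> padic_norm (f m - f n) \<le> g n" "g \<longlonglongrightarrow> 0"
  shows "convergent f"
proof -
  have "Cauchy f"
  proof (rule metric_CauchyI)
    fix e :: real assume "e > 0"
    then obtain k where k: "\<And>n. n \<ge> k \<Longrightarrow> \<bar>g n\<bar> < e"
      using LIMSEQ_D[OF assms(2)] by (metis diff_zero real_norm_def)
    have "dist (f m) (f n) < e" if "m \<ge> k" "n \<ge> k" for m n
    proof -
      have "dist (f m) (f n) \<le> g (min m n)"
        using assms(1)[of m n] assms(1)[of n m] padic_norm_minus_commute[of "f m" "f n"]
        by (cases "m \<le> n") (auto simp: dist_padic min_def)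
      also have "g (min m n) < e" using k[of "min m n"] that by auto
      finally show ?thesis .
    qed
    then show "\<exists>M. \<forall>m\<ge>M. \<forall>n\<ge>M. dist (f m) (f n) < e" by blast
  qed
  then show ?thesis by (rule Cauchy_convergent)
qed

text \<open>In an ultrametric a tail is no larger than its largest term, so terms tending to 0 are
  enough; \<open>g\<close> is decreasing so that it bounds whole tails.\<close>

lemma padic_summable:
  fixes f :: "nat \<Rightarrow> 'p::prime_card padic"
  assumes "\<And>n. padic_norm (f n) \<le> g n" "decseq g" "g \<longlonglongrightarrow> 0"
  shows "summable f"
  unfolding summable_iff_convergent
proof (rule padic_convergentI[OF _ assms(3)])
  fix n m :: nat assume "n \<le> m"
  then have "(\<Sum>i<m. f i) - (\<Sum>i<n. f i) = sum f {n..<m}"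
    by (simp flip: atLeast0LessThan add: sum_diff_nat_ivl)
  moreover have "padic_norm (sum f {n..<m}) \<le> g n"
  proof (rule padic_norm_sum_le)
    show "g n \<ge> 0" using assms(1)[of n] padic_norm_nonneg[of "f n"] by linarith
    fix i assume "i \<in> {n..<m}"
    then show "padic_norm (f i) \<le> g n" using assms(1)[of i] assms(2) by (auto simp: decseq_def intro: order_trans)
  qed
  ultimately show "padic_norm ((\<Sum>i<m. f i) - (\<Sum>i<n. f i)) \<le> g n" by simp
qed

lemma padic_norm_limit:
  assumes "f \<longlonglongrightarrow> (l :: 'p::prime_card padic)" shows "(\<lambda>n. padic_norm (f n)) \<longlonglongrightarrow> padic_norm l"
  using tendsto_dist[OF assms tendsto_const[of 0]] by (simp add: dist_padic)

lemma padic_norm_limit_le: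
  "f \<longlonglongrightarrow> (l :: 'p::prime_card padic) \<Longrightarrow> (\<And>n. padic_norm (f n) \<le> c) \<Longrightarrow> padic_norm l \<le> c"
  by (rule LIMSEQ_le_const2[OF padic_norm_limit]) auto

lemma padic_norm_suminf_le:
  fixes f :: "nat \<Rightarrow> 'p::prime_card padic"
  assumes "summable f" "\<And>n. padic_norm (f n) \<le> c" shows "padic_norm (suminf f) \<le> c"
proof -
  have "c \<ge> 0" using assms(2)[of 0] padic_norm_nonneg[of "f 0"] by linarith
  then show ?thesis
    by (intro padic_norm_limit_le[OF summable_LIMSEQ[OF assms(1)]] padic_norm_sum_le assms(2))
qed

lemma inverse_card_pos [simp]: "inverse (real CARD('p::prime_card)) > 0"
  using prime_card_gt_1[where ?'p = 'p] by simp

lemma inverse_card_less_1 [simp]: "inverse (real CARD('p::prime_card)) < 1"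
  using prime_card_gt_1[where ?'p = 'p] by (intro inverse_less_1_iff[THEN iffD2]) linarith

lemma inverse_card_power_mono:
  "m \<le> n \<Longrightarrow> inverse (real CARD('p::prime_card)) ^ n \<le> inverse (real CARD('p)) ^ m"
  by (intro power_decreasing less_imp_le[OF inverse_card_pos] less_imp_le[OF inverse_card_less_1])

lemma inverse_card_power_less_1 [simp]: "inverse (real CARD('p::prime_card)) ^ Suc n < 1"
  by (rule order.strict_trans1[OF inverse_card_power_mono[of 1 "Suc n"]]) simp_all

lemma inverse_card_power_tendsto_0: "(\<lambda>n. inverse (real CARD('p::prime_card)) ^ n) \<longlonglongrightarrow> 0"
  by (intro LIMSEQ_realpow_zero less_imp_le[OF inverse_card_pos] inverse_card_less_1)

lemma card_power_tendsto_0: "(\<lambda>n. of_nat CARD('p) ^ n :: 'p::prime_card padic) \<longlonglongrightarrow> 0"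
  by (rule padic_tendstoI[OF _ inverse_card_power_tendsto_0[where ?'p = 'p]]) (simp add: padic_norm_power)

text \<open>The value group is discrete: a rational closer to x than |x| has the same norm, and that
  norm is an integral power of 1/p. So strict bounds by 1 sharpen to divisibility by p.\<close>

lemma padic_norm_less_1:
  assumes "padic_norm (x :: 'p::prime_card padic) < 1" shows "padic_norm x \<le> inverse (real CARD('p))"
proof (cases "x = 0")
  case False
  have pe: "prime_elem (int CARD('p))" using prime_card_int[where ?'a = 'p] by auto
  have "padic_norm x > 0" using False padic_norm_nonneg[of x] padic_norm_eq_0_iff[of x] by linarith
  then obtain q where "padic_norm (x - of_rat q) < padic_norm x" by (rule padic_rat_dense)
  then have q: "padic_norm x = rat_pabs CARD('p) q"
    using padic_norm_eq_of_diff_less[of x "of_rat q"] by (simp add: padic_norm_of_rat)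
  have "q \<noteq> 0" using q False by auto
  define k where "k = int (multiplicity (int CARD('p)) (fst (quotient_of q))) - int (multiplicity (int CARD('p)) (snd (quotient_of q)))"
  have k: "padic_norm x = inverse (real CARD('p)) powi k" using q \<open>q \<noteq> 0\<close> by (simp add: rat_pabs_def k_def)
  have p: "real CARD('p) > 1" using prime_card_gt_1[where ?'p = 'p] by simp
  have "k > 0"
  proof (rule ccontr)
    assume "\<not> k > 0"
    then have "inverse (real CARD('p)) powi k = real CARD('p) ^ nat (- k)"
      by (auto simp: power_int_def)
    also have "\<dots> \<ge> 1" using p by (intro one_le_power) auto
    finally show False using assms k by simp
  qed
  then have "padic_norm x = inverse (real CARD('p)) ^ nat k" by (simp add: k power_int_def)
  also have "\<dots> \<le> inverse (real CARD('p)) ^ 1"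
    using p \<open>k > 0\<close> by (intro power_decreasing) (auto simp: field_simps)
  finally show ?thesis by simp
qed simp

section \<open>The Teichmueller character\<close>

text \<open>The cofactor of x - y in x^p - y^p is p y^(p-1) up to multiples of the differences x^i -
  y^i, so it is itself divisible by p.\<close>

lemma padic_norm_power_card_diff:
  assumes x: "padic_norm (x :: 'p::prime_card padic) \<le> 1" and y: "padic_norm y \<le> 1"
    and k: "padic_norm (x - y) \<le> inverse (real CARD('p)) ^ Suc k"
  shows "padic_norm (x ^ CARD('p) - y ^ CARD('p)) \<le> inverse (real CARD('p)) ^ Suc (Suc k)"
proof -
  let ?p = "CARD('p)"
  have m: "?p = Suc (?p - 1)" by simp
  define m where "m = ?p - 1"
  note m = m[folded m_def]
  have p1: "inverse (real ?p) ^ Suc k \<le> inverse (real ?p)"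
    using inverse_card_power_mono[of 1 "Suc k", where ?'p = 'p] by simp
  have xy: "padic_norm (x ^ i - y ^ i) \<le> inverse (real ?p)" for i
  proof -
    have "padic_norm (x ^ i - y ^ i) \<le> inverse (real ?p) ^ Suc k"
    proof (induction i)
      case (Suc i)
      have "x ^ Suc i - y ^ Suc i = x * (x ^ i - y ^ i) + (x - y) * y ^ i" by (simp add: algebra_simps)
      moreover have "padic_norm (x * (x ^ i - y ^ i)) \<le> inverse (real ?p) ^ Suc k"
        using mult_mono[OF x Suc] by (simp add: padic_norm_mult)
      moreover have "padic_norm ((x - y) * y ^ i) \<le> inverse (real ?p) ^ Suc k"
        using mult_mono[OF k padic_norm_power_le_1[OF y, of i]] by (simp add: padic_norm_mult)
      ultimately show ?case using padic_norm_add_le by metis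
    qed simp
    with p1 show ?thesis by linarith
  qed
  have "(\<Sum>i<?p. y ^ (?p - Suc i) * (x ^ i - y ^ i)) = (\<Sum>i<?p. y ^ (?p - Suc i) * x ^ i) - (\<Sum>i<?p. y ^ m)"
    unfolding sum_subtractf[symmetric]
  proof (rule sum.cong[OF refl])
    fix i assume "i \<in> {..<?p}"
    then have "m = (?p - Suc i) + i" by (auto simp: m)
    then have "y ^ m = y ^ (?p - Suc i) * y ^ i" by (metis power_add)
    then show "y ^ (?p - Suc i) * (x ^ i - y ^ i) = y ^ (?p - Suc i) * x ^ i - y ^ m"
      by (simp only: right_diff_distrib)
  qed
  then have e: "(\<Sum>i<?p. y ^ (?p - Suc i) * x ^ i) =
      (\<Sum>i<?p. y ^ (?p - Suc i) * (x ^ i - y ^ i)) + of_nat ?p * y ^ m" by simp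
  have "padic_norm (\<Sum>i<?p. y ^ (?p - Suc i) * (x ^ i - y ^ i)) \<le> inverse (real ?p)"
    using mult_mono[OF padic_norm_power_le_1[OF y] xy]
    by (intro padic_norm_sum_le) (auto simp: padic_norm_mult)
  moreover have "padic_norm (of_nat ?p * y ^ m) \<le> inverse (real ?p)"
    using padic_norm_power_le_1[OF y, of m] by (simp add: padic_norm_mult mult_left_le)
  ultimately have s: "padic_norm (\<Sum>i<?p. y ^ (?p - Suc i) * x ^ i) \<le> inverse (real ?p)"
    unfolding e by (rule padic_norm_add_le)
  have "x ^ ?p - y ^ ?p = (x - y) * (\<Sum>i<?p. y ^ (?p - Suc i) * x ^ i)" by (rule power_diff_sumr2)
  then show ?thesis using mult_mono[OF k s] by (simp add: padic_norm_mult mult.commute)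
qed

lemma padic_norm_power_card_power_diff:
  assumes x: "padic_norm (x :: 'p::prime_card padic) \<le> 1" and y: "padic_norm y \<le> 1"
    and xy: "padic_norm (x - y) < 1"
  shows "padic_norm (x ^ (CARD('p) ^ n) - y ^ (CARD('p) ^ n)) \<le> inverse (real CARD('p)) ^ Suc n"
proof (induction n)
  case 0
  then show ?case using padic_norm_less_1[OF xy] by simp
next
  case (Suc n)
  from padic_norm_power_card_diff[OF padic_norm_power_le_1[OF x] padic_norm_power_le_1[OF y] this]
  show ?case by (simp add: mult.commute flip: power_mult)
qed

lemma power_card_fixed:
  assumes "(x :: 'p::prime_card padic) ^ CARD('p) = x" shows "x ^ (CARD('p) ^ n) = x"
  using assms by (induction n) (auto simp: mult.commute power_mult)

lemma power_card_fixed_norm_le: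
  assumes "(x :: 'p::prime_card padic) ^ CARD('p) = x" shows "padic_norm x \<le> 1"
proof (cases "x = 0")
  case False
  have n: "padic_norm x > 0" using False padic_norm_nonneg[of x] padic_norm_eq_0_iff[of x] by linarith
  have "padic_norm x ^ CARD('p) = padic_norm x ^ 1" using assms by (simp flip: padic_norm_power)
  then show ?thesis 
    using power_strict_increasing[of 1 "CARD('p)" "padic_norm x"] by (intro leI notI) simp
qed simp

text \<open>Raising to the power p^n fixes both points but brings their distance below
  p^-(n+1).\<close>

lemma power_card_fixed_unique:
  assumes x: "(x :: 'p::prime_card padic) ^ CARD('p) = x" and y: "y ^ CARD('p) = y"
    and xy: "padic_norm (x - y) < 1"
  shows "x = y"
proof -
  have "padic_norm (x - y) \<le> inverse (real CARD('p)) ^ Suc n" for n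
    using padic_norm_power_card_power_diff[OF power_card_fixed_norm_le[OF x] power_card_fixed_norm_le[OF y] xy, of n]
    by (simp add: power_card_fixed x y)
  then have "padic_norm (x - y) \<le> 0"
    by (intro LIMSEQ_le_const[OF LIMSEQ_Suc[OF inverse_card_power_tendsto_0[where ?'p = 'p]]]) auto
  then have "padic_norm (x - y) = 0" using padic_norm_nonneg[of "x - y"] by linarith
  then show ?thesis by simp
qed

lemma fermat_int: "prime p \<Longrightarrow> [a ^ p = a] (mod int p)"
proof (cases "int p dvd a")
  case True
  assume "prime p"
  then have "int p dvd a ^ p" using True prime_gt_0_nat[of p] by (intro dvd_trans[OF True dvd_power]) auto
  then show ?thesis using True by (meson cong_0_iff cong_sym cong_trans)
next
  case False
  assume p: "prime p"
  obtain b where b: "[a = int b] (mod int p)"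
    using p prime_gt_0_nat[of p] by (metis cong_mod_right cong_refl nat_0_le of_nat_0_less_iff pos_mod_sign)
  then have "\<not> p dvd b" using False by (metis cong_dvd_iff int_dvd_int_iff)
  then have "[b ^ (p - 1) = 1] (mod p)" using p by (intro fermat_theorem)
  then have "[b ^ (p - 1) * b = 1 * b] (mod p)" by (intro cong_mult) auto
  moreover have "b ^ (p - 1) * b = b ^ p" using prime_gt_0_nat[OF p] by (cases p) auto
  ultimately have "[int b ^ p = int b] (mod int p)"
    by (metis cong_int_iff mult_1 of_nat_power)
  with b show ?thesis by (meson cong_pow cong_sym cong_trans)
qed

lemma padic_norm_of_int_diff_less_1_iff:
  "padic_norm (of_int a - of_int b :: 'p::prime_card padic) < 1 \<longleftrightarrow> [a = b] (mod int CARD('p))"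
proof -
  have "padic_norm (of_int (a - b) :: 'p padic) < 1 \<longleftrightarrow> int CARD('p) dvd a - b"
  proof
    assume "padic_norm (of_int (a - b) :: 'p padic) < 1"
    then show "int CARD('p) dvd a - b"
      using padic_norm_of_int_le_iff[of "a - b" 1, where ?'p = 'p] padic_norm_less_1[of "of_int (a - b) :: 'p padic"] by simp
  next
    assume "int CARD('p) dvd a - b"
    then have "padic_norm (of_int (a - b) :: 'p padic) \<le> inverse (real CARD('p))"
      using padic_norm_of_int_le_iff[of "a - b" 1, where ?'p = 'p] by simp
    also have "\<dots> < 1" by (rule inverse_card_less_1)
    finally show "padic_norm (of_int (a - b) :: 'p padic) < 1" .
  qed
  then show ?thesis by (simp add: cong_iff_dvd_diff)
qed

text \<open>Fermat gives the congruence between a^p and a modulo p, and each further p-th power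
  gains one more digit, so the powers a^(p^n) converge.\<close>

lemma teichmueller_limit_exists:
  obtains z where "(\<lambda>n. (of_int a :: 'p::prime_card padic) ^ (CARD('p) ^ n)) \<longlonglongrightarrow> z"
    "z ^ CARD('p) = z" "padic_norm (z - of_int a) < 1"
proof -
  let ?p = "CARD('p)" and ?x = "of_int a :: 'p padic"
  have x: "padic_norm ?x \<le> 1" by simp
  have f: "padic_norm (?x ^ ?p - ?x) < 1"
    using fermat_int[OF prime_card[where ?'a = 'p], of a] padic_norm_of_int_diff_less_1_iff[of "a ^ ?p" a, where ?'p = 'p]
    by simp
  have s: "padic_norm (?x ^ (?p ^ Suc n) - ?x ^ (?p ^ n)) \<le> inverse (real ?p) ^ Suc n" for n
    using padic_norm_power_card_power_diff[OF padic_norm_power_le_1[OF x] x f, of n]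
    by (simp flip: power_mult)
  have c: "padic_norm (?x ^ (?p ^ m) - ?x ^ (?p ^ n)) \<le> inverse (real ?p) ^ Suc n" if "n \<le> m" for m n
    using that
  proof (induction m rule: dec_induct)
    case (step m)
    have "inverse (real ?p) ^ Suc m \<le> inverse (real ?p) ^ Suc n"
      using step(1) by (intro inverse_card_power_mono) simp
    then have "padic_norm (?x ^ (?p ^ Suc m) - ?x ^ (?p ^ m)) \<le> inverse (real ?p) ^ Suc n" using s[of m] by linarith
    from this step(3) show ?case by (rule padic_norm_diff_trans)
  qed simp
  have "convergent (\<lambda>n. ?x ^ (?p ^ n))"
    by (rule padic_convergentI[OF c LIMSEQ_Suc[OF inverse_card_power_tendsto_0[where ?'p = 'p]]])
  then obtain z where z: "(\<lambda>n. ?x ^ (?p ^ n)) \<longlonglongrightarrow> z" by (auto simp: convergent_def)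
  have "(\<lambda>n. (?x ^ (?p ^ n)) ^ ?p) \<longlonglongrightarrow> z ^ ?p" by (intro padic_tendsto_power z)
  then have "(\<lambda>n. ?x ^ (?p ^ Suc n)) \<longlonglongrightarrow> z ^ ?p" by (simp add: mult.commute flip: power_mult)
  then have "z ^ ?p = z" using LIMSEQ_Suc[OF z] LIMSEQ_unique by blast
  moreover have "padic_norm (z - ?x) \<le> inverse (real ?p)"
    using c[of 0] by (intro padic_norm_limit_le[OF tendsto_diff[OF z tendsto_const]]) auto
  then have "padic_norm (z - ?x) < 1"
    using inverse_card_less_1[where ?'p = 'p] by linarith
  ultimately show ?thesis using z that by blast
qed

lemma power_card_minus_1_iff:
  "(z :: 'p::prime_card padic) ^ (CARD('p) - 1) = 1 \<longleftrightarrow> z ^ CARD('p) = z \<and> z \<noteq> 0"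
proof -
  define m where "m = CARD('p) - 2"
  have m: "CARD('p) = Suc (Suc m)" using prime_card_ge_2[where ?'p = 'p] by (simp add: m_def)
  show ?thesis unfolding m by auto
qed

lemma to_int_mod_ring_eq_0_iff_dvd: "int CARD('p) dvd to_int_mod_ring (x :: 'p::prime_card mod_ring) \<longleftrightarrow> x = 0"
proof
  assume "int CARD('p) dvd to_int_mod_ring x"
  moreover have "to_int_mod_ring x \<in> {0..<int CARD('p)}" using range_to_int_mod_ring by blast
  ultimately have "to_int_mod_ring x = 0" using zdvd_imp_le by fastforce
  then show "x = 0" by (metis of_int_mod_ring_hom.hom_zero of_int_mod_ring_to_int_mod_ring)
qed simp

lemma teichmueller_props:
  shows teichmueller_power_card: "teichmueller (x :: 'p::prime_card mod_ring) ^ CARD('p) = teichmueller x"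
    and teichmueller_cong: "padic_norm (teichmueller x - of_int (to_int_mod_ring x)) < 1"
    and teichmueller_eq_0_iff [simp]: "teichmueller x = 0 \<longleftrightarrow> x = 0"
proof -
  let ?P = "\<lambda>z. z ^ (CARD('p) - 1) = 1 \<and> padic_norm (z - of_int (to_int_mod_ring x)) < 1"
  have "?P (teichmueller x)" if x: "x \<noteq> 0"
  proof -
    obtain z where z: "z ^ CARD('p) = z" "padic_norm (z - of_int (to_int_mod_ring x) :: 'p padic) < 1"
      by (rule teichmueller_limit_exists)
    have "padic_norm (of_int (to_int_mod_ring x) :: 'p padic) = 1"
      using x by (intro padic_norm_of_int_eq_1) (simp add: to_int_mod_ring_eq_0_iff_dvd)
    then have "z \<noteq> 0" using z(2) by auto
    with z have Pz: "?P z" unfolding power_card_minus_1_iff by simp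
    have "w = z" if "?P w" for w
    proof (rule power_card_fixed_unique)
      show "w ^ CARD('p) = w" "z ^ CARD('p) = z" using that Pz by (auto simp only: power_card_minus_1_iff)
      have "padic_norm (of_int (to_int_mod_ring x) - z) < 1"
        using z(2) padic_norm_minus_commute[of z] by simp
      then show "padic_norm (w - z) < 1"
        using that padic_norm_ultra[of "w - of_int (to_int_mod_ring x)" "of_int (to_int_mod_ring x) - z"]
        unfolding diff_add_cancel add_diff_eq by linarith
    qed
    with Pz have "(THE w. ?P w) = z" by (intro the_equality) blast
    then show ?thesis using Pz x by (simp add: teichmueller_def)
  qed
  then show "teichmueller x ^ CARD('p) = teichmueller x" "padic_norm (teichmueller x - of_int (to_int_mod_ring x)) < 1"
    "teichmueller x = 0 \<longleftrightarrow> x = 0"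
    unfolding power_card_minus_1_iff by (cases "x = 0"; simp add: teichmueller_def)+
qed

lemma teichmueller_eqI:
  assumes "z ^ CARD('p) = z" "padic_norm (z - of_int (to_int_mod_ring x)) < 1"
  shows "teichmueller (x :: 'p::prime_card mod_ring) = z"
proof (rule power_card_fixed_unique[OF teichmueller_power_card assms(1)])
  show "padic_norm (teichmueller x - z) < 1"
    using padic_norm_diff_less[OF teichmueller_cong[of x] assms(2)] by simp
qed

lemma to_int_mod_ring_of_int: "[to_int_mod_ring (of_int a :: 'p::prime_card mod_ring) = a] (mod int CARD('p))"
  by (simp add: of_int_of_int_mod_ring of_int_mod_ring.rep_eq to_int_mod_ring.rep_eq)

lemma teichmueller_power_limit:
  "(\<lambda>n. (of_int a :: 'p::prime_card padic) ^ (CARD('p) ^ n)) \<longlonglongrightarrow> teichmueller (of_int a :: 'p mod_ring)"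
proof -
  obtain z where z: "(\<lambda>n. (of_int a :: 'p padic) ^ (CARD('p) ^ n)) \<longlonglongrightarrow> z"
    "z ^ CARD('p) = z" "padic_norm (z - of_int a) < 1"
    by (rule teichmueller_limit_exists)
  have "padic_norm (of_int a - of_int (to_int_mod_ring (of_int a :: 'p mod_ring)) :: 'p padic) < 1"
    unfolding padic_norm_of_int_diff_less_1_iff by (rule cong_sym[OF to_int_mod_ring_of_int])
  then have "padic_norm (z - of_int (to_int_mod_ring (of_int a :: 'p mod_ring))) < 1"
    using z(3) padic_norm_ultra[of "z - of_int a" "of_int a - of_int (to_int_mod_ring (of_int a :: 'p mod_ring))"] by simp
  with z show ?thesis using teichmueller_eqI by metis
qed

lemma teichmueller_0 [simp]: "teichmueller 0 = 0" by simp

lemma teichmueller_1 [simp]: "teichmueller (1 :: 'p::prime_card mod_ring) = 1"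
  by (rule teichmueller_eqI) auto

lemma mod_ring_of_int_cases: obtains a where "(x :: 'p::prime_card mod_ring) = of_int a"
  by (metis of_int_mod_ring_to_int_mod_ring of_int_of_int_mod_ring)

lemma teichmueller_mult:
  "teichmueller (x * y) = teichmueller x * teichmueller (y :: 'p::prime_card mod_ring)"
proof -
  obtain a b where ab: "x = of_int a" "y = of_int b" by (metis mod_ring_of_int_cases)
  have "(\<lambda>n. (of_int (a * b) :: 'p padic) ^ (CARD('p) ^ n)) \<longlonglongrightarrow> teichmueller x * teichmueller y"
    using tendsto_mult[OF teichmueller_power_limit[of a, where ?'p = 'p] teichmueller_power_limit[of b, where ?'p = 'p]]
    by (simp add: ab power_mult_distrib)
  then show ?thesis
    using teichmueller_power_limit[of "a * b", where ?'p = 'p] LIMSEQ_unique by (auto simp: ab)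
qed

lemma teichmueller_power: "teichmueller (x ^ n) = teichmueller (x :: 'p::prime_card mod_ring) ^ n"
  by (induction n) (auto simp: teichmueller_mult)

lemma teichmueller_inverse: "teichmueller (inverse x) = inverse (teichmueller (x :: 'p::prime_card mod_ring))"
proof (cases "x = 0")
  case False
  then have "teichmueller x * teichmueller (inverse x) = 1" by (simp flip: teichmueller_mult)
  then show ?thesis by (rule inverse_unique[symmetric])
qed simp

text \<open>omega is additive only modulo p. This is exactly the error that Dwork's additive
  character can absorb.\<close>

lemma teichmueller_add_cong:
  "padic_norm (teichmueller x + teichmueller y - teichmueller (x + y :: 'p::prime_card mod_ring)) < 1"
proof -
  let ?t = "\<lambda>x :: 'p mod_ring. of_int (to_int_mod_ring x) :: 'p padic"
  obtain a b where ab: "x = of_int a" "y = of_int b" by (metis mod_ring_of_int_cases)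
  have t: "[to_int_mod_ring x + to_int_mod_ring y = to_int_mod_ring (x + y)] (mod int CARD('p))"
    by (simp add: to_int_mod_ring_add)
  have "padic_norm (?t x + ?t y - ?t (x + y)) < 1"
    using t unfolding padic_norm_of_int_diff_less_1_iff[symmetric, where ?'p = 'p] by simp
  then have "padic_norm (((teichmueller x - ?t x) + (teichmueller y - ?t y)) -
      (teichmueller (x + y) - ?t (x + y)) + (?t x + ?t y - ?t (x + y))) < 1"
    by (rule padic_norm_add_less[OF padic_norm_diff_less[OF padic_norm_add_less[OF teichmueller_cong teichmueller_cong] teichmueller_cong]])
  then show ?thesis by (simp add: algebra_simps)
qed

lemma teichmueller_eq_iff [simp]: "teichmueller x = teichmueller y \<longleftrightarrow> x = (y :: 'p::prime_card mod_ring)"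
proof
  assume e: "teichmueller x = teichmueller y"
  have "padic_norm (teichmueller (x - y)) < 1"
    using teichmueller_add_cong[of "x - y" y] by (simp add: e)
  then have "teichmueller (x - y) = 0"
    using power_card_fixed_unique[OF teichmueller_power_card[of "x - y"], of 0] by simp
  then show "x = y" by simp
qed simp

lemma teichmueller_eq_1_iff [simp]: "teichmueller x = 1 \<longleftrightarrow> x = (1 :: 'p::prime_card mod_ring)"
  by (metis teichmueller_1 teichmueller_eq_iff)

lemma teichmueller_power_card_minus_1:
  "(x :: 'p::prime_card mod_ring) \<noteq> 0 \<Longrightarrow> teichmueller x ^ (CARD('p) - 1) = 1"
  by (simp only: power_card_minus_1_iff teichmueller_power_card teichmueller_eq_0_iff) simp

lemma power_mod_of_power_eq_1:
  assumes "x ^ n = (1 :: 'a::monoid_mult)" shows "x ^ (k mod n) = x ^ k"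
  by (metis assms mult.commute mult_1 power_add power_mult power_one div_mult_mod_eq)

lemma teichmueller_power_mod:
  "(x :: 'p::prime_card mod_ring) \<noteq> 0 \<Longrightarrow> teichmueller x ^ (k mod (CARD('p) - 1)) = teichmueller x ^ k"
  by (rule power_mod_of_power_eq_1[OF teichmueller_power_card_minus_1])

lemma teichmueller_minus_1: "odd CARD('p) \<Longrightarrow> teichmueller (-1 :: 'p::prime_card mod_ring) = -1"
proof -
  assume p: "odd CARD('p)"
  have "[to_int_mod_ring (of_int (-1) :: 'p mod_ring) = -1] (mod int CARD('p))"
    by (rule to_int_mod_ring_of_int)
  then have "padic_norm (of_int (-1) - of_int (to_int_mod_ring (of_int (-1) :: 'p mod_ring)) :: 'p padic) < 1"
    unfolding padic_norm_of_int_diff_less_1_iff by (rule cong_sym)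
  then show ?thesis using p by (intro teichmueller_eqI) auto
qed

lemma sum_power_teichmueller_exponents:
  assumes "(x :: 'p::prime_card mod_ring) \<noteq> 0"
  shows "(\<Sum>j<CARD('p) - 1. teichmueller x ^ j) = (if x = 1 then of_nat (CARD('p) - 1) else 0)"
  using geometric_sum[of "teichmueller x" "CARD('p) - 1"] teichmueller_power_card_minus_1[OF assms] by auto

lemma sum_mult_reindex:
  fixes c :: "'a::{field,finite}"
  assumes "c \<noteq> 0"
  shows "(\<Sum>x\<in>-{0}. f (c * x)) = (\<Sum>x\<in>-{0}. f x)"
  by (rule sum.reindex_bij_witness[of _ "\<lambda>x. x / c" "\<lambda>x. c * x"]) (use assms in auto)

lemma sum_teichmueller_power:
  "(\<Sum>x\<in>-{0}. teichmueller (x :: 'p::prime_card mod_ring) ^ k) =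
    (if (CARD('p) - 1) dvd k then of_nat (CARD('p) - 1) else 0)"
proof (cases "(CARD('p) - 1) dvd k")
  case True
  then have "teichmueller x ^ k = 1" if "x \<noteq> 0" for x :: "'p mod_ring"
    using teichmueller_power_card_minus_1[OF that] by (auto elim!: dvdE simp: power_mult)
  then have "(\<Sum>x\<in>-{0}. teichmueller (x :: 'p mod_ring) ^ k) = (\<Sum>x\<in>-{0 :: 'p mod_ring}. 1)"
    by (intro sum.cong) auto
  with True show ?thesis by (simp add: Compl_eq_Diff_UNIV)
next
  case False
  let ?Q = "CARD('p) - 1" and ?f = "Polynomial.monom 1 (k mod (CARD('p) - 1)) + [:-1:] :: 'p padic poly"
  \<comment> \<open>Otherwise the p - 1 distinct Teichmueller representatives would all be roots of
    a nonzero polynomial of degree k mod (p - 1), which is less than p - 1.\<close>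
  have "\<exists>c::'p mod_ring. c \<noteq> 0 \<and> teichmueller c ^ k \<noteq> 1"
  proof (rule ccontr)
    assume "\<not> ?thesis"
    then have "teichmueller c ^ k = 1" if "c \<noteq> 0" for c :: "'p mod_ring" using that by auto
    then have s: "teichmueller ` (-{0 :: 'p mod_ring}) \<subseteq> {z. poly ?f z = 0}"
      by (auto simp: teichmueller_power_mod poly_monom simp del: One_nat_def)
    have k: "k mod ?Q > 0" using False by (simp add: mod_greater_zero_iff_not_dvd)
    have d: "degree ?f = k mod ?Q" using k by (subst degree_add_eq_left) (auto simp: degree_monom_eq)
    then have f0: "?f \<noteq> 0" using k by auto
    have "?Q = card (-{0 :: 'p mod_ring})" by (simp add: Compl_eq_Diff_UNIV)
    also have "\<dots> = card (teichmueller ` (-{0 :: 'p mod_ring}))"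
      by (intro card_image[symmetric] inj_onI) simp
    also have "\<dots> \<le> card {z. poly ?f z = 0}"
      by (intro card_mono s poly_roots_finite[OF f0])
    also have "\<dots> \<le> k mod ?Q" using poly_roots_degree[OF f0] d by simp
    also have "\<dots> < ?Q" using prime_card_gt_1[where ?'p = 'p] by (intro mod_less_divisor) linarith
    finally show False by simp
  qed
  then obtain c :: "'p mod_ring" where c: "c \<noteq> 0" "teichmueller c ^ k \<noteq> 1" by blast
  let ?S = "\<Sum>x\<in>-{0}. teichmueller (x :: 'p mod_ring) ^ k"
  have "teichmueller c ^ k * ?S = (\<Sum>x\<in>-{0}. teichmueller (c * x) ^ k)"
    by (simp add: sum_distrib_left teichmueller_mult power_mult_distrib)
  also have "\<dots> = ?S" by (rule sum_mult_reindex[OF c(1)])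
  finally have "(teichmueller c ^ k - 1) * ?S = 0" by (simp add: algebra_simps)
  with c False show ?thesis by simp
qed

section \<open>Morita's gamma function\<close>

lemma morita_factorial_0 [simp]: "morita_factorial 0 = 1"
  by (simp add: morita_factorial_def)

lemma morita_factorial_Suc:
  "(morita_factorial (Suc n) :: 'p::prime_card padic) =
    - (if CARD('p) dvd n then 1 else of_nat n) * morita_factorial n"
proof -
  have "{j. 0 < j \<and> j < Suc n \<and> \<not> CARD('p) dvd j} =
      (if CARD('p) dvd n then {} else {n}) \<union> {j. 0 < j \<and> j < n \<and> \<not> CARD('p) dvd j}"
    by (auto simp: less_Suc_eq intro!: gr0I)
  then show ?thesis by (auto simp: morita_factorial_def)
qed

lemma padic_norm_morita_factorial [simp]: "padic_norm (morita_factorial n) = 1"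
  by (induction n) (auto simp: morita_factorial_Suc padic_norm_mult padic_norm_of_nat_eq_1)

text \<open>Pairing each unit j modulo p^N with its inverse \<open>g j\<close> permutes the factors,
  so the square of the product is a product of terms \<open>j * g j\<close>, all congruent to 1.
  Squaring avoids the study of self-inverse units; the sign is settled afterwards by Wilson's
  theorem.\<close>

lemma morita_factorial_square_cong:
  "padic_norm ((morita_factorial (CARD('p) ^ N) :: 'p::prime_card padic) ^ 2 - 1) \<le> inverse (real CARD('p)) ^ N"
proof -
  let ?p = "CARD('p)" and ?q = "CARD('p) ^ N"
  define U where "U = {j. 0 < j \<and> j < ?q \<and> \<not> ?p dvd j}"
  have U: "coprime j ?q" if "j \<in> U" for j
    using that prime_imp_coprime[OF prime_card[where ?'a = 'p], of j]
    by (auto simp: U_def coprime_commute intro: coprime_power_left_iff[THEN iffD2])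
  have finU: "finite U" by (simp add: U_def)
  define g where "g j = (SOME k. [j * k = 1] (mod ?q)) mod ?q" for j
  have g: "[j * g j = 1] (mod ?q)" if "j \<in> U" for j
  proof -
    have "\<exists>k. [j * k = 1] (mod ?q)" using cong_solve_coprime_nat[OF U[OF that]] by simp
    then have "[j * (SOME k. [j * k = 1] (mod ?q)) = 1] (mod ?q)" by (rule someI_ex)
    then show ?thesis unfolding g_def by (simp add: cong_def mod_mult_right_eq)
  qed
  have gU: "g j \<in> U" if j: "j \<in> U" for j
  proof -
    have N: "N > 0" using j by (cases N) (auto simp: U_def)
    then have pq: "?p dvd ?q" by simp
    have nd: "\<not> ?p dvd g j"
    proof
      assume "?p dvd g j"
      then have "?p dvd j * g j" by simp
      with g[OF j] pq have "?p dvd 1" by (meson cong_dvd_iff cong_dvd_modulus_nat)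
      then show False by simp
    qed
    then have "g j > 0" by (intro gr0I) auto
    moreover have "g j < ?q" unfolding g_def by simp
    ultimately show ?thesis using nd by (simp add: U_def)
  qed
  have gg: "g (g j) = j" if j: "j \<in> U" for j
  proof -
    have "[j * g j * g (g j) = 1 * g (g j)] (mod ?q)" by (intro cong_mult g j) auto
    moreover have "[j * (g j * g (g j)) = j * 1] (mod ?q)" by (intro cong_mult g gU j) auto
    ultimately have "[g (g j) = j] (mod ?q)" by (metis cong_sym cong_trans mult.assoc mult_1 mult.right_neutral)
    moreover have "g (g j) < ?q" "j < ?q" using j gU[OF gU[OF j]] by (auto simp: U_def)
    ultimately show ?thesis by (simp add: cong_less_modulus_unique_nat)
  qed
  let ?P = "\<Prod>j\<in>U. of_nat j :: 'p padic"
  have "?P = (\<Prod>j\<in>U. of_nat (g j))"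
    by (rule prod.reindex_bij_witness[of _ g g]) (auto simp: gU gg)
  then have "?P ^ 2 = (\<Prod>j\<in>U. of_nat (j * g j))"
    by (simp add: power2_eq_square prod.distrib)
  moreover have "padic_norm ((\<Prod>j\<in>V. of_nat (j * g j)) - 1 :: 'p padic) \<le> inverse (real ?p) ^ N" if "V \<subseteq> U" for V
    using finite_subset[OF that finU] that
  proof (induction V rule: finite_induct)
    case (insert j V)
    let ?Q = "\<Prod>j\<in>V. of_nat (j * g j) :: 'p padic"
    have "padic_norm (of_int (int (j * g j) - 1) :: 'p padic) \<le> inverse (real ?p) ^ N"
      unfolding padic_norm_of_int_le_iff
      using g[of j] insert.prems by (metis cong_iff_dvd_diff cong_int_iff insert_subset of_nat_1 of_nat_power)
    then have 1: "padic_norm (of_nat (j * g j) - 1 :: 'p padic) \<le> inverse (real ?p) ^ N" by simp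
    have "padic_norm ?Q \<le> 1" unfolding of_nat_prod[symmetric] by (rule padic_norm_of_nat_le_1)
    from padic_norm_mult_le[OF this 1] have "padic_norm ((of_nat (j * g j) - 1) * ?Q) \<le> inverse (real ?p) ^ N"
      by (simp only: mult.commute)
    then have "padic_norm ((of_nat (j * g j) - 1) * ?Q + (?Q - 1)) \<le> inverse (real ?p) ^ N"
      using insert by (intro padic_norm_add_le) auto
    then show ?case using insert by (simp add: algebra_simps)
  qed simp
  moreover have "(morita_factorial ?q :: 'p padic) ^ 2 = ?P ^ 2"
    by (simp add: morita_factorial_def U_def power_mult_distrib flip: power_mult)
  ultimately show ?thesis by simp
qed

lemma morita_factorial_card: "padic_norm ((morita_factorial CARD('p) :: 'p::prime_card padic) - 1) < 1"
  if odd: "odd CARD('p)"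
proof -
  let ?p = "CARD('p)"
  have "{j. 0 < j \<and> j < ?p \<and> \<not> ?p dvd j} = {1..?p - 1}"
    using prime_card_gt_1[where ?'p = 'p] by (auto dest!: dvd_imp_le)
  then have "(morita_factorial ?p :: 'p padic) = - fact (?p - 1)"
    using odd by (simp add: morita_factorial_def fact_prod)
  then have e: "(morita_factorial ?p :: 'p padic) - 1 = of_int (- 1) - of_int (fact (?p - 1))" by simp
  show ?thesis
    unfolding e padic_norm_of_int_diff_less_1_iff
    using wilson_theorem[OF prime_card[where ?'a = 'p]] by (simp add: cong_sym)
qed

text \<open>Beyond M the factors repeat those from 0 on, up to an error of size |M|; since p divides
  M, the same indices are omitted.\<close>

lemma morita_factorial_shift:
  assumes "padic_norm ((morita_factorial M :: 'p::prime_card padic) - 1) \<le> c"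
    and "padic_norm (of_nat M :: 'p padic) \<le> c" and "CARD('p) dvd M"
  shows "padic_norm ((morita_factorial (n + M) :: 'p padic) - morita_factorial n) \<le> c"
proof (induction n)
  case 0
  then show ?case using assms by simp
next
  case (Suc n)
  let ?p = "CARD('p)" and ?m = "morita_factorial :: nat \<Rightarrow> 'p padic"
  define u v :: "'p padic" where "u = (if ?p dvd n then 1 else of_nat n)"
    and "v = (if ?p dvd n then 1 else of_nat (n + M))"
  have vu: "v = u + (if ?p dvd n then 0 else of_nat M)" by (simp add: u_def v_def)
  have "?m (Suc n + M) - ?m (Suc n) = - (v * ?m (n + M) - u * ?m n)"
    using assms(3) by (simp add: morita_factorial_Suc u_def v_def dvd_add_left_iff)
  also have "\<dots> = - (u * (?m (n + M) - ?m n) + (if ?p dvd n then 0 else of_nat M) * ?m (n + M))"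
    unfolding vu by (simp add: algebra_simps)
  finally have e: "?m (Suc n + M) - ?m (Suc n) = \<dots>" .
  have c: "c \<ge> 0" using assms(2) padic_norm_nonneg order_trans by blast
  have "padic_norm u \<le> 1" by (simp add: u_def)
  then have "padic_norm (u * (?m (n + M) - ?m n)) \<le> c"
    using mult_mono[OF _ Suc, of "padic_norm u" 1] by (simp add: padic_norm_mult)
  moreover have "padic_norm ((if ?p dvd n then 0 else of_nat M) * ?m (n + M)) \<le> c"
    using assms(2) c by (simp add: padic_norm_mult)
  ultimately show ?case unfolding e padic_norm_minus by (rule padic_norm_add_le)
qed

lemma padic_norm_2: "odd CARD('p) \<Longrightarrow> padic_norm (2 :: 'p::prime_card padic) = 1"
  using padic_norm_of_nat_eq_1[of 2, where ?'p = 'p] primes_dvd_imp_eq[OF prime_card two_is_prime_nat, where ?'a1 = 'p]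
  by (cases "CARD('p) = 2") auto

context
  assumes odd_p: "odd CARD('p::prime_card)"
begin

text \<open>Write m for the value. The product (m - 1)(m + 1) is small by the congruence for
  squares. Wilson's theorem makes m congruent to 1 modulo p, so m + 1 is congruent to 2, a unit for
  odd p, and all the smallness sits in m - 1.\<close>

lemma morita_factorial_card_power:
  "padic_norm ((morita_factorial (CARD('p) ^ Suc N) :: 'p padic) - 1) \<le> inverse (real CARD('p)) ^ Suc N"
proof -
  let ?p = "CARD('p)" and ?m = "morita_factorial :: nat \<Rightarrow> 'p padic"
  have 1: "padic_norm (?m ?p - 1) \<le> inverse (real ?p)"
    by (rule padic_norm_less_1[OF morita_factorial_card[OF odd_p]])
  have "padic_norm (?m (k * ?p) - 1) \<le> inverse (real ?p)" for k
  proof (induction k)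
    case (Suc k)
    have "padic_norm (?m (k * ?p + ?p) - ?m (k * ?p)) \<le> inverse (real ?p)"
      using 1 by (rule morita_factorial_shift) auto
    from padic_norm_diff_trans[OF this Suc] show ?case by (simp add: add.commute)
  qed simp
  from this[of "?p ^ N"] have "padic_norm (?m (?p ^ Suc N) - 1) \<le> inverse (real ?p)" by (simp add: mult.commute)
  then have l: "padic_norm (?m (?p ^ Suc N) - 1) < 1" using inverse_card_less_1[where ?'p = 'p] by linarith
  have "padic_norm (2 - (?m (?p ^ Suc N) + 1)) < padic_norm (2 :: 'p padic)"
    using l padic_norm_minus_commute[of "?m (?p ^ Suc N)" 1] by (simp add: padic_norm_2[OF odd_p] algebra_simps)
  from padic_norm_eq_of_diff_less[OF this] have 2: "padic_norm (?m (?p ^ Suc N) + 1) = 1"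
    by (simp add: padic_norm_2[OF odd_p])
  have "padic_norm (?m (?p ^ Suc N) - 1) = padic_norm ((?m (?p ^ Suc N) - 1) * (?m (?p ^ Suc N) + 1))"
    unfolding padic_norm_mult 2 by simp
  also have "\<dots> = padic_norm (?m (?p ^ Suc N) ^ 2 - 1)" by (simp add: algebra_simps power2_eq_square)
  also have "\<dots> \<le> inverse (real ?p) ^ Suc N" by (rule morita_factorial_square_cong)
  finally show ?thesis .
qed

lemma morita_factorial_cong:
  assumes "padic_norm (of_nat m - of_nat n :: 'p padic) \<le> inverse (real CARD('p)) ^ Suc N"
  shows "padic_norm (morita_factorial m - morita_factorial n :: 'p padic) \<le> inverse (real CARD('p)) ^ Suc N"
proof -
  let ?p = "CARD('p)" and ?m = "morita_factorial :: nat \<Rightarrow> 'p padic"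
  have s: "padic_norm (?m (n + k * ?p ^ Suc N) - ?m n) \<le> inverse (real ?p) ^ Suc N" for k n
  proof (induction k)
    case (Suc k)
    have "padic_norm (of_nat (?p ^ Suc N) :: 'p padic) \<le> inverse (real ?p) ^ Suc N"
      by (simp add: padic_norm_power padic_norm_mult)
    then have "padic_norm (?m (n + k * ?p ^ Suc N + ?p ^ Suc N) - ?m (n + k * ?p ^ Suc N)) \<le> inverse (real ?p) ^ Suc N"
      by (intro morita_factorial_shift morita_factorial_card_power) auto
    from padic_norm_diff_trans[OF this Suc] show ?case by (simp add: algebra_simps)
  qed simp
  have le: "padic_norm (?m m - ?m n) \<le> inverse (real ?p) ^ Suc N"
    if "n \<le> m" "padic_norm (of_nat m - of_nat n :: 'p padic) \<le> inverse (real ?p) ^ Suc N" for m n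
  proof -
    have "padic_norm (of_nat (m - n) :: 'p padic) \<le> inverse (real ?p) ^ Suc N"
      using that by (simp add: of_nat_diff)
    then obtain k where "m - n = ?p ^ Suc N * k" unfolding padic_norm_of_nat_le_iff by (elim dvdE)
    then have "m = n + k * ?p ^ Suc N" using that(1) by (simp add: mult.commute)
    then show ?thesis using s by simp
  qed
  show ?thesis
    using le[of n m] le[of m n] assms padic_norm_minus_commute[of "?m m" "?m n"]
      padic_norm_minus_commute[of "of_nat m :: 'p padic" "of_nat n"]
    by (cases "n \<le> m") (simp_all del: power_Suc)
qed

end

section \<open>Extension of gamma from the naturals to the p-adic integers\<close>

lemma padic_nat_dense:
  assumes "padic_norm (x :: 'p::prime_card padic) \<le> 1"
  obtains n where "padic_norm (x - of_nat n) \<le> inverse (real CARD('p)) ^ N"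
proof -
  let ?p = "CARD('p)"
  have "inverse (real ?p) ^ N > 0" by simp
  then obtain q where q: "padic_norm (x - of_rat q) < inverse (real ?p) ^ N" by (rule padic_rat_dense)
  have "inverse (real ?p) ^ N \<le> 1" using inverse_card_power_mono[of 0 N, where ?'p = 'p] by simp
  with q have "padic_norm (x - of_rat q) \<le> 1" by linarith
  from padic_norm_diff_le[OF assms this] have q1: "padic_norm (of_rat q :: 'p padic) \<le> 1" by simp
  obtain a b where ab: "quotient_of q = (a, b)" by (cases "quotient_of q")
  have b: "b > 0" using quotient_of_denom_pos[OF ab] .
  have e: "q = of_int a / of_int b" using quotient_of_div[OF ab] .
  have co: "coprime a b" using quotient_of_coprime[OF ab] .
  have nb: "\<not> int ?p dvd b"
  proof
    assume d: "int ?p dvd b"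
    then have "\<not> int ?p dvd a" using co prime_card_int[where ?'a = 'p]
      by (meson coprime_common_divisor not_prime_unit)
    then have "padic_norm (of_int a :: 'p padic) = 1" by (rule padic_norm_of_int_eq_1)
    moreover have "of_int a = of_rat q * (of_int b :: 'p padic)" using b by (simp add: e of_rat_divide)
    moreover have "padic_norm (of_int b :: 'p padic) \<le> inverse (real ?p)"
      using d padic_norm_of_int_le_iff[of b 1, where ?'p = 'p] by simp
    ultimately have "1 \<le> padic_norm (of_rat q :: 'p padic) * inverse (real ?p)"
      using mult_left_mono[of "padic_norm (of_int b :: 'p padic)" "inverse (real ?p)" "padic_norm (of_rat q :: 'p padic)"]
      by (simp add: padic_norm_mult)
    also have "\<dots> \<le> 1 * inverse (real ?p)" using q1 by (intro mult_right_mono) auto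
    finally show False using inverse_card_less_1[where ?'p = 'p] by linarith
  qed
  \<comment> \<open>Inverting the denominator b modulo p^N turns the p-integral rational a/b into a
    natural number of the same residue.\<close>
  then have "coprime b (int ?p ^ N)"
    using prime_imp_coprime[OF prime_card_int[where ?'a = 'p], of b] by (simp add: coprime_commute)
  then obtain c where c: "[b * c = 1] (mod (int ?p ^ N))" using cong_solve_coprime_int by blast
  define n where "n = nat ((a * c) mod (int ?p ^ N))"
  have n: "[int n = a * c] (mod (int ?p ^ N))" by (simp add: n_def cong_def)
  have "[b * int n = b * (a * c)] (mod (int ?p ^ N))" by (intro cong_mult n cong_refl)
  also have "b * (a * c) = a * (b * c)" by simp
  also have "[a * (b * c) = a * 1] (mod (int ?p ^ N))" by (intro cong_mult c cong_refl)
  finally have "int ?p ^ N dvd a - b * int n" by (metis cong_iff_dvd_diff cong_sym mult.right_neutral)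
  then have "padic_norm (of_int (a - b * int n) :: 'p padic) \<le> inverse (real ?p) ^ N"
    by (simp only: padic_norm_of_int_le_iff)
  moreover have "of_int (a - b * int n) = of_int b * (of_rat q - of_nat n :: 'p padic)"
    using b by (simp add: e of_rat_divide algebra_simps)
  ultimately have "padic_norm (of_rat q - of_nat n :: 'p padic) \<le> inverse (real ?p) ^ N"
    using padic_norm_of_int_eq_1[OF nb] by (simp add: padic_norm_mult)
  from padic_norm_diff_trans[OF less_imp_le[OF q] this] show ?thesis by (rule that)
qed

lemma padic_nat_sequence:
  assumes "padic_norm (x :: 'p::prime_card padic) \<le> 1"
  obtains n where "\<And>N. padic_norm (x - of_nat (n N)) \<le> inverse (real CARD('p)) ^ Suc N"
    "(\<lambda>N. of_nat (n N)) \<longlonglongrightarrow> x"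
proof -
  have "\<forall>N. \<exists>n. padic_norm (x - of_nat n) \<le> inverse (real CARD('p)) ^ Suc N"
    using padic_nat_dense[OF assms] by metis
  then obtain n where n: "\<And>N. padic_norm (x - of_nat (n N)) \<le> inverse (real CARD('p)) ^ Suc N" by metis
  have "(\<lambda>N. of_nat (n N)) \<longlonglongrightarrow> x"
    by (rule padic_tendstoI[OF _ LIMSEQ_Suc[OF inverse_card_power_tendsto_0[where ?'p = 'p]]])
       (use n padic_norm_minus_commute in metis)
  with n that show ?thesis by blast
qed

context
  assumes odd_p: "odd CARD('p::prime_card)"
begin

text \<open>The limit along one sequence of naturals is shown to be the limit along the whole
  filter. The explicit rate, inherited from \<open>morita_factorial_cong\<close>, is what later
  continuity arguments rest on.\<close>

lemma padic_Gamma_approx: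
  assumes x: "padic_norm (x :: 'p padic) \<le> 1"
    and n: "padic_norm (x - of_nat n) \<le> inverse (real CARD('p)) ^ Suc N"
  shows "padic_norm (padic_Gamma x - morita_factorial n) \<le> inverse (real CARD('p)) ^ Suc N"
proof -
  let ?p = "CARD('p)" and ?m = "morita_factorial :: nat \<Rightarrow> 'p padic"
  let ?F = "filtercomap of_nat (nhds x)"
  obtain s where s: "\<And>N. padic_norm (x - of_nat (s N)) \<le> inverse (real ?p) ^ Suc N"
    "(\<lambda>N. of_nat (s N)) \<longlonglongrightarrow> x" using padic_nat_sequence[OF x] by blast
  have mc: "padic_norm (?m k - ?m l) \<le> inverse (real ?p) ^ Suc N"
    if "padic_norm (x - of_nat k) \<le> inverse (real ?p) ^ Suc N"
      "padic_norm (x - of_nat l) \<le> inverse (real ?p) ^ Suc N" for k l N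
  proof (rule morita_factorial_cong[OF odd_p])
    show "padic_norm (of_nat k - of_nat l :: 'p padic) \<le> inverse (real ?p) ^ Suc N"
      using padic_norm_diff_le[OF that(2) that(1)] by simp
  qed
  have mono: "padic_norm (x - of_nat (s M)) \<le> inverse (real ?p) ^ Suc N" if "N \<le> M" for N M
    using s(1)[of M] inverse_card_power_mono[of "Suc N" "Suc M", where ?'p = 'p] that by linarith
  have "convergent (\<lambda>N. ?m (s N))"
    by (rule padic_convergentI[OF _ LIMSEQ_Suc[OF inverse_card_power_tendsto_0[where ?'p = 'p]]])
       (intro mc mono order_refl)
  then obtain L where L: "(\<lambda>N. ?m (s N)) \<longlonglongrightarrow> L" by (auto simp: convergent_def)
  have Ln: "padic_norm (L - ?m n) \<le> inverse (real ?p) ^ Suc N"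
    if n: "padic_norm (x - of_nat n) \<le> inverse (real ?p) ^ Suc N" for n N
  proof (rule Lim_bounded[OF padic_norm_limit[OF tendsto_diff[OF L tendsto_const]]])
    show "\<forall>M\<ge>N. padic_norm (?m (s M) - ?m n) \<le> inverse (real ?p) ^ Suc N"
      using mc[OF mono n] by blast
  qed
  have "(?m \<longlongrightarrow> L) ?F"
  proof (rule tendstoI)
    fix e :: real assume "e > 0"
    then obtain N where N: "inverse (real ?p) ^ Suc N < e"
      using order_tendstoD(2)[OF LIMSEQ_Suc[OF inverse_card_power_tendsto_0[where ?'p = 'p]], of e]
      by (auto simp: eventually_sequentially)
    have "eventually (\<lambda>y. dist y x < inverse (real ?p) ^ Suc N) (nhds x)"
      by (intro eventually_nhds_metric[THEN iffD2] exI[of _ "inverse (real ?p) ^ Suc N"]) simp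
    then have "eventually (\<lambda>n. dist (of_nat n) x < inverse (real ?p) ^ Suc N) ?F"
      by (rule eventually_filtercomapI)
    then show "eventually (\<lambda>n. dist (?m n) L < e) ?F"
    proof (rule eventually_mono)
      fix n assume "dist (of_nat n) x < inverse (real ?p) ^ Suc N"
      then have "padic_norm (x - of_nat n) \<le> inverse (real ?p) ^ Suc N"
        by (simp add: dist_padic padic_norm_minus_commute)
      from Ln[OF this] N show "dist (?m n) L < e" by (simp add: dist_padic padic_norm_minus_commute)
    qed
  qed
  \<comment> \<open>Limits are unique only along a nontrivial filter; naturals converging to x show
    that this one is nontrivial.\<close>
  moreover have "?F \<noteq> bot"
  proof
    assume "?F = bot"
    then have "eventually (\<lambda>n. False) ?F" by simp
    then obtain P where P: "eventually P (nhds x)" "\<And>n. P (of_nat n) \<Longrightarrow> False"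
      unfolding eventually_filtercomap by blast
    have "eventually (\<lambda>N. P (of_nat (s N))) sequentially"
      using s(2) P(1) by (rule filterlim_iff[THEN iffD1, rule_format])
    then show False using P(2) by (auto simp: eventually_sequentially)
  qed
  ultimately have "padic_Gamma x = L" unfolding padic_Gamma_def by (intro tendsto_Lim) auto
  with Ln[OF n] show ?thesis by simp
qed

lemma padic_Gamma_of_nat: "padic_Gamma (of_nat n :: 'p padic) = morita_factorial n"
proof -
  have "padic_norm (padic_Gamma (of_nat n :: 'p padic) - morita_factorial n) \<le> inverse (real CARD('p)) ^ Suc N" for N
    by (rule padic_Gamma_approx) auto
  then have "padic_norm (padic_Gamma (of_nat n :: 'p padic) - morita_factorial n) \<le> 0"
    by (intro LIMSEQ_le_const[OF LIMSEQ_Suc[OF inverse_card_power_tendsto_0[where ?'p = 'p]]]) auto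
  then have "padic_norm (padic_Gamma (of_nat n :: 'p padic) - morita_factorial n) = 0"
    by (intro antisym) auto
  then show ?thesis by simp
qed

lemma padic_Gamma_cong:
  assumes x: "padic_norm (x :: 'p padic) \<le> 1" and y: "padic_norm y \<le> 1"
    and xy: "padic_norm (x - y) \<le> inverse (real CARD('p)) ^ Suc N"
  shows "padic_norm (padic_Gamma x - padic_Gamma y) \<le> inverse (real CARD('p)) ^ Suc N"
proof -
  obtain n where n: "padic_norm (x - of_nat n) \<le> inverse (real CARD('p)) ^ Suc N"
    by (rule padic_nat_dense[OF x])
  have "padic_norm (y - of_nat n) \<le> inverse (real CARD('p)) ^ Suc N"
    using xy n padic_norm_minus_commute[of x y] by (intro padic_norm_diff_trans[OF _ n]) simp
  from padic_norm_diff_le[OF padic_Gamma_approx[OF x n] padic_Gamma_approx[OF y this]]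
  show ?thesis by simp
qed

lemma padic_Gamma_tendsto:
  assumes y: "\<And>k. padic_norm (y k :: 'p padic) \<le> 1" and lim: "y \<longlonglongrightarrow> x"
  shows "(\<lambda>k. padic_Gamma (y k)) \<longlonglongrightarrow> padic_Gamma x"
proof (rule metric_LIMSEQ_I)
  have x: "padic_norm x \<le> 1" by (rule padic_norm_limit_le[OF lim y])
  fix e :: real assume "e > 0"
  then obtain N where N: "inverse (real CARD('p)) ^ Suc N < e"
    using order_tendstoD(2)[OF LIMSEQ_Suc[OF inverse_card_power_tendsto_0[where ?'p = 'p]], of e]
    by (auto simp: eventually_sequentially)
  have "inverse (real CARD('p)) ^ Suc N > 0" by simp
  from metric_LIMSEQ_D[OF lim this] obtain k0 where
    k0: "\<And>k. k \<ge> k0 \<Longrightarrow> dist (y k) x < inverse (real CARD('p)) ^ Suc N" by blast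
  have "dist (padic_Gamma (y k)) (padic_Gamma x) < e" if "k \<ge> k0" for k
    using padic_Gamma_cong[OF y x, of k N] k0[OF that] N by (auto simp: dist_padic)
  then show "\<exists>no. \<forall>n\<ge>no. dist (padic_Gamma (y n)) (padic_Gamma x) < e" by blast
qed

text \<open>At naturals this is the recursion of \<open>morita_factorial\<close>. It survives the
  limit because the approximating naturals are divisible by p exactly when x is not a unit.\<close>

lemma padic_Gamma_plus_1:
  assumes x: "padic_norm (x :: 'p padic) \<le> 1"
  shows "padic_Gamma (x + 1) = - (if padic_norm x < 1 then 1 else x) * padic_Gamma x"
proof -
  obtain s where s: "\<And>N. padic_norm (x - of_nat (s N)) \<le> inverse (real CARD('p)) ^ Suc N"
    "(\<lambda>N. of_nat (s N)) \<longlonglongrightarrow> x" using padic_nat_sequence[OF x] by blast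
  have d: "CARD('p) dvd s N \<longleftrightarrow> padic_norm x < 1" for N
  proof -
    have 1: "padic_norm (x - of_nat (s N)) < 1"
      using s(1)[of N] inverse_card_power_less_1[of N, where ?'p = 'p] by linarith
    have "CARD('p) dvd s N \<longleftrightarrow> padic_norm (of_nat (s N) :: 'p padic) < 1"
      using padic_norm_of_int_diff_less_1_iff[of "int (s N)" 0, where ?'p = 'p] by (simp add: cong_0_iff)
    also have "\<dots> \<longleftrightarrow> padic_norm x < 1"
      using padic_norm_add_less[OF 1, of "of_nat (s N)"] padic_norm_diff_less[OF _ 1, of x] by auto
    finally show ?thesis .
  qed
  have "(\<lambda>N. padic_Gamma (of_nat (Suc (s N)))) \<longlonglongrightarrow> padic_Gamma (x + 1)"
    using tendsto_add[OF s(2) tendsto_const[of 1]] by (intro padic_Gamma_tendsto padic_norm_of_nat_le_1) (simp add: add.commute)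
  moreover have "padic_Gamma (of_nat (Suc (s N)) :: 'p padic) =
      - (if padic_norm x < 1 then 1 else of_nat (s N)) * padic_Gamma (of_nat (s N))" for N
    unfolding padic_Gamma_of_nat by (simp add: morita_factorial_Suc d)
  moreover have "(\<lambda>N. - (if padic_norm x < 1 then 1 else of_nat (s N)) * padic_Gamma (of_nat (s N))) \<longlonglongrightarrow>
      - (if padic_norm x < 1 then 1 else x) * padic_Gamma x"
    using s(2) by (intro tendsto_mult tendsto_minus padic_Gamma_tendsto) auto
  ultimately show ?thesis using LIMSEQ_unique by force
qed

lemma padic_norm_padic_Gamma: "padic_norm (x :: 'p padic) \<le> 1 \<Longrightarrow> padic_norm (padic_Gamma x) = 1"
proof -
  assume x: "padic_norm x \<le> 1"
  obtain n where "padic_norm (x - of_nat n) \<le> inverse (real CARD('p)) ^ Suc 0" by (rule padic_nat_dense[OF x])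
  from padic_Gamma_approx[OF x this] have "padic_norm (morita_factorial n - padic_Gamma x) < padic_norm (morita_factorial n :: 'p padic)"
    using inverse_card_less_1[where ?'p = 'p] padic_norm_minus_commute[of "padic_Gamma x"]
    by (auto elim: order.strict_trans1 simp del: inverse_card_less_1)
  from padic_norm_eq_of_diff_less[OF this] show ?thesis by simp
qed

lemma padic_Gamma_neq_0: "padic_norm (x :: 'p padic) \<le> 1 \<Longrightarrow> padic_Gamma x \<noteq> 0"
  using padic_norm_padic_Gamma by force

end

section \<open>Reflection and duplication formulas\<close>

context
  assumes odd_p: "odd CARD('p::prime_card)"
begin

lemma padic_Gamma_0 [simp]: "padic_Gamma (0 :: 'p padic) = 1"
  using padic_Gamma_of_nat[OF odd_p, of 0] by simp

lemma padic_Gamma_1 [simp]: "padic_Gamma (1 :: 'p padic) = -1"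
  using padic_Gamma_plus_1[OF odd_p, of 0] by simp

lemma padic_Gamma_reflection_step:
  assumes "padic_norm (x :: 'p padic) \<le> 1"
  shows "padic_Gamma (x + 1) * padic_Gamma (- x) =
    (if padic_norm x < 1 then 1 else - 1) * (padic_Gamma x * padic_Gamma (1 - x))"
  using padic_Gamma_plus_1[OF odd_p, of x] padic_Gamma_plus_1[OF odd_p, of "- x"] assms
  by (simp add: algebra_simps)

text \<open>Each unit step changes the product by a sign only, so its square is 1 at all naturals
  and, by continuity, everywhere.\<close>

lemma padic_Gamma_reflection_square:
  assumes x: "padic_norm (x :: 'p padic) \<le> 1"
  shows "(padic_Gamma x * padic_Gamma (1 - x)) ^ 2 = 1"
proof -
  have n: "(padic_Gamma (of_nat n) * padic_Gamma (1 - of_nat n :: 'p padic)) ^ 2 = 1" for n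
  proof (induction n)
    case (Suc n)
    have "padic_Gamma (of_nat (Suc n)) * padic_Gamma (1 - of_nat (Suc n) :: 'p padic) =
      padic_Gamma (of_nat n + 1) * padic_Gamma (- of_nat n)" by (simp add: add.commute)
    also have "\<dots> = (if padic_norm (of_nat n :: 'p padic) < 1 then 1 else - 1) *
        (padic_Gamma (of_nat n) * padic_Gamma (1 - of_nat n))"
      by (rule padic_Gamma_reflection_step) simp
    finally show ?case using Suc by (simp add: power_mult_distrib)
  qed simp
  obtain s where s: "(\<lambda>N. of_nat (s N)) \<longlonglongrightarrow> x" using padic_nat_sequence[OF x] by blast
  have "(\<lambda>N. (padic_Gamma (of_nat (s N)) * padic_Gamma (1 - of_nat (s N))) ^ 2) \<longlonglongrightarrow> (padic_Gamma x * padic_Gamma (1 - x)) ^ 2"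
    using s by (intro padic_tendsto_power tendsto_mult padic_Gamma_tendsto[OF odd_p] tendsto_diff padic_norm_diff_le) auto
  then show ?thesis unfolding n using LIMSEQ_unique[OF tendsto_const] by metis
qed

lemma padic_square_eq_1_cong:
  assumes "(x :: 'p padic) ^ 2 = 1" "y ^ 2 = 1" "padic_norm (x - y) < 1"
  shows "x = y"
proof (rule ccontr)
  assume "x \<noteq> y"
  moreover have "x = 1 \<or> x = -1" "y = 1 \<or> y = -1" using assms(1,2) by (auto simp: power2_eq_1_iff)
  ultimately have "x - y = 2 \<or> x - y = -2" by auto
  then show False using assms(3) padic_norm_2[OF odd_p] by auto
qed

text \<open>The value is a square root of 1 and hence determined modulo p. There x may be replaced
  by n, which is reached from 1, where the value is -1, by n - 1 sign changes.\<close>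

lemma padic_Gamma_reflection:
  assumes x: "padic_norm (x :: 'p padic) \<le> 1"
    and n: "1 \<le> n" "n \<le> CARD('p)" "padic_norm (x - of_nat n) < 1"
  shows "padic_Gamma x * padic_Gamma (1 - x) = (-1) ^ n"
proof (rule padic_square_eq_1_cong)
  have e: "padic_Gamma (of_nat n) * padic_Gamma (1 - of_nat n :: 'p padic) = (-1) ^ n" using n(1,2)
  proof (induction n rule: dec_induct)
    case (step n)
    have "padic_norm (of_nat n :: 'p padic) = 1"
      using step by (intro padic_norm_of_nat_eq_1) (auto dest: dvd_imp_le)
    moreover have "padic_Gamma (of_nat (Suc n)) * padic_Gamma (1 - of_nat (Suc n) :: 'p padic) =
      padic_Gamma (of_nat n + 1) * padic_Gamma (- of_nat n)" by (simp add: add.commute)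
    ultimately show ?case using step padic_Gamma_reflection_step[of "of_nat n"] by simp
  qed simp
  have xn: "padic_norm (x - of_nat n) \<le> inverse (real CARD('p)) ^ Suc 0"
    using padic_norm_less_1[OF n(3)] by simp
  have 1: "padic_norm (padic_Gamma x - padic_Gamma (of_nat n)) \<le> inverse (real CARD('p))"
    using padic_Gamma_cong[OF odd_p x _ xn] by simp
  have "padic_norm (padic_Gamma (1 - x) - padic_Gamma (1 - of_nat n)) \<le> inverse (real CARD('p)) ^ Suc 0"
  proof (rule padic_Gamma_cong[OF odd_p])
    show "padic_norm (1 - x) \<le> 1" "padic_norm (1 - of_nat n :: 'p padic) \<le> 1"
      using x by (auto intro: padic_norm_diff_le)
    show "padic_norm (1 - x - (1 - of_nat n)) \<le> inverse (real CARD('p)) ^ Suc 0"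
      using xn padic_norm_minus_commute[of x "of_nat n"] by simp
  qed
  then have 2: "padic_norm (padic_Gamma (1 - x) - padic_Gamma (1 - of_nat n)) \<le> inverse (real CARD('p))" by simp
  have "padic_norm (padic_Gamma (1 - x) * (padic_Gamma x - padic_Gamma (of_nat n)) +
      padic_Gamma (of_nat n) * (padic_Gamma (1 - x) - padic_Gamma (1 - of_nat n))) \<le> inverse (real CARD('p))"
    using x by (intro padic_norm_add_le padic_norm_mult_le 1 2) (auto simp: padic_norm_padic_Gamma[OF odd_p] padic_norm_diff_le)
  also have "padic_Gamma (1 - x) * (padic_Gamma x - padic_Gamma (of_nat n)) +
      padic_Gamma (of_nat n) * (padic_Gamma (1 - x) - padic_Gamma (1 - of_nat n)) =
      padic_Gamma x * padic_Gamma (1 - x) - (-1) ^ n"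
    unfolding e[symmetric] by (simp add: algebra_simps)
  finally show "padic_norm (padic_Gamma x * padic_Gamma (1 - x) - (-1) ^ n) < 1"
    using inverse_card_less_1[where ?'p = 'p] by linarith
qed (simp_all add: padic_Gamma_reflection_square[OF x] flip: power_mult)

text \<open>Removing the multiples of p from m! leaves, up to sign, the inverse of Gamma(-m); the
  removed part is p^k k! with k = m div p. This ties gamma to the coefficients of the exponential
  and also yields the norm of m!.\<close>

lemma fact_mult_padic_Gamma_minus:
  "fact m * padic_Gamma (- of_nat m :: 'p padic) = (- of_nat CARD('p)) ^ (m div CARD('p)) * fact (m div CARD('p))"
proof (induction m)
  case (Suc m)
  let ?p = "CARD('p)"
  have n: "padic_norm (- of_nat (Suc m) :: 'p padic) < 1 \<longleftrightarrow> ?p dvd Suc m"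
    using padic_norm_of_int_diff_less_1_iff[of "int (Suc m)" 0, where ?'p = 'p]
    by (simp add: cong_0_iff del: of_nat_Suc)
  have e: "padic_Gamma (- of_nat m :: 'p padic) = - (if ?p dvd Suc m then 1 else - of_nat (Suc m)) * padic_Gamma (- of_nat (Suc m))"
  proof -
    have "- of_nat (Suc m) + 1 = (- of_nat m :: 'p padic)" by simp
    then show ?thesis using padic_Gamma_plus_1[OF odd_p, of "- of_nat (Suc m)"] n by (simp del: of_nat_Suc)
  qed
  show ?case
  proof (cases "?p dvd Suc m")
    case True
    then have d: "Suc m div ?p = Suc (m div ?p)" by (simp add: div_Suc dvd_imp_mod_0)
    then have "Suc m = ?p * Suc (m div ?p)" using True by (metis dvd_mult_div_cancel)
    then have "(of_nat (Suc m) :: 'p padic) = of_nat ?p * of_nat (Suc (m div ?p))" by (metis of_nat_mult)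
    moreover have "fact (Suc m) * padic_Gamma (- of_nat (Suc m) :: 'p padic) =
        - (of_nat (Suc m) * (fact m * padic_Gamma (- of_nat m)))"
      using e True by (simp add: algebra_simps)
    ultimately show ?thesis unfolding d Suc by (simp add: algebra_simps)
  next
    case False
    then have d: "Suc m div ?p = m div ?p" by (simp add: div_Suc dvd_eq_mod_eq_0)
    have "fact (Suc m) * padic_Gamma (- of_nat (Suc m) :: 'p padic) = fact m * padic_Gamma (- of_nat m)"
      using e False by (simp add: algebra_simps)
    then show ?thesis unfolding d Suc .
  qed
qed simp

lemma padic_norm_fact:
  "padic_norm (fact m :: 'p padic) = inverse (real CARD('p)) ^ (m div CARD('p)) * padic_norm (fact (m div CARD('p)) :: 'p padic)"
proof -
  have "padic_norm (fact m * padic_Gamma (- of_nat m :: 'p padic)) = padic_norm (fact m :: 'p padic)"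
    by (simp add: padic_norm_mult padic_norm_padic_Gamma[OF odd_p])
  then show ?thesis unfolding fact_mult_padic_Gamma_minus by (simp add: padic_norm_mult padic_norm_power)
qed

lemma padic_norm_half: "padic_norm (x / 2 :: 'p padic) = padic_norm x"
  by (simp add: padic_norm_divide padic_norm_2[OF odd_p])

text \<open>When n grows by 1, one gamma factor on the left gains n/2 and the one on the right gains
  n, unless p divides n. So the exponent of 2 counts the non-multiples of p below n.\<close>

lemma padic_Gamma_duplication_nat:
  "padic_Gamma (of_nat n / 2) * padic_Gamma ((of_nat n + 1) / 2) * 2 ^ card {i. i < n \<and> \<not> CARD('p) dvd i} =
    padic_Gamma (1 / 2) * padic_Gamma (of_nat n :: 'p padic)"
proof (induction n)
  case (Suc n)
  let ?p = "CARD('p)" and ?x = "of_nat n :: 'p padic"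
  have n: "padic_norm ?x < 1 \<longleftrightarrow> ?p dvd n"
    using padic_norm_of_int_diff_less_1_iff[of "int n" 0, where ?'p = 'p] by (simp add: cong_0_iff)
  have "{i. i < Suc n \<and> \<not> ?p dvd i} = (if ?p dvd n then {} else {n}) \<union> {i. i < n \<and> \<not> ?p dvd i}"
    by (auto simp: less_Suc_eq)
  then have c: "card {i. i < Suc n \<and> \<not> ?p dvd i} = (if ?p dvd n then 0 else 1) + card {i. i < n \<and> \<not> ?p dvd i}"
    by auto
  have h: "(of_nat (Suc n) + 1) / 2 = ?x / 2 + 1" by (simp add: field_simps)
  have "padic_Gamma (?x / 2 + 1) = - (if ?p dvd n then 1 else ?x / 2) * padic_Gamma (?x / 2)"
    using padic_Gamma_plus_1[OF odd_p, of "?x / 2"] n by (simp add: padic_norm_half)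
  moreover have "padic_Gamma (of_nat (Suc n) :: 'p padic) = - (if ?p dvd n then 1 else ?x) * padic_Gamma ?x"
    using padic_Gamma_plus_1[OF odd_p, of ?x] n by (simp add: add.commute)
  ultimately show ?case unfolding c h using Suc by (auto simp: algebra_simps add.commute)
qed simp

lemma padic_norm_of_nat_divide_card_minus_1: "padic_norm (of_nat k / of_nat (CARD('p) - 1) :: 'p padic) \<le> 1"
proof -
  have "\<not> CARD('p) dvd CARD('p) - 1" using prime_card_gt_1[where ?'p = 'p] by (intro nat_dvd_not_less) auto
  then show ?thesis by (simp add: padic_norm_divide padic_norm_of_nat_eq_1 del: One_nat_def)
qed

lemma sum_power_card: "(CARD('p) - 1) * (\<Sum>i<N. CARD('p) ^ i) = CARD('p) ^ N - 1"
proof -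
  have "int ((CARD('p) - 1) * (\<Sum>i<N. CARD('p) ^ i)) = int (CARD('p) ^ N - 1)"
    using power_diff_1_eq[of "int CARD('p)" N] prime_card_gt_1[where ?'p = 'p]
    by (simp add: of_nat_diff)
  then show ?thesis by linarith
qed

lemma card_not_dvd_less:
  assumes "k < p" "M > 0" "p > 0"
  shows "card {i. i < p * M - k \<and> \<not> p dvd i} = p * M - k - M"
proof -
  have "i < p * M - k \<longleftrightarrow> j < M" if "i = p * j" for i j
  proof
    assume "j < M"
    then have "p * j + p \<le> p * M" by (metis Suc_leI mult_Suc_right mult_le_mono2 add.commute)
    then show "i < p * M - k" using that assms by linarith
  next
    assume "i < p * M - k"
    then have "p * j < p * M" using that by linarith
    then show "j < M" by simp
  qed
  then have "{i. i < p * M - k \<and> p dvd i} = (\<lambda>j. p * j) ` {..<M}" by (auto elim!: dvdE)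
  then have "card {i. i < p * M - k \<and> p dvd i} = M"
    using assms by (simp add: card_image inj_on_def)
  moreover have "{i. i < p * M - k \<and> \<not> p dvd i} = {..<p * M - k} - {i. i < p * M - k \<and> p dvd i}" by auto
  moreover have "card ({..<p * M - k} - {i. i < p * M - k \<and> p dvd i}) =
      card {..<p * M - k} - card {i. i < p * M - k \<and> p dvd i}"
    by (rule card_Diff_subset) auto
  ultimately show ?thesis by simp
qed

text \<open>The naturals n N = 1 + d (p^N - 1)/(p - 1) with d = p - 1 - k tend to w. Exactly d p^N
  non-multiples of p lie below n (N+1), so the power of 2 in the formula for naturals tends to
  omega(2)^d, the inverse of omega(2)^k.\<close>

lemma padic_Gamma_duplication:
  fixes k defines "w \<equiv> of_nat k / of_nat (CARD('p) - 1) :: 'p padic"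
  assumes k: "k < CARD('p) - 1"
  shows "padic_Gamma (w / 2) * padic_Gamma ((w + 1) / 2) =
    teichmueller (2 :: 'p mod_ring) ^ k * padic_Gamma (1 / 2) * padic_Gamma w"
proof -
  let ?p = "CARD('p)" and ?Q = "CARD('p) - 1"
  define e where "e N = (\<Sum>i<N. ?p ^ i)" for N
  define d where "d = ?Q - k"
  have pd: "d + k + 1 = ?p" and Qd: "d + k = ?Q" using k by (auto simp: d_def)
  define n where "n N = 1 + e N * d" for N
  have Q: "?p = ?Q + 1" "?Q > 0" using prime_card_gt_1[where ?'p = 'p] by auto
  have eS: "e (Suc N) = 1 + ?p * e N" for N
    by (simp add: e_def sum.lessThan_Suc_shift sum_distrib_left del: sum.lessThan_Suc)
  \<comment> \<open>In this form it is visible that the multiples of p below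
    \<open>n (Suc N)\<close> number exactly \<open>n N\<close>.\<close>
  have n1: "n (Suc N) = ?p * n N - k" for N
  proof -
    have "n (Suc N) + k = (d + k + 1) + ?p * e N * d" by (simp add: n_def eS algebra_simps)
    also have "\<dots> = ?p * n N" unfolding pd by (simp add: n_def algebra_simps)
    finally show ?thesis by linarith
  qed
  have n2: "n (Suc N) = n N + ?p ^ N * d" for N by (simp add: n_def e_def algebra_simps)
  have c: "card {i. i < n (Suc N) \<and> \<not> ?p dvd i} = ?p ^ N * d" for N
  proof -
    have "card {i. i < ?p * n N - k \<and> \<not> ?p dvd i} = ?p * n N - k - n N"
      using k Q by (intro card_not_dvd_less) (auto simp: n_def)
    then show ?thesis unfolding n1[symmetric] by (simp add: n2)
  qed
  have "?Q * n N = k + ?p ^ N * d" for N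
  proof -
    have "?Q * n N = ?Q + (?Q * e N) * d" by (simp add: n_def algebra_simps)
    also have "\<dots> = (d + k) + (?p ^ N - 1) * d" unfolding e_def sum_power_card Qd ..
    also have "\<dots> = k + (1 + (?p ^ N - 1)) * d" by (simp only: algebra_simps)
    finally show ?thesis by simp
  qed
  then have "(of_nat ?Q * of_nat (n N) :: 'p padic) = of_nat k + of_nat ?p ^ N * of_nat d" for N
    by (metis of_nat_add of_nat_mult of_nat_power)
  moreover have Q0: "(of_nat ?Q :: 'p padic) \<noteq> 0" using Q(2) by (simp del: of_nat_diff One_nat_def)
  ultimately have "(of_nat (n N) :: 'p padic) = w + of_nat ?p ^ N * (of_nat d / of_nat ?Q)" for N
    unfolding w_def by (simp add: field_simps del: of_nat_diff One_nat_def)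
  then have "(\<lambda>N. of_nat (n N)) \<longlonglongrightarrow> w + 0 * (of_nat d / of_nat ?Q)"
    by (simp only:) (intro tendsto_intros card_power_tendsto_0)
  from LIMSEQ_Suc[OF this] have nw: "(\<lambda>N. of_nat (n (Suc N))) \<longlonglongrightarrow> w" by simp
  have half: "(\<lambda>N. (of_nat (n (Suc N)) + c) / 2) \<longlonglongrightarrow> (w + c) / 2" for c
    unfolding divide_inverse by (intro tendsto_intros nw)
  have n_half: "padic_norm ((of_nat j + (1::'p padic)) / 2) \<le> 1" "padic_norm ((of_nat j + (0::'p padic)) / 2) \<le> 1" for j
    unfolding padic_norm_half using padic_norm_of_nat_le_1[of "Suc j", where ?'p = 'p] by (auto simp: add.commute)
  have two: "(\<lambda>N. 2 ^ (?p ^ N) :: 'p padic) \<longlonglongrightarrow> teichmueller (2 :: 'p mod_ring)"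
    using teichmueller_power_limit[of 2, where ?'p = 'p] by simp
  have "(\<lambda>N. padic_Gamma ((of_nat (n (Suc N)) + 0) / 2) * padic_Gamma ((of_nat (n (Suc N)) + 1) / 2) * (2 ^ (?p ^ N)) ^ d)
    \<longlonglongrightarrow> padic_Gamma ((w + 0) / 2) * padic_Gamma ((w + 1) / 2) * teichmueller (2 :: 'p mod_ring) ^ d"
    by (intro tendsto_mult padic_Gamma_tendsto[OF odd_p] padic_tendsto_power n_half half two)
  moreover have "padic_Gamma ((of_nat (n (Suc N)) + 0) / 2) * padic_Gamma ((of_nat (n (Suc N)) + 1) / 2) * (2 ^ (?p ^ N)) ^ d
    = padic_Gamma (1 / 2) * padic_Gamma (of_nat (n (Suc N)) :: 'p padic)" for N
    using padic_Gamma_duplication_nat[of "n (Suc N)"] unfolding c by (simp add: power_mult)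
  moreover have "(\<lambda>N. padic_Gamma (1 / 2) * padic_Gamma (of_nat (n (Suc N)))) \<longlonglongrightarrow> padic_Gamma (1 / 2) * padic_Gamma w"
    by (intro tendsto_mult tendsto_const padic_Gamma_tendsto[OF odd_p] nw padic_norm_of_nat_le_1)
  ultimately have e: "padic_Gamma (w / 2) * padic_Gamma ((w + 1) / 2) * teichmueller (2 :: 'p mod_ring) ^ d =
      padic_Gamma (1 / 2) * padic_Gamma w"
    using LIMSEQ_unique by force
  have "\<not> ?p dvd 2" using primes_dvd_imp_eq[OF prime_card two_is_prime_nat, where ?'a1 = 'p] odd_p by (cases "?p = 2") auto
  then have "(2 :: 'p mod_ring) \<noteq> 0" using of_nat_0_mod_ring_dvd[of 2, where ?'a = 'p] by auto
  then have "teichmueller (2 :: 'p mod_ring) ^ d * teichmueller (2 :: 'p mod_ring) ^ k = 1"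
    unfolding power_add[symmetric] Qd by (rule teichmueller_power_card_minus_1)
  then have "padic_Gamma (w / 2) * padic_Gamma ((w + 1) / 2) =
    (padic_Gamma (w / 2) * padic_Gamma ((w + 1) / 2) * teichmueller (2 :: 'p mod_ring) ^ d) * teichmueller (2 :: 'p mod_ring) ^ k"
    by (simp add: mult.assoc)
  then show ?thesis unfolding e by (simp add: algebra_simps)
qed

section \<open>Values at 1/2, 1/4 and 3/4\<close>

lemma padic_norm_quarter: "padic_norm (1 / 4 :: 'p padic) = 1"
proof -
  have "(1 / 4 :: 'p padic) = (1 / 2) / 2" by simp
  then show ?thesis by (simp only: padic_norm_half padic_norm_1)
qed

lemma padic_Gamma_half_square:
  "padic_Gamma (1 / 2 :: 'p padic) ^ 2 = (-1) ^ ((CARD('p) + 1) div 2)"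
proof -
  let ?n = "(CARD('p) + 1) div 2"
  have "2 * ?n = CARD('p) + 1" using odd_p by simp
  then have "(2 * of_nat ?n :: 'p padic) = of_nat CARD('p) + 1" by (metis of_nat_1 of_nat_add of_nat_mult of_nat_numeral)
  then have "1 / 2 - of_nat ?n = - (of_nat CARD('p) :: 'p padic) / 2" by (simp add: field_simps)
  then have "padic_norm (1 / 2 - of_nat ?n :: 'p padic) < 1" by (simp only: padic_norm_half padic_norm_minus padic_norm_card inverse_card_less_1)
  moreover have "1 \<le> ?n" "?n \<le> CARD('p)" using \<open>2 * ?n = CARD('p) + 1\<close> prime_card_gt_1[where ?'p = 'p] by linarith+
  ultimately have "padic_Gamma (1 / 2 :: 'p padic) * padic_Gamma (1 - 1 / 2) = (-1) ^ ?n"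
    by (intro padic_Gamma_reflection) (auto simp: padic_norm_half)
  then show ?thesis by (simp add: power2_eq_square)
qed

lemma padic_Gamma_quarters:
  "padic_Gamma (1 / 4) * padic_Gamma (3 / 4 :: 'p padic) =
    (-1) ^ (if CARD('p) mod 4 = 1 then (3 * CARD('p) + 1) div 4 else (CARD('p) + 1) div 4)"
proof -
  let ?p = "CARD('p)"
  \<comment> \<open>The factor c makes c p + 1 divisible by 4, so that n is the representative of
    1/4 modulo p in the range 1..p required by reflection.\<close>
  define c where "c = (if ?p mod 4 = 1 then 3 else 1 :: nat)"
  define n where "n = (c * ?p + 1) div 4"
  have "(c * ?p + 1) mod 4 = 0"
  proof -
    have "?p mod 4 = 1 \<or> ?p mod 4 = 3" using odd_p by presburger
    then show ?thesis unfolding c_def by (auto; presburger)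
  qed
  then have n: "4 * n = c * ?p + 1" unfolding n_def by presburger
  then have "(4 * of_nat n :: 'p padic) = of_nat c * of_nat ?p + 1" by (metis of_nat_1 of_nat_add of_nat_mult of_nat_numeral)
  then have e: "1 / 4 - of_nat n = - (of_nat c * of_nat ?p) * (1 / 4 :: 'p padic)" by (simp add: field_simps)
  have c: "c \<le> 3" by (simp add: c_def)
  have "padic_norm (1 / 4 - of_nat n :: 'p padic) \<le> 1 * inverse (real ?p)"
    unfolding e padic_norm_mult padic_norm_minus padic_norm_quarter padic_norm_card mult_1_right
    by (intro mult_right_mono) auto
  then have "padic_norm (1 / 4 - of_nat n :: 'p padic) < 1" using inverse_card_less_1[where ?'p = 'p] by linarith
  moreover have "1 \<le> n" using n by (cases n) auto
  moreover have "c * ?p \<le> 3 * ?p" using c by simp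
  then have "n \<le> ?p" using n prime_card_gt_1[where ?'p = 'p] by linarith
  ultimately have "padic_Gamma (1 / 4 :: 'p padic) * padic_Gamma (1 - 1 / 4) = (-1) ^ n"
    by (intro padic_Gamma_reflection) (auto simp: padic_norm_quarter)
  then show ?thesis by (simp add: n_def c_def)
qed

text \<open>Duplication at w = 1/2, combined with Gamma(1/2)^4 = 1. It identifies s(p) with the
  quadratic character of 2, the form in which it enters the character sums.\<close>

lemma padic_Gamma_quarters_teichmueller:
  "padic_Gamma (1 / 4) * padic_Gamma (3 / 4 :: 'p padic) * padic_Gamma (1 / 2) ^ 2 =
    teichmueller (2 :: 'p mod_ring) ^ ((CARD('p) - 1) div 2)"
proof -
  let ?m = "(CARD('p) - 1) div 2"
  have m: "?m < CARD('p) - 1" using prime_card_gt_1[where ?'p = 'p] odd_p by (auto elim!: oddE)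
  have 2: "2 * ?m = CARD('p) - 1" using odd_p by simp
  then have "(2 * of_nat ?m :: 'p padic) = of_nat (CARD('p) - 1)" by (metis of_nat_mult of_nat_numeral)
  moreover have "?m \<noteq> 0" using 2 prime_card_gt_1[where ?'p = 'p] by linarith
  then have "(of_nat ?m :: 'p padic) \<noteq> 0" by (simp only: of_nat_eq_0_iff) simp
  ultimately have w: "of_nat ?m / of_nat (CARD('p) - 1) = (1 / 2 :: 'p padic)"
    by (metis divide_divide_eq_left divide_self mult.commute)
  have "padic_Gamma (1 / 4) * padic_Gamma (3 / 4 :: 'p padic) = teichmueller (2 :: 'p mod_ring) ^ ?m * padic_Gamma (1 / 2) ^ 2"
    using padic_Gamma_duplication[OF m] unfolding w by (simp add: power2_eq_square)
  then have "padic_Gamma (1 / 4) * padic_Gamma (3 / 4 :: 'p padic) * padic_Gamma (1 / 2) ^ 2 =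
    teichmueller (2 :: 'p mod_ring) ^ ?m * (padic_Gamma (1 / 2) ^ 2) ^ 2"
    by (simp add: power2_eq_square)
  also have "((padic_Gamma (1 / 2) :: 'p padic) ^ 2) ^ 2 = 1"
    unfolding padic_Gamma_half_square by (simp flip: power_mult)
  finally show ?thesis by simp
qed

lemma padic_Gamma_quarters_sign:
  "padic_Gamma (1 / 4) * padic_Gamma (3 / 4 :: 'p padic) * padic_Gamma (1 / 2) ^ 2 =
    (-1) powi (\<lfloor>(real CARD('p) - 1) / 4\<rfloor> + \<lfloor>(real CARD('p) - 1) / 2\<rfloor>)"
proof -
  let ?p = "CARD('p)"
  have p: "?p \<ge> 1" using prime_card_gt_1[where ?'p = 'p] by simp
  have f4: "\<lfloor>(real ?p - 1) / 4\<rfloor> = int ((?p - 1) div 4)"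
    using floor_divide_of_nat_eq[of "?p - 1" 4, where ?'a = real] p by (simp add: of_nat_diff)
  have f2: "\<lfloor>(real ?p - 1) / 2\<rfloor> = int ((?p - 1) div 2)"
    using floor_divide_of_nat_eq[of "?p - 1" 2, where ?'a = real] p by (simp add: of_nat_diff)
  have "even ((if ?p mod 4 = 1 then (3 * ?p + 1) div 4 else (?p + 1) div 4) + (?p + 1) div 2) \<longleftrightarrow>
      even ((?p - 1) div 4 + (?p - 1) div 2)"
  proof (cases "?p mod 4 = 1")
    case True
    then obtain k where "?p = 4 * k + 1" by (metis mult_div_mod_eq)
    then show ?thesis by simp
  next
    case False
    then have "?p mod 4 = 3" using odd_p by presburger
    then obtain k where k: "?p = 4 * k + 3" by (metis mult_div_mod_eq)
    have "(4 * k + 2) div 4 = k" "(4 * k + 2) div 2 = 2 * k + 1" "(4 * k + 4) div 4 = k + 1" "(4 * k + 4) div 2 = 2 * k + 2"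
      by presburger+
    then show ?thesis using k False by (simp del: div_mult_self1 div_mult_self2 div_mult_self3 div_mult_self4)
  qed
  then have "(-1 :: 'p padic) ^ ((if ?p mod 4 = 1 then (3 * ?p + 1) div 4 else (?p + 1) div 4) + (?p + 1) div 2) =
      (-1) ^ ((?p - 1) div 4 + (?p - 1) div 2)"
    by (simp only: minus_one_power_iff)
  then show ?thesis
    unfolding padic_Gamma_quarters padic_Gamma_half_square f4 f2 by (simp only: power_add of_nat_add[symmetric] power_int_of_nat)
qed

end

unbundle no vec_syntax
unbundle fps_syntax

section \<open>Bounded power series\<close>

text \<open>\<open>gauss_le \<rho> C F\<close> says that the Gauss norm of \<open>F\<close> at radius \<open>\<rho>\<close> is at most \<open>C\<close>.\<close>

definition gauss_le :: "real \<Rightarrow> real \<Rightarrow> 'p::prime_card padic fps \<Rightarrow> bool" where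
  "gauss_le \<rho> C F \<longleftrightarrow> (\<forall>n. padic_norm (F $ n) * \<rho> ^ n \<le> C)"

lemma gauss_le_nonneg: "gauss_le \<rho> C F \<Longrightarrow> C \<ge> 0"
  unfolding gauss_le_def using padic_norm_nonneg[of "F $ 0"] by (metis mult.right_neutral order_trans power_0)

lemma gauss_leD: "gauss_le \<rho> C F \<Longrightarrow> \<rho> > 0 \<Longrightarrow> padic_norm (F $ n) \<le> C / \<rho> ^ n"
  by (simp add: gauss_le_def field_simps)

lemma gauss_leI: "\<rho> > 0 \<Longrightarrow> (\<And>n. padic_norm (F $ n) \<le> C / \<rho> ^ n) \<Longrightarrow> gauss_le \<rho> C F"
  by (simp add: gauss_le_def field_simps)

lemma gauss_le_add: "gauss_le \<rho> C F \<Longrightarrow> gauss_le \<rho> C G \<Longrightarrow> \<rho> > 0 \<Longrightarrow> gauss_le \<rho> C (F + G)"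
  by (intro gauss_leI) (auto intro!: padic_norm_add_le dest: gauss_leD)

lemma gauss_le_mono: "gauss_le \<rho> C F \<Longrightarrow> C \<le> D \<Longrightarrow> gauss_le \<rho> D F"
  unfolding gauss_le_def by (meson order_trans)

lemma gauss_le_1: "gauss_le \<rho> 1 1"
  by (auto simp: gauss_le_def)

lemma gauss_le_mult:
  assumes F: "gauss_le \<rho> C F" and G: "gauss_le \<rho> D G" and \<rho>: "\<rho> > 0"
  shows "gauss_le \<rho> (C * D) (F * G)"
proof (rule gauss_leI[OF \<rho>])
  fix n
  note CD = gauss_le_nonneg[OF F] gauss_le_nonneg[OF G]
  show "padic_norm ((F * G) $ n) \<le> C * D / \<rho> ^ n"
    unfolding fps_mult_nth
  proof (rule padic_norm_sum_le)
    fix i assume i: "i \<in> {0..n}"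
    have "padic_norm (F $ i * G $ (n - i)) \<le> (C / \<rho> ^ i) * (D / \<rho> ^ (n - i))"
      unfolding padic_norm_mult using CD \<rho> by (intro mult_mono gauss_leD F G) auto
    also have "\<dots> = C * D / \<rho> ^ n" using i by (simp flip: power_add)
    finally show "padic_norm (F $ i * G $ (n - i)) \<le> C * D / \<rho> ^ n" .
  qed (use CD \<rho> in auto)
qed

lemma gauss_le_power: "gauss_le \<rho> C F \<Longrightarrow> \<rho> > 0 \<Longrightarrow> gauss_le \<rho> (C ^ k) (F ^ k)"
  by (induction k) (auto intro: gauss_le_mult gauss_le_1)

text \<open>Each power G^k has Gauss norm at most D^k, so F only has to be bounded at radius
  D.\<close>

lemma gauss_le_compose:
  assumes G: "gauss_le \<rho> D G" and \<rho>: "\<rho> > 0" and F: "\<And>k. padic_norm (F $ k) * D ^ k \<le> B"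
  shows "gauss_le \<rho> B (F oo G)"
proof (rule gauss_leI[OF \<rho>])
  fix n
  have "B \<ge> 0" using F[of 0] padic_norm_nonneg[of "F $ 0"] by (metis mult.right_neutral order_trans power_0)
  show "padic_norm ((F oo G) $ n) \<le> B / \<rho> ^ n"
    unfolding fps_compose_nth
  proof (rule padic_norm_sum_le)
    fix i assume "i \<in> {0..n}"
    have "padic_norm (F $ i * G ^ i $ n) \<le> padic_norm (F $ i) * (D ^ i / \<rho> ^ n)"
      unfolding padic_norm_mult by (intro mult_left_mono gauss_leD[OF gauss_le_power[OF G \<rho>] \<rho>]) auto
    also have "\<dots> = padic_norm (F $ i) * D ^ i / \<rho> ^ n" by simp
    also have "\<dots> \<le> B / \<rho> ^ n" using \<rho> by (intro divide_right_mono F) auto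
    finally show "padic_norm (F $ i * G ^ i $ n) \<le> B / \<rho> ^ n" .
  qed (use \<open>B \<ge> 0\<close> \<rho> in auto)
qed

section \<open>The exponential of a power series\<close>

definition fps_expc :: "'a::field_char_0 fps \<Rightarrow> 'a fps" where
  "fps_expc A = fps_exp 1 oo A"

lemma fps_expc_nth_0 [simp]: "fps_expc A $ 0 = 1"
  by (simp add: fps_expc_def)

lemma fps_expc_0 [simp]: "fps_expc 0 = 1"
  by (simp add: fps_expc_def fps_compose_0_right)

lemma fps_deriv_expc: "A $ 0 = 0 \<Longrightarrow> fps_deriv (fps_expc A) = fps_deriv A * fps_expc A"
  unfolding fps_expc_def by (subst fps_compose_deriv) (auto simp: mult.commute)

text \<open>In characteristic 0 a linear first-order differential equation determines every
  coefficient from the constant one. Additivity of the exponential reduces to this.\<close>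

lemma fps_expc_unique:
  fixes F G A :: "'a::field_char_0 fps"
  assumes F: "fps_deriv F = A * F" and G: "fps_deriv G = A * G" and 0: "F $ 0 = G $ 0"
  shows "F = G"
proof -
  have "F $ n = G $ n" for n
  proof (induction n rule: less_induct)
    case (less n)
    show ?case
    proof (cases n)
      case (Suc m)
      have "fps_deriv F $ m = fps_deriv G $ m"
        unfolding F G fps_mult_nth using less Suc by (intro sum.cong) auto
      then have "of_nat (m + 1) * F $ (m + 1) = of_nat (m + 1) * G $ (m + 1)" by (simp only: fps_deriv_nth)
      then show ?thesis unfolding Suc Suc_eq_plus1 by (simp only: mult_cancel_left of_nat_eq_0_iff) simp
    qed (simp add: 0)
  qed
  then show ?thesis by (simp add: fps_eq_iff)
qed

lemma fps_expc_add:
  assumes "A $ 0 = 0" "B $ 0 = 0"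
  shows "fps_expc (A + B) = fps_expc A * fps_expc B"
  by (rule fps_expc_unique[of _ "fps_deriv A + fps_deriv B"])
     (use assms in \<open>auto simp: fps_deriv_expc algebra_simps\<close>)

lemma fps_expc_power: "A $ 0 = 0 \<Longrightarrow> fps_expc A ^ n = fps_expc (of_nat n * A)"
  by (induction n) (auto simp: fps_expc_add distrib_right fps_mult_nth_0)

lemma fps_expc_compose: "A $ 0 = 0 \<Longrightarrow> B $ 0 = 0 \<Longrightarrow> fps_expc A oo B = fps_expc (A oo B)"
  unfolding fps_expc_def by (rule fps_compose_assoc[symmetric])

lemma fps_expc_X: "fps_expc (fps_const c * fps_X) = fps_exp c"
proof (rule fps_expc_unique)
  show "fps_deriv (fps_expc (fps_const c * fps_X)) = fps_const c * fps_expc (fps_const c * fps_X)"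
    by (subst fps_deriv_expc) simp_all
  show "fps_deriv (fps_exp c) = fps_const c * fps_exp c" by simp
qed simp

section \<open>Radii\<close>

text \<open>\<open>exp_radius p\<close> is the radius of convergence \<open>p powr (-1/(p-1))\<close> of the p-adic exponential, and
  \<open>dwork_radius p\<close> that of \<open>exp (x + x^p / p)\<close>.\<close>

definition exp_radius :: "nat \<Rightarrow> real" where "exp_radius p = root (p - 1) (inverse (real p))"
definition dwork_radius :: "nat \<Rightarrow> real" where "dwork_radius p = root (p ^ 2) (exp_radius p / real p ^ 2)"

lemma
  assumes p: "p \<ge> 3"
  shows exp_radius_pos: "exp_radius p > 0" and exp_radius_power: "exp_radius p ^ (p - 1) = inverse (real p)"
    and exp_radius_less_1: "exp_radius p < 1" and exp_radius_gt: "exp_radius p > inverse (real p)"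
proof -
  show pos: "exp_radius p > 0" using p by (simp add: exp_radius_def)
  show pw: "exp_radius p ^ (p - 1) = inverse (real p)"
    unfolding exp_radius_def using p by (intro real_root_pow_pos2) auto
  have "inverse (real p) < 1" using p by (simp add: field_simps)
  then have "\<not> 1 \<le> exp_radius p ^ (p - 1)" unfolding pw by simp
  then show lt: "exp_radius p < 1" using one_le_power[of "exp_radius p" "p - 1"] by linarith
  have "exp_radius p ^ (p - 1) < exp_radius p ^ 1"
    using p pos lt by (intro power_strict_decreasing) auto
  then show "exp_radius p > inverse (real p)" using pw by simp
qed

text \<open>The exponent p^2 and the divisor p^2 are chosen so that x^(p^2)/p^2, the first
  Artin-Hasse term missing from x + x^p/p, has Gauss norm exactly \<open>exp_radius p\<close>. The
  bound \<open>dwork_radius_gt\<close> makes the expansion of gamma converge and puts pi inside the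
  disc.\<close>

lemma
  assumes p: "p \<ge> 3"
  shows dwork_radius_pos: "dwork_radius p > 0" and dwork_radius_less_1: "dwork_radius p < 1"
    and dwork_radius_power_square: "dwork_radius p ^ (p ^ 2) = exp_radius p / real p ^ 2"
    and dwork_radius_gt: "real p * dwork_radius p ^ p > 1"
    and dwork_radius_power_le: "dwork_radius p ^ p \<le> exp_radius p"
proof -
  note r = exp_radius_pos[OF p] exp_radius_power[OF p] exp_radius_less_1[OF p] exp_radius_gt[OF p]
  show pos: "dwork_radius p > 0" using p r by (simp add: dwork_radius_def)
  show pw: "dwork_radius p ^ (p ^ 2) = exp_radius p / real p ^ 2"
    unfolding dwork_radius_def using p r by (intro real_root_pow_pos2) auto
  have p1: "real p ^ 2 \<ge> 1" using p by simp
  have "exp_radius p / real p ^ 2 < 1" using r p1 by (simp add: divide_less_eq)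
  then show "dwork_radius p < 1" using one_le_power[of "dwork_radius p" "p ^ 2"] pw by force
  have pp: "(dwork_radius p ^ p) ^ p = exp_radius p / real p ^ 2"
    using pw by (simp add: power2_eq_square flip: power_mult)
  show "real p * dwork_radius p ^ p > 1"
  proof (rule ccontr)
    assume "\<not> ?thesis"
    then have "(real p * dwork_radius p ^ p) ^ p \<le> 1" using pos by (intro power_le_one) auto
    moreover have "(real p * dwork_radius p ^ p) ^ p = real p ^ p * (exp_radius p / real p ^ 2)"
      unfolding power_mult_distrib pp ..
    moreover have "real p ^ p * (exp_radius p / real p ^ 2) = real p ^ (p - 2) * exp_radius p"
      using p by (simp add: power_diff)
    moreover have "real p ^ 1 * inverse (real p) < real p ^ (p - 2) * exp_radius p"
      using p r by (intro mult_le_less_imp_less power_increasing) auto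
    moreover have "real p ^ 1 * inverse (real p) = 1" using p by simp
    ultimately show False by linarith
  qed
  have "exp_radius p / real p ^ 2 \<le> exp_radius p * inverse (real p)"
    using p r by (simp add: field_simps power2_eq_square)
  also have "\<dots> = exp_radius p ^ (1 + (p - 1))" unfolding power_add r(2) by simp
  also have "\<dots> = exp_radius p ^ p" using p by simp
  finally show "dwork_radius p ^ p \<le> exp_radius p"
    unfolding pp[symmetric] using p r pos by (subst (asm) power_mono_iff) auto
qed

text \<open>Passing from i to i + 1 costs a factor p, which p - 1 further factors of size at most r
  absorb because r^(p-1) = 1/p. So all later Artin-Hasse terms obey the bound of the first missing
  one.\<close>

lemma dwork_radius_power_power:
  assumes p: "p \<ge> 3" and i: "i \<ge> 2"
  shows "real p ^ i * dwork_radius p ^ (p ^ i) \<le> exp_radius p"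
  using i
proof (induction i rule: dec_induct)
  case base
  then show ?case using p by (simp add: dwork_radius_power_square[OF p])
next
  case (step i)
  let ?\<rho> = "dwork_radius p" and ?r = "exp_radius p"
  note r = exp_radius_pos[OF p] exp_radius_power[OF p] exp_radius_less_1[OF p] dwork_radius_pos[OF p]
  have pos: "?\<rho> ^ (p ^ i) > 0" using r by simp
  have "1 * ?\<rho> ^ (p ^ i) \<le> real p ^ i * ?\<rho> ^ (p ^ i)" using p r by (intro mult_right_mono) auto
  with step have "?\<rho> ^ (p ^ i) \<le> ?r" by linarith
  then have "(?\<rho> ^ (p ^ i)) ^ (p - 1) \<le> inverse (real p)" using power_mono[of "?\<rho> ^ (p ^ i)" ?r "p - 1"] pos r by simp
  then have *: "real p * (?\<rho> ^ (p ^ i)) ^ (p - 1) \<le> 1" using p by (simp add: field_simps)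
  have "real p ^ Suc i * ?\<rho> ^ (p ^ Suc i) = real p ^ i * real p * (?\<rho> ^ (p ^ i)) ^ (1 + (p - 1))"
    using p by (simp flip: power_mult add: mult.commute)
  also have "\<dots> = (real p ^ i * ?\<rho> ^ (p ^ i)) * (real p * (?\<rho> ^ (p ^ i)) ^ (p - 1))"
    by (simp only: power_add power_one_right mult_ac)
  also have "\<dots> \<le> (real p ^ i * ?\<rho> ^ (p ^ i)) * 1"
    using pos by (intro mult_left_mono *) auto
  finally show ?case using step by simp
qed

lemma odd_prime_card_ge_3: "odd CARD('p::prime_card) \<Longrightarrow> CARD('p) \<ge> 3"
  using prime_card_ge_2[where ?'p = 'p] by (cases "CARD('p) = 2") auto

text \<open>Legendre's bound v(k!) <= k/(p - 1), obtained by recursion from k to k div p.\<close>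

lemma padic_norm_fact_ge:
  assumes odd_p: "odd CARD('p::prime_card)"
  shows "exp_radius CARD('p) ^ k \<le> padic_norm (fact k :: 'p padic)"
proof (induction k rule: less_induct)
  case (less k)
  let ?p = "CARD('p)" and ?r = "exp_radius CARD('p)"
  note p3 = odd_prime_card_ge_3[OF odd_p]
  note r = exp_radius_pos[OF p3] exp_radius_power[OF p3] exp_radius_less_1[OF p3]
  show ?case
  proof (cases "k = 0")
    case False
    have "?r ^ k \<le> ?r ^ ((1 + (?p - 1)) * (k div ?p))"
      using p3 r by (intro power_decreasing) (auto simp: less_imp_le)
    also have "\<dots> = inverse (real ?p) ^ (k div ?p) * ?r ^ (k div ?p)"
      unfolding power_mult power_add r(2) by (simp add: power_mult_distrib mult.commute)
    also have "\<dots> \<le> inverse (real ?p) ^ (k div ?p) * padic_norm (fact (k div ?p) :: 'p padic)"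
      using False p3 by (intro mult_left_mono less) auto
    also have "\<dots> = padic_norm (fact k :: 'p padic)" by (rule padic_norm_fact[OF odd_p, symmetric])
    finally show ?thesis .
  qed simp
qed

lemma padic_norm_inverse_fact_le:
  assumes odd_p: "odd CARD('p::prime_card)"
  shows "padic_norm (1 / fact k :: 'p padic) * exp_radius CARD('p) ^ k \<le> 1"
proof -
  have "padic_norm (fact k :: 'p padic) > 0"
    using exp_radius_pos[OF odd_prime_card_ge_3[OF odd_p]] padic_norm_fact_ge[OF odd_p, of k]
    by (meson order_less_le_trans zero_less_power)
  then show ?thesis using padic_norm_fact_ge[OF odd_p, of k] by (simp add: padic_norm_divide field_simps)
qed

lemma gauss_le_expc:
  assumes odd_p: "odd CARD('p::prime_card)" and A: "gauss_le \<rho> (exp_radius CARD('p)) A" and \<rho>: "\<rho> > 0"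
  shows "gauss_le \<rho> 1 (fps_expc (A :: 'p padic fps))"
  unfolding fps_expc_def
  using padic_norm_inverse_fact_le[OF odd_p] by (intro gauss_le_compose[OF A \<rho>]) simp

section \<open>Integrality of the Artin--Hasse exponential\<close>

lemma power_card_cong:
  assumes c: "padic_norm (c :: 'p::prime_card padic) \<le> 1"
  shows "padic_norm (c ^ CARD('p) - c) \<le> inverse (real CARD('p))"
proof -
  let ?p = "CARD('p)"
  obtain n where n: "padic_norm (c - of_nat n) \<le> inverse (real ?p) ^ Suc 0" by (rule padic_nat_dense[OF c])
  have "padic_norm (c ^ ?p - of_nat n ^ ?p) \<le> inverse (real ?p) ^ Suc (Suc 0)"
    by (rule padic_norm_power_card_diff[OF c _ n]) simp
  also have "\<dots> \<le> inverse (real ?p) ^ Suc 0" by (rule inverse_card_power_mono) simp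
  finally have 1: "padic_norm (c ^ ?p - of_nat n ^ ?p) \<le> inverse (real ?p)" by simp
  have "padic_norm (of_int (int n ^ ?p) - of_int (int n) :: 'p padic) < 1"
    unfolding padic_norm_of_int_diff_less_1_iff by (rule fermat_int[OF prime_card])
  then have 2: "padic_norm (of_nat n ^ ?p - of_nat n :: 'p padic) \<le> inverse (real ?p)"
    by (intro padic_norm_less_1) simp
  have 3: "padic_norm (of_nat n - c) \<le> inverse (real ?p)" using n padic_norm_minus_commute[of c] by simp
  show ?thesis by (rule padic_norm_diff_trans[OF padic_norm_diff_trans[OF 1 2] 3])
qed

lemma gauss_le_1_binomial_prime:
  fixes A B :: "'p::prime_card padic fps"
  assumes A: "gauss_le 1 1 A" and B: "gauss_le 1 1 B"
  shows "gauss_le 1 (inverse (real CARD('p))) ((A + B) ^ CARD('p) - A ^ CARD('p) - B ^ CARD('p))"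
proof -
  let ?p = "CARD('p)"
  define f where "f k = of_nat (?p choose k) * A ^ k * B ^ (?p - k)" for k
  have p0: "?p > 0" by simp
  have "(A + B) ^ ?p = sum f {..?p}" unfolding f_def by (rule binomial_ring)
  also have "{..?p} = insert 0 (insert ?p {1..<?p})" using p0 by auto
  also have "sum f \<dots> = f 0 + (f ?p + sum f {1..<?p})" using p0 by simp
  finally have e: "(A + B) ^ ?p - A ^ ?p - B ^ ?p = sum f {1..<?p}" by (simp add: f_def)
  have "padic_norm (f k $ n) \<le> inverse (real ?p)" if k: "k \<in> {1..<?p}" for k n
  proof -
    have "?p dvd (?p choose k)" using k by (intro dvd_choose_prime prime_card) auto
    then have 1: "padic_norm (of_nat (?p choose k) :: 'p padic) \<le> inverse (real ?p)"
      using padic_norm_of_nat_le_iff[of "?p choose k" 1, where ?'p = 'p] by simp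
    have "gauss_le 1 (1 ^ k * 1 ^ (?p - k)) (A ^ k * B ^ (?p - k))"
      by (intro gauss_le_mult gauss_le_power A B) auto
    then have 2: "padic_norm ((A ^ k * B ^ (?p - k)) $ n) \<le> 1" using gauss_leD by force
    have "f k $ n = (A ^ k * B ^ (?p - k)) $ n * of_nat (?p choose k)"
      by (simp add: f_def mult.assoc mult.commute[of "of_nat _"] flip: fps_of_nat)
    then show ?thesis using padic_norm_mult_le[OF 2 1] by simp
  qed
  then show ?thesis unfolding e by (intro gauss_leI) (auto simp: fps_sum_nth intro!: padic_norm_sum_le)
qed

text \<open>Taking p-th powers is additive modulo p, and the coefficients may stay as they are
  because c^p and c agree modulo p for p-adic integers.\<close>

lemma frobenius_cong:
  fixes c :: "nat \<Rightarrow> 'p::prime_card padic"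
  assumes c: "\<And>i. i < k \<Longrightarrow> padic_norm (c i) \<le> 1"
  shows "gauss_le 1 (inverse (real CARD('p)))
    ((\<Sum>i<k. fps_const (c i) * fps_X ^ i) ^ CARD('p) - (\<Sum>i<k. fps_const (c i) * fps_X ^ (CARD('p) * i)))"
  using c
proof (induction k)
  case 0
  then show ?case by (simp add: gauss_le_def zero_power)
next
  case (Suc k)
  let ?p = "CARD('p)"
  define A where "A = (\<Sum>i<k. fps_const (c i) * fps_X ^ i)"
  define A' where "A' = (\<Sum>i<k. fps_const (c i) * fps_X ^ (?p * i))"
  define B where "B = fps_const (c k) * fps_X ^ k"
  define B' where "B' = fps_const (c k) * fps_X ^ (?p * k)"
  have "padic_norm (A $ n) \<le> 1" for n
    unfolding A_def using Suc.prems by (auto simp: fps_sum_nth intro!: padic_norm_sum_le)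
  then have A: "gauss_le 1 1 A" by (simp add: gauss_le_def)
  have B: "gauss_le 1 1 B" using Suc.prems by (auto simp: gauss_le_def B_def)
  have 1: "gauss_le 1 (inverse (real ?p)) (A ^ ?p - A')"
    unfolding A_def A'_def using Suc by simp
  have "B ^ ?p - B' = fps_const (c k ^ ?p - c k) * fps_X ^ (?p * k)"
    by (simp add: B_def B'_def power_mult_distrib mult.commute flip: power_mult fps_const_power fps_const_sub add: algebra_simps)
  then have 2: "gauss_le 1 (inverse (real ?p)) (B ^ ?p - B')"
    using power_card_cong[of "c k"] Suc.prems by (auto simp: gauss_le_def)
  have "gauss_le 1 (inverse (real ?p)) (((A + B) ^ ?p - A ^ ?p - B ^ ?p) + ((A ^ ?p - A') + (B ^ ?p - B')))"
    by (intro gauss_le_add gauss_le_1_binomial_prime A B 1 2) auto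
  also have "((A + B) ^ ?p - A ^ ?p - B ^ ?p) + ((A ^ ?p - A') + (B ^ ?p - B')) = (A + B) ^ ?p - (A' + B')"
    by simp
  finally show ?case by (simp add: A_def A'_def B_def B'_def)
qed

lemma fps_power_nth_agree:
  fixes F T :: "'a::comm_ring_1 fps"
  assumes "\<And>i. i < n \<Longrightarrow> F $ i = T $ i" "i < n" shows "(F ^ k) $ i = (T ^ k) $ i"
  using assms(2)
proof (induction k arbitrary: i)
  case (Suc k)
  then show ?case by (auto simp: fps_mult_nth assms(1) intro!: sum.cong)
qed simp

text \<open>In the coefficient of x^n of F^k the coefficient F_n enters only linearly, once per
  factor; everything else is already seen by the truncation T.\<close>

lemma fps_power_nth_cutoff:
  fixes F T :: "'a::comm_ring_1 fps"
  assumes T: "\<And>i. i < n \<Longrightarrow> F $ i = T $ i" "T $ n = 0" and F: "F $ 0 = 1" and n: "n > 0"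
  shows "(F ^ k) $ n = (T ^ k) $ n + of_nat k * F $ n"
proof (induction k)
  case (Suc k)
  have split: "{0..n} = insert 0 (insert n {1..<n})" using n by auto
  have "(F ^ k) $ 0 = 1" using F by (induction k) auto
  moreover have "(\<Sum>i\<in>{1..<n}. F $ i * (F ^ k) $ (n - i)) = (\<Sum>i\<in>{1..<n}. T $ i * (T ^ k) $ (n - i))"
  proof (rule sum.cong[OF refl])
    fix i assume i: "i \<in> {1..<n}"
    then have "(F ^ k) $ (n - i) = (T ^ k) $ (n - i)" by (intro fps_power_nth_agree[of n] T(1)) auto
    then show "F $ i * (F ^ k) $ (n - i) = T $ i * (T ^ k) $ (n - i)" using i T(1)[of i] by simp
  qed
  ultimately show ?case using n T F Suc by (simp add: fps_mult_nth split algebra_simps)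
qed (use n in simp)

text \<open>Dwork's criterion: comparing the coefficients of \<open>x^n\<close> in \<open>F(x)^p = F(x^p) H(x)\<close> bounds \<open>p F_n\<close>.\<close>

lemma dwork_integrality:
  fixes F H :: "'p::prime_card padic fps"
  assumes F: "F $ 0 = 1" and H: "H $ 0 = 1" "\<And>n. n > 0 \<Longrightarrow> padic_norm (H $ n) \<le> inverse (real CARD('p))"
    and FH: "F ^ CARD('p) = (F oo fps_X ^ CARD('p)) * H"
  shows "padic_norm (F $ n) \<le> 1"
proof (induction n rule: less_induct)
  case (less n)
  let ?p = "CARD('p)"
  let ?F = "F oo fps_X ^ ?p"
  have p0: "?p > 0" by simp
  have nth: "?F $ i = (if ?p dvd i then F $ (i div ?p) else 0)" for i
    by (rule fps_nth_compose_X_power)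
  show ?case
  proof (cases "n = 0")
    case False
    define T where "T = (\<Sum>i<n. fps_const (F $ i) * fps_X ^ i)"
    define T' where "T' = (\<Sum>i<n. fps_const (F $ i) * fps_X ^ (?p * i))"
    have T: "T $ i = (if i < n then F $ i else 0)" for i
      by (simp add: T_def fps_sum_nth if_distrib[of "\<lambda>x. _ * x"] cong: if_cong)
    have "T' $ n = (\<Sum>i<n. F $ i * (if n = ?p * i then 1 else 0))" by (simp add: T'_def fps_sum_nth)
    also have "\<dots> = (if ?p dvd n then F $ (n div ?p) else 0)"
    proof (cases "?p dvd n")
      case True
      then obtain j where j: "n = ?p * j" by (elim dvdE)
      then have "j < n" using False prime_card_gt_1[where ?'p = 'p] by simp
      then show ?thesis using p0 by (simp add: j if_distrib[of "\<lambda>x. _ * x"] cong: if_cong)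
    next
      case False
      then show ?thesis by (auto intro!: sum.neutral)
    qed
    finally have T': "T' $ n = ?F $ n" by (simp add: nth)
    have "gauss_le 1 (inverse (real ?p)) (T ^ ?p - T')"
      unfolding T_def T'_def using less by (intro frobenius_cong)
    from gauss_leD[OF this, of n] have 1: "padic_norm (?F $ n - (T ^ ?p) $ n) \<le> inverse (real ?p)"
      by (simp add: T' padic_norm_minus_commute)
    have "(?F * H) $ n = (\<Sum>i<n. ?F $ i * H $ (n - i)) + ?F $ n"
      by (simp add: fps_mult_nth H atLeast0AtMost lessThan_Suc_atMost[symmetric])
    moreover have "padic_norm (?F $ i * H $ (n - i)) \<le> inverse (real ?p)" if "i < n" for i
    proof (rule padic_norm_mult_le)
      have "i div ?p < n" using that by (meson div_le_dividend le_less_trans)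
      then show "padic_norm (?F $ i) \<le> 1" using less by (simp add: nth)
      show "padic_norm (H $ (n - i)) \<le> inverse (real ?p)" using that by (intro H) simp
    qed
    then have 2: "padic_norm (\<Sum>i<n. ?F $ i * H $ (n - i)) \<le> inverse (real ?p)"
      by (intro padic_norm_sum_le) auto
    have "(F ^ ?p) $ n = (T ^ ?p) $ n + of_nat ?p * F $ n"
      using False F by (intro fps_power_nth_cutoff) (auto simp: T)
    ultimately have "of_nat ?p * F $ n = (\<Sum>i<n. ?F $ i * H $ (n - i)) + (?F $ n - (T ^ ?p) $ n)"
      unfolding FH by (simp add: algebra_simps)
    then have "padic_norm (of_nat ?p * F $ n) \<le> inverse (real ?p)"
      using padic_norm_add_le[OF 2 1] by simp
    then have "inverse (real ?p) * padic_norm (F $ n) \<le> inverse (real ?p) * 1" by (simp add: padic_norm_mult)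
    then show ?thesis using inverse_card_pos[where ?'p = 'p] by (subst (asm) mult_le_cancel_left_pos)
  qed (simp add: F)
qed

text \<open>The series x + x^p/p + x^(p^2)/p^2 + ..., whose exponential is the Artin-Hasse
  series.\<close>

definition artin_hasse_log :: "'p::prime_card padic fps" where
  "artin_hasse_log = Abs_fps (\<lambda>n. if n \<in> range (\<lambda>i. CARD('p) ^ i) then 1 / of_nat n else 0)"

lemma artin_hasse_log_0 [simp]: "(artin_hasse_log :: 'p::prime_card padic fps) $ 0 = 0"
  by (simp add: artin_hasse_log_def)

lemma artin_hasse_log_compose:
  "of_nat CARD('p) * artin_hasse_log =
    fps_const (of_nat CARD('p)) * fps_X + (artin_hasse_log oo fps_X ^ CARD('p) :: 'p::prime_card padic fps)"
proof (rule fps_ext)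
  fix n
  let ?p = "CARD('p)" and ?L = "artin_hasse_log :: 'p padic fps"
  have p0: "?p > 0" by simp
  have r1: "1 \<in> range (\<lambda>i. ?p ^ i)" by (metis power_0 rangeI)
  have rp: "?p * m \<in> range (\<lambda>i. ?p ^ i) \<longleftrightarrow> m \<in> range (\<lambda>i. ?p ^ i)" for m
  proof
    assume "?p * m \<in> range (\<lambda>i. ?p ^ i)"
    then obtain i where i: "?p * m = ?p ^ i" by auto
    then have "i \<noteq> 0" using prime_card_gt_1[where ?'p = 'p] by (intro notI) simp
    then obtain j where "i = Suc j" by (cases i) auto
    then have "m = ?p ^ j" using i by simp
    then show "m \<in> range (\<lambda>i. ?p ^ i)" by simp
  qed (auto intro: range_eqI[of _ _ "Suc _"])
  have nd: "n \<notin> range (\<lambda>i. ?p ^ i)" if "\<not> ?p dvd n" "n \<noteq> 1"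
  proof
    assume "n \<in> range (\<lambda>i. ?p ^ i)"
    then obtain i where "n = ?p ^ i" by auto
    then show False using that by (cases i) auto
  qed
  have "(of_nat ?p * ?L) $ n = of_nat ?p * ?L $ n" by (simp flip: fps_of_nat)
  also have "\<dots> = (fps_const (of_nat ?p) * fps_X + (?L oo fps_X ^ ?p)) $ n"
  proof (cases "?p dvd n")
    case True
    then obtain m where m: "n = ?p * m" by (elim dvdE)
    have "m = 0" if "?p * m \<le> Suc 0"
    proof (rule ccontr)
      assume "m \<noteq> 0"
      then have "?p * 1 \<le> ?p * m" by (intro mult_le_mono) auto
      then show False using that prime_card_gt_1[where ?'p = 'p] by linarith
    qed
    then show ?thesis using p0 rp[of m]
      by (simp add: m fps_nth_compose_X_power artin_hasse_log_def)
  next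
    case False
    then show ?thesis using p0 r1 nd by (cases "n = 1") (auto simp: fps_nth_compose_X_power artin_hasse_log_def)
  qed
  finally show "(of_nat ?p * ?L) $ n = (fps_const (of_nat ?p) * fps_X + (?L oo fps_X ^ ?p)) $ n" .
qed

context
  assumes odd_p: "odd CARD('p::prime_card)"
begin

text \<open>The functional equation of the logarithm becomes E(x)^p = E(x^p) exp(p x). The
  nonconstant coefficients p^n/n! of exp(p x) are divisible by p, so Dwork's criterion
  applies.\<close>

lemma gauss_le_artin_hasse: "gauss_le 1 1 (fps_expc (artin_hasse_log :: 'p padic fps))"
proof -
  let ?p = "CARD('p)" and ?L = "artin_hasse_log :: 'p padic fps"
  note p3 = odd_prime_card_ge_3[OF odd_p]
  note r = exp_radius_pos[OF p3] exp_radius_gt[OF p3]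
  have "padic_norm (fps_expc ?L $ n) \<le> 1" for n
  proof (rule dwork_integrality)
    show "fps_expc ?L ^ ?p = (fps_expc ?L oo fps_X ^ ?p) * fps_exp (of_nat ?p)"
    proof -
      have "fps_expc ?L ^ ?p = fps_expc (fps_const (of_nat ?p) * fps_X + (?L oo fps_X ^ ?p))"
        unfolding artin_hasse_log_compose[symmetric] by (rule fps_expc_power) simp
      also have "\<dots> = fps_exp (of_nat ?p) * fps_expc (?L oo fps_X ^ ?p)"
        by (subst fps_expc_add) (simp_all add: fps_expc_X)
      finally show ?thesis by (simp add: fps_expc_compose mult.commute)
    qed
    fix n :: nat assume n: "n > 0"
    have "padic_norm (of_nat ?p ^ n / fact n :: 'p padic) = inverse (real ?p) ^ n * padic_norm (1 / fact n :: 'p padic)"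
      by (simp add: padic_norm_divide padic_norm_power)
    also have "\<dots> < exp_radius ?p ^ n * padic_norm (1 / fact n :: 'p padic)"
    proof (rule mult_strict_right_mono)
      show "inverse (real ?p) ^ n < exp_radius ?p ^ n" using r n by (intro power_strict_mono) auto
      have "(1 / fact n :: 'p padic) \<noteq> 0" by simp
      then show "padic_norm (1 / fact n :: 'p padic) > 0"
        using padic_norm_nonneg padic_norm_eq_0_iff by (metis order_le_less)
    qed
    also have "\<dots> \<le> 1" using padic_norm_inverse_fact_le[OF odd_p, of n] by (simp only: mult.commute)
    finally show "padic_norm (fps_exp (of_nat ?p) $ n :: 'p padic) \<le> inverse (real ?p)"
      by (intro padic_norm_less_1) simp
  qed auto
  then show ?thesis by (simp add: gauss_le_def)
qed

end

section \<open>The Dwork exponential\<close>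

definition dwork_arg :: "'p::prime_card padic fps" where
  "dwork_arg = fps_X + fps_const (1 / of_nat CARD('p)) * fps_X ^ CARD('p)"

definition dwork_exp :: "'p::prime_card padic fps" where
  "dwork_exp = fps_expc dwork_arg"

lemma dwork_arg_0 [simp]: "(dwork_arg :: 'p::prime_card padic fps) $ 0 = 0"
  by (simp add: dwork_arg_def)

text \<open>The differential equation f' = (1 + x^(p-1)) f at a single coefficient. This recurrence
  drives the telescoping of the trace.\<close>

lemma dwork_exp_Suc:
  assumes "n \<ge> CARD('p)"
  shows "of_nat n * (dwork_exp :: 'p::prime_card padic fps) $ n = dwork_exp $ (n - 1) + dwork_exp $ (n - CARD('p))"
proof -
  let ?p = "CARD('p)" and ?f = "dwork_exp :: 'p padic fps"
  obtain m where m: "n = Suc m" using assms by (cases n) auto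
  have "fps_deriv (dwork_arg :: 'p padic fps) = 1 + fps_X ^ (?p - 1)"
    by (simp add: dwork_arg_def fps_deriv_power flip: fps_of_nat mult.assoc)
  then have "fps_deriv ?f = (1 + fps_X ^ (?p - 1)) * ?f"
    unfolding dwork_exp_def by (subst fps_deriv_expc) simp_all
  then have "fps_deriv ?f $ m = ((1 + fps_X ^ (?p - 1)) * ?f) $ m" by simp
  also have "\<dots> = ?f $ m + ?f $ (m - (?p - 1))"
    using assms m by (simp add: distrib_right fps_X_power_mult_nth)
  also have "m - (?p - 1) = n - ?p" using m by simp
  finally show ?thesis by (simp add: m)
qed

lemma fps_exp_1_eq_dwork_exp:
  "fps_exp 1 = (dwork_exp :: 'p::prime_card padic fps) * (fps_exp (- 1 / of_nat CARD('p)) oo fps_X ^ CARD('p))"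
proof -
  let ?p = "CARD('p)"
  let ?B = "fps_const (- 1 / of_nat ?p) * fps_X ^ ?p :: 'p padic fps"
  have "fps_X = (dwork_arg :: 'p padic fps) + ?B"
    by (simp add: dwork_arg_def add.assoc flip: distrib_right)
  then have "fps_expc fps_X = (dwork_exp :: 'p padic fps) * fps_expc ?B"
    unfolding dwork_exp_def by (simp flip: fps_expc_add)
  moreover have "fps_expc ?B = fps_exp (- 1 / of_nat ?p) oo fps_X ^ ?p"
    unfolding fps_expc_X[symmetric]
    by (subst fps_expc_compose) (simp_all add: fps_compose_mult_distrib fps_X_fps_compose_startby0)
  ultimately show ?thesis using fps_expc_X[of "1 :: 'p padic"] by simp
qed

lemma fact_mult_pochhammer_minus:
  "l \<le> n \<Longrightarrow> fact (n - l) * pochhammer (- of_nat n :: 'a::field_char_0) l = (-1) ^ l * fact n"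
proof (induction l)
  case (Suc l)
  have "fact (n - l) = of_nat (n - l) * (fact (n - Suc l) :: 'a)"
    using Suc.prems by (subst fact_reduce) auto
  also have "of_nat (n - l) = (of_nat n - of_nat l :: 'a)" using Suc.prems by (simp add: of_nat_diff)
  finally have f: "fact (n - l) = (of_nat n - of_nat l) * (fact (n - Suc l) :: 'a)" .
  have "fact (n - Suc l) * pochhammer (- of_nat n :: 'a) (Suc l) =
      - (fact (n - l) * pochhammer (- of_nat n) l)"
    unfolding f pochhammer_Suc by (simp add: algebra_simps)
  then show ?case using Suc by simp
qed simp

context
  assumes odd_p: "odd CARD('p::prime_card)"
begin

text \<open>Divided by the Artin-Hasse series, which is integral, this is the exponential of the
  negated terms x^(p^i)/p^i with i >= 2. The radius keeps those within \<open>exp_radius\<close>, so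
  both factors have Gauss norm at most 1.\<close>

lemma gauss_le_dwork_exp: "gauss_le (dwork_radius CARD('p)) 1 (dwork_exp :: 'p padic fps)"
proof -
  let ?p = "CARD('p)" and ?\<rho> = "dwork_radius CARD('p)"
  note p3 = odd_prime_card_ge_3[OF odd_p]
  note \<rho> = dwork_radius_pos[OF p3] dwork_radius_less_1[OF p3]
  define M where "M = dwork_arg - (artin_hasse_log :: 'p padic fps)"
  have "padic_norm (M $ n) * ?\<rho> ^ n \<le> exp_radius ?p" for n
  proof (cases "\<exists>i\<ge>2. n = ?p ^ i")
    case True
    then obtain i where i: "i \<ge> 2" "n = ?p ^ i" by blast
    have "?p ^ 1 < ?p ^ i" using i p3 by (intro power_strict_increasing) auto
    then have n: "n \<noteq> 1" "n \<noteq> ?p" using i p3 by auto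
    have "n \<in> range (\<lambda>i. ?p ^ i)" using i by blast
    then have "M $ n = - (1 / of_nat n)"
      using n unfolding M_def dwork_arg_def artin_hasse_log_def by simp
    then have "padic_norm (M $ n) = real ?p ^ i"
      using i by (simp add: padic_norm_inverse padic_norm_power divide_inverse power_inverse)
    then show ?thesis using dwork_radius_power_power[OF p3 i(1)] i(2) by simp
  next
    case False
    have "M $ n = 0"
    proof (cases "n \<in> range (\<lambda>i. ?p ^ i)")
      case True
      then obtain i where i: "n = ?p ^ i" by auto
      with False have "i = 0 \<or> i = 1" by (metis One_nat_def Suc_1 Suc_leI le_neq_implies_less not_less_eq_eq zero_less_iff_neq_zero)
      then have n: "n = 1 \<or> n = ?p" using i by auto
      then show ?thesis using True p3 by (auto simp: M_def dwork_arg_def artin_hasse_log_def)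
    next
      case nr: False
      have "1 \<in> range (\<lambda>i. ?p ^ i)" "?p \<in> range (\<lambda>i. ?p ^ i)" by (metis power_0 rangeI) (metis power_one_right rangeI)
      then have "n \<noteq> 1" "n \<noteq> ?p" using nr by auto
      then show ?thesis using nr by (auto simp: M_def dwork_arg_def artin_hasse_log_def)
    qed
    then show ?thesis using exp_radius_pos[OF p3] by simp
  qed
  then have "gauss_le ?\<rho> 1 (fps_expc M)" by (intro gauss_le_expc[OF odd_p _ \<rho>(1)]) (simp add: gauss_le_def)
  moreover have "gauss_le ?\<rho> 1 (fps_expc (artin_hasse_log :: 'p padic fps))"
    unfolding gauss_le_def
  proof
    fix n
    have "padic_norm (fps_expc (artin_hasse_log :: 'p padic fps) $ n) \<le> 1"
      using gauss_le_artin_hasse[OF odd_p] by (simp add: gauss_le_def)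
    moreover have "?\<rho> ^ n \<le> 1" using \<rho> by (intro power_le_one) auto
    ultimately show "padic_norm (fps_expc (artin_hasse_log :: 'p padic fps) $ n) * ?\<rho> ^ n \<le> 1"
      using \<rho> by (intro mult_le_one) auto
  qed
  ultimately have "gauss_le ?\<rho> (1 * 1) (fps_expc artin_hasse_log * fps_expc M)"
    by (intro gauss_le_mult \<rho>)
  moreover have "fps_expc artin_hasse_log * fps_expc M = dwork_exp"
    unfolding dwork_exp_def by (subst fps_expc_add[symmetric]) (simp_all add: M_def)
  ultimately show ?thesis by simp
qed

lemma padic_norm_dwork_exp_le: "padic_norm ((dwork_exp :: 'p padic fps) $ n) \<le> inverse (dwork_radius CARD('p)) ^ n"
  using gauss_leD[OF gauss_le_dwork_exp dwork_radius_pos[OF odd_prime_card_ge_3[OF odd_p]]]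
  by (simp add: divide_inverse power_inverse)

section \<open>Dwork's expansion of the gamma function\<close>

text \<open>Compare coefficients of x^(a + p n) in exp(x) = f(x) exp(-x^p/p) and multiply by (-p)^n
  n!: the inverse factorial on the left becomes Gamma(-(a + p n)).\<close>

lemma padic_Gamma_minus_dwork:
  assumes a: "a < CARD('p)"
  shows "padic_Gamma (- of_nat (a + CARD('p) * n)) =
    (\<Sum>l\<le>n. of_nat CARD('p) ^ l * dwork_exp $ (a + CARD('p) * l) * pochhammer (- of_nat n :: 'p padic) l)"
proof -
  let ?p = "CARD('p)" and ?f = "dwork_exp :: 'p padic fps" and ?m = "a + CARD('p) * n"
  let ?P = "of_nat CARD('p) :: 'p padic"
  have div: "?m div ?p = n" using a by simp
  have "1 / fact ?m = (?f * (fps_exp (- 1 / ?P) oo fps_X ^ ?p)) $ ?m"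
    unfolding fps_exp_1_eq_dwork_exp[symmetric] by simp
  also have "\<dots> = ((fps_exp (- 1 / ?P) oo fps_X ^ ?p) * ?f) $ ?m" by (simp only: mult.commute)
  also have "\<dots> = (\<Sum>j\<in>{0..?m}. (fps_exp (- 1 / ?P) oo fps_X ^ ?p) $ j * ?f $ (?m - j))"
    by (rule fps_mult_nth)
  also have "\<dots> = (\<Sum>j\<in>{0..?m}. if ?p dvd j then ?f $ (?m - j) * ((- 1 / ?P) ^ (j div ?p) / fact (j div ?p)) else 0)"
    by (intro sum.cong) (auto simp: fps_nth_compose_X_power)
  also have "\<dots> = (\<Sum>j\<in>(\<lambda>l. ?p * (n - l)) ` {..n}. ?f $ (?m - j) * ((- 1 / ?P) ^ (j div ?p) / fact (j div ?p)))"
  proof (intro sum.mono_neutral_cong_right)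
    show "\<forall>j\<in>{0..?m} - (\<lambda>l. ?p * (n - l)) ` {..n}.
      (if ?p dvd j then ?f $ (?m - j) * ((- 1 / ?P) ^ (j div ?p) / fact (j div ?p)) else 0) = 0"
    proof
      fix j assume j: "j \<in> {0..?m} - (\<lambda>l. ?p * (n - l)) ` {..n}"
      have "\<not> ?p dvd j"
      proof
        assume "?p dvd j"
        then obtain k where k: "j = ?p * k" by (elim dvdE)
        have "j div ?p \<le> ?m div ?p" using j by (intro div_le_mono) simp
        then have "k \<le> n" using k div by simp
        then have "j = ?p * (n - (n - k))" "n - k \<le> n" using k by auto
        then show False using j by blast
      qed
      then show "(if ?p dvd j then ?f $ (?m - j) * ((- 1 / ?P) ^ (j div ?p) / fact (j div ?p)) else 0) = 0" by simp
    qed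
  qed (auto intro!: trans_le_add2 mult_le_mono2)
  also have "\<dots> = (\<Sum>l\<le>n. ?f $ (a + ?p * l) * ((- 1 / ?P) ^ (n - l) / fact (n - l)))"
  proof (subst sum.reindex)
    show "inj_on (\<lambda>l. ?p * (n - l)) {..n}" by (auto simp: inj_on_def)
    show "sum ((\<lambda>j. ?f $ (?m - j) * ((- 1 / ?P) ^ (j div ?p) / fact (j div ?p))) \<circ> (\<lambda>l. ?p * (n - l))) {..n} =
      (\<Sum>l\<le>n. ?f $ (a + ?p * l) * ((- 1 / ?P) ^ (n - l) / fact (n - l)))"
    proof (intro sum.cong refl)
      fix l assume "l \<in> {..n}"
      then have "?m - ?p * (n - l) = a + ?p * l" by (simp add: diff_mult_distrib2 algebra_simps)
      then show "((\<lambda>j. ?f $ (?m - j) * ((- 1 / ?P) ^ (j div ?p) / fact (j div ?p))) \<circ> (\<lambda>l. ?p * (n - l))) l =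
        ?f $ (a + ?p * l) * ((- 1 / ?P) ^ (n - l) / fact (n - l))" by simp
    qed
  qed
  finally have e: "1 / fact ?m = \<dots>" .
  have "padic_Gamma (- of_nat ?m) = (- ?P) ^ n * fact n * (1 / fact ?m)"
    using fact_mult_padic_Gamma_minus[OF odd_p, of ?m] unfolding div by (simp add: field_simps)
  also have "\<dots> = (\<Sum>l\<le>n. (- ?P) ^ n * fact n * (?f $ (a + ?p * l) * ((- 1 / ?P) ^ (n - l) / fact (n - l))))"
    unfolding e by (simp add: sum_distrib_left)
  also have "\<dots> = (\<Sum>l\<le>n. ?P ^ l * ?f $ (a + ?p * l) * pochhammer (- of_nat n) l)"
  proof (intro sum.cong refl)
    fix l assume l: "l \<in> {..n}"
    have "(- ?P) ^ n * (- 1 / ?P) ^ (n - l) = (- ?P) ^ l * ((- ?P) * (- 1 / ?P)) ^ (n - l)"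
      using l by (simp only: power_mult_distrib mult.assoc[symmetric] power_add[symmetric]) simp
    then have 1: "(- ?P) ^ n * (- 1 / ?P) ^ (n - l) = (- ?P) ^ l" by simp
    have "fact n = (-1) ^ l * (fact (n - l) * pochhammer (- of_nat n :: 'p padic) l)"
      using fact_mult_pochhammer_minus[of l n, where ?'a = "'p padic"] l by (simp flip: power_mult_distrib mult.assoc)
    then have 2: "fact n / fact (n - l) = (-1) ^ l * pochhammer (- of_nat n :: 'p padic) l" by simp
    have "(- ?P) ^ n * fact n * (?f $ (a + ?p * l) * ((- 1 / ?P) ^ (n - l) / fact (n - l))) =
        ((- ?P) ^ n * (- 1 / ?P) ^ (n - l)) * ?f $ (a + ?p * l) * (fact n / fact (n - l))" by simp
    also have "\<dots> = (- ?P) ^ l * ?f $ (a + ?p * l) * ((-1) ^ l * pochhammer (- of_nat n :: 'p padic) l)"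
      unfolding 1 2 ..
    also have "\<dots> = ((-1) * (- ?P)) ^ l * ?f $ (a + ?p * l) * pochhammer (- of_nat n :: 'p padic) l"
      unfolding power_mult_distrib by (simp only: mult_ac)
    finally show "(- ?P) ^ n * fact n * (?f $ (a + ?p * l) * ((- 1 / ?P) ^ (n - l) / fact (n - l))) =
      ?P ^ l * ?f $ (a + ?p * l) * pochhammer (- of_nat n) l" by simp
  qed
  finally show ?thesis .
qed

lemma padic_norm_pochhammer_le: "padic_norm (z :: 'p padic) \<le> 1 \<Longrightarrow> padic_norm (pochhammer z l) \<le> 1"
  by (induction l) (auto simp: pochhammer_Suc intro!: padic_norm_mult_le padic_norm_add_le)

lemma padic_norm_dwork_term_le:
  assumes "padic_norm y \<le> 1"
  shows "padic_norm (of_nat CARD('p) ^ l * dwork_exp $ (a + CARD('p) * l) * y :: 'p padic) \<le>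
    inverse (dwork_radius CARD('p)) ^ a * inverse (real CARD('p) * dwork_radius CARD('p) ^ CARD('p)) ^ l"
proof -
  let ?p = "CARD('p)"
  have "padic_norm (of_nat ?p ^ l * dwork_exp $ (a + ?p * l) * y) \<le> padic_norm (of_nat ?p ^ l * dwork_exp $ (a + ?p * l) :: 'p padic)"
    unfolding padic_norm_mult[of _ y] using assms by (simp add: mult_left_le)
  also have "\<dots> \<le> inverse (real ?p) ^ l * inverse (dwork_radius ?p) ^ (a + ?p * l)"
    unfolding padic_norm_mult padic_norm_power padic_norm_card by (intro mult_left_mono padic_norm_dwork_exp_le) simp
  also have "\<dots> = inverse (dwork_radius ?p) ^ a * inverse (real ?p * dwork_radius ?p ^ ?p) ^ l"
    by (simp add: power_add power_mult power_mult_distrib power_inverse)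
  finally show ?thesis .
qed

lemma dwork_ratio: "inverse (real CARD('p) * dwork_radius CARD('p) ^ CARD('p)) > 0"
  "inverse (real CARD('p) * dwork_radius CARD('p) ^ CARD('p)) < 1"
  using dwork_radius_gt[OF odd_prime_card_ge_3[OF odd_p]]
  by (auto simp: inverse_less_1_iff simp del: inverse_mult_distrib)

lemma dwork_bound_tendsto_0:
  "(\<lambda>l. c * inverse (real CARD('p) * dwork_radius CARD('p) ^ CARD('p)) ^ l) \<longlonglongrightarrow> 0"
  by (intro tendsto_mult_right_zero LIMSEQ_realpow_zero less_imp_le[OF dwork_ratio(1)] dwork_ratio(2))

text \<open>With n N = a (p^N - 1)/(p - 1), both -n N and -(a + p n N) = -n (N+1) tend to z, so the
  argument of gamma and the Pochhammer parameter share one limit. The error bound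
  \<open>\<epsilon>\<close> is uniform in n, which permits passing to the limit in N for fixed
  K.\<close>

lemma dwork_Gamma_limit:
  fixes a defines "z \<equiv> of_nat a / of_nat (CARD('p) - 1) :: 'p padic"
  assumes a: "a < CARD('p)"
  shows "(\<lambda>K. \<Sum>l<K. of_nat CARD('p) ^ l * dwork_exp $ (a + CARD('p) * l) * pochhammer z l) \<longlonglongrightarrow> padic_Gamma z"
proof -
  let ?p = "CARD('p)" and ?Q = "CARD('p) - 1"
  define t where "t y l = of_nat ?p ^ l * dwork_exp $ (a + ?p * l) * pochhammer y l" for y :: "'p padic" and l
  define \<epsilon> where "\<epsilon> l = inverse (dwork_radius ?p) ^ a * inverse (real ?p * dwork_radius ?p ^ ?p) ^ l" for l
  have t: "padic_norm (t y l) \<le> \<epsilon> l" if "padic_norm y \<le> 1" for y l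
    unfolding t_def \<epsilon>_def by (intro padic_norm_dwork_term_le padic_norm_pochhammer_le that)
  have \<epsilon>_mono: "\<epsilon> m \<le> \<epsilon> l" if "l \<le> m" for l m
    unfolding \<epsilon>_def using that dwork_ratio dwork_radius_pos[OF odd_prime_card_ge_3[OF odd_p]]
    by (intro mult_left_mono power_decreasing) auto
  have \<epsilon>0: "\<epsilon> l \<ge> 0" for l using order_trans[OF padic_norm_nonneg t[of 0 l]] by simp
  have approx: "padic_norm (padic_Gamma (- of_nat (a + ?p * n)) - (\<Sum>l<K. t (- of_nat n) l)) \<le> \<epsilon> K" for n K
  proof -
    have z0: "t (- of_nat n) l = 0" if "l > n" for l
      using that by (simp add: t_def pochhammer_of_nat_eq_0_iff)
    have "padic_Gamma (- of_nat (a + ?p * n)) = (\<Sum>l\<le>n. t (- of_nat n) l)"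
      unfolding t_def by (rule padic_Gamma_minus_dwork[OF a])
    also have "\<dots> = (\<Sum>l<max K (Suc n). t (- of_nat n) l)"
      by (intro sum.mono_neutral_left) (auto intro!: z0)
    also have "\<dots> = (\<Sum>l<K. t (- of_nat n) l) + (\<Sum>l\<in>{K..<max K (Suc n)}. t (- of_nat n) l)"
      using sum.atLeastLessThan_concat[of 0 K "max K (Suc n)" "t (- of_nat n)"] by (simp add: atLeast0LessThan)
    finally have "padic_Gamma (- of_nat (a + ?p * n)) - (\<Sum>l<K. t (- of_nat n) l) = (\<Sum>l\<in>{K..<max K (Suc n)}. t (- of_nat n) l)"
      by simp
    moreover have "padic_norm (\<Sum>l\<in>{K..<max K (Suc n)}. t (- of_nat n) l) \<le> \<epsilon> K"
      by (rule padic_norm_sum_le[OF \<epsilon>0]) (auto intro: order_trans[OF t \<epsilon>_mono])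
    ultimately show ?thesis by simp
  qed
  define n where "n N = a * (\<Sum>i<N. ?p ^ i)" for N
  note Q0 = of_nat_card_minus_1_neq_0[where ?'p = 'p and ?'q = 'p]
  have nS: "a + ?p * n N = n (Suc N)" for N
    by (simp add: n_def sum.lessThan_Suc_shift sum_distrib_left algebra_simps del: sum.lessThan_Suc)
  have "- of_nat (n N) = z - z * of_nat ?p ^ N" for N
  proof -
    have "?Q * n N + a = a * ?p ^ N"
    proof -
      have "?Q * n N = a * (?Q * (\<Sum>i<N. ?p ^ i))" by (simp add: n_def algebra_simps)
      also have "\<dots> = a * (?p ^ N - 1)" by (simp only: sum_power_card[OF odd_p])
      also have "\<dots> + a = a * (?p ^ N - 1 + 1)" by (simp only: distrib_left mult_1_right)
      finally show ?thesis by simp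
    qed
    then have "of_nat ?Q * of_nat (n N) + of_nat a = (of_nat a * of_nat ?p ^ N :: 'p padic)"
      by (metis of_nat_add of_nat_mult of_nat_power)
    then show ?thesis unfolding z_def using Q0 by (simp add: field_simps del: of_nat_diff One_nat_def)
  qed
  then have "(\<lambda>N. - of_nat (n N)) \<longlonglongrightarrow> z - z * 0"
    by (simp only:) (intro tendsto_intros card_power_tendsto_0)
  then have nz: "(\<lambda>N. - of_nat (n N)) \<longlonglongrightarrow> z" by simp
  have "padic_norm (padic_Gamma z - (\<Sum>l<K. t z l)) \<le> \<epsilon> K" for K
  proof (rule padic_norm_limit_le)
    have poch: "(\<lambda>N. pochhammer (- of_nat (n N)) l) \<longlonglongrightarrow> pochhammer z l" for l
    proof (induction l)
      case (Suc l)
      then show ?case unfolding pochhammer_Suc by (intro tendsto_mult tendsto_add nz tendsto_const)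
    qed simp
    show "(\<lambda>N. padic_Gamma (- of_nat (n (Suc N))) - (\<Sum>l<K. t (- of_nat (n N)) l)) \<longlonglongrightarrow> padic_Gamma z - (\<Sum>l<K. t z l)"
      unfolding t_def using LIMSEQ_Suc[OF nz]
      by (intro tendsto_diff tendsto_sum tendsto_mult tendsto_const poch padic_Gamma_tendsto[OF odd_p]) auto
    show "padic_norm (padic_Gamma (- of_nat (n (Suc N))) - (\<Sum>l<K. t (- of_nat (n N)) l)) \<le> \<epsilon> K" for N
      unfolding nS[symmetric] by (rule approx)
  qed
  then have "padic_norm ((\<Sum>l<K. t z l) - padic_Gamma z) \<le> \<epsilon> K" for K
    by (simp add: padic_norm_minus_commute)
  moreover have "\<epsilon> \<longlonglongrightarrow> 0" unfolding \<epsilon>_def by (rule dwork_bound_tendsto_0)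
  ultimately show ?thesis unfolding t_def[symmetric] by (rule padic_tendstoI)
qed

section \<open>The Gross--Koblitz formula\<close>

text \<open>The sum on the left is, up to the factor \<open>\<pi>^a\<close> with \<open>\<pi>^(p-1) = -p\<close>, the trace of the Dwork
  operator on power series twisted by \<open>x^z\<close>, and that operator acts as \<open>padic_Gamma z\<close> on the
  one-dimensional cokernel of the twisted derivation. The columns \<open>V N l\<close> make the resulting
  telescoping explicit.\<close>

lemma dwork_trace:
  fixes a defines "z \<equiv> of_nat a / of_nat (CARD('p) - 1) :: 'p padic"
  assumes a: "a < CARD('p)"
  shows "(\<lambda>N. \<Sum>j<N. (- of_nat CARD('p)) ^ j * dwork_exp $ (a + (CARD('p) - 1) * j)) \<longlonglongrightarrow>
    padic_Gamma z / (1 - of_nat CARD('p))"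
proof -
  let ?p = "CARD('p)" and ?Q = "CARD('p) - 1" and ?f = "dwork_exp :: 'p padic fps"
  let ?P = "of_nat CARD('p) :: 'p padic"
  have Qp: "?p = ?Q + 1" using prime_card_gt_1[where ?'p = 'p] by simp
  note Q0 = of_nat_card_minus_1_neq_0[where ?'p = 'p and ?'q = 'p]
  have QP: "of_nat ?Q = ?P - 1" using prime_card_gt_1[where ?'p = 'p] by (simp add: of_nat_diff)
  have az: "of_nat a = (?P - 1) * z" unfolding z_def using Q0 by (simp only: QP) simp
  define B where "B j l = ?f $ (?p * j + a - l)" for j l
  define V where "V N l = (\<Sum>j\<in>{l..<N}. ?P ^ j * pochhammer (z + of_nat l) (j - l) * B j l)" for N l
  \<comment> \<open>Adjacent columns cancel up to a diagonal and a boundary term. The recurrence is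
    used at index p N + a - l, which equals p (N + z) - (l + z) because a = (p - 1) z: the first
    summand extends the boundary Pochhammer symbol, the second cancels the new term of column
    l.\<close>
  have V: "V (Suc l + k) l + V (Suc l + k) (Suc l) =
      (1 - ?P) * ?P ^ l * B l l + ?P ^ (Suc l + k) * pochhammer (z + of_nat (Suc l)) k * B (l + k) l" for l k
  proof (induction k)
    case 0
    then show ?case by (simp add: V_def algebra_simps)
  next
    case (Suc k)
    let ?N = "Suc l + k" and ?h = "pochhammer (z + of_nat (Suc l)) k"
    have "?p * ?N + a - l \<ge> ?p"
    proof -
      have "l \<le> ?p * l" by simp
      moreover have "?p * ?N + a = ?p + ?p * k + ?p * l + a" by (simp add: algebra_simps)
      ultimately show ?thesis by linarith
    qed
    from dwork_exp_Suc[OF this]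
    have "of_nat (?p * ?N + a - l) * B ?N l = ?f $ (?p * ?N + a - l - 1) + ?f $ (?p * ?N + a - l - ?p)"
      by (simp only: B_def)
    moreover have "?p * ?N + a - l - 1 = ?p * ?N + a - Suc l" by simp
    moreover have "?p * ?N + a - l - ?p = ?p * (l + k) + a - l" by (simp add: algebra_simps)
    ultimately have rec: "of_nat (?p * ?N + a - l) * B ?N l = B ?N (Suc l) + B (l + k) l" by (simp only: B_def)
    have "1 * l \<le> ?p * ?N" by (intro mult_le_mono) auto
    then have "l \<le> ?p * ?N + a" by linarith
    then have "of_nat (?p * ?N + a - l) = ?P * of_nat ?N + of_nat a - (of_nat l :: 'p padic)"
      by (simp add: of_nat_diff algebra_simps)
    also have "\<dots> = ?P * (of_nat ?N + z) - (of_nat l + z)" unfolding az by (simp add: algebra_simps)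
    finally have e: "of_nat (?p * ?N + a - l) = \<dots>" .
    have rec': "B ?N (Suc l) = (?P * (of_nat ?N + z) - (of_nat l + z)) * B ?N l - B (l + k) l"
      unfolding eq_diff_eq using rec[unfolded e] by (rule sym)
    have "z + of_nat l + 1 = z + of_nat (Suc l)" by simp
    then have h1: "pochhammer (z + of_nat l) (Suc k) = (z + of_nat l) * ?h"
      by (simp only: pochhammer_rec)
    have h2: "pochhammer (z + of_nat (Suc l)) (Suc k) = ?h * (of_nat ?N + z)"
      by (simp add: pochhammer_Suc algebra_simps)
    have "{l..<Suc l + Suc k} = insert ?N {l..<?N}" "{Suc l..<Suc l + Suc k} = insert ?N {Suc l..<?N}" by auto
    then have "V (Suc l + Suc k) l + V (Suc l + Suc k) (Suc l) =
        (V ?N l + V ?N (Suc l)) + ?P ^ ?N * (pochhammer (z + of_nat l) (Suc k) * B ?N l + ?h * B ?N (Suc l))"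
      by (simp add: V_def algebra_simps)
    also have "\<dots> = (1 - ?P) * ?P ^ l * B l l +
      ?P ^ ?N * ?h * (B (l + k) l + (z + of_nat l) * B ?N l + B ?N (Suc l))"
      unfolding Suc h1 by (simp add: algebra_simps)
    also have "B (l + k) l + (z + of_nat l) * B ?N l + B ?N (Suc l) = ?P * (of_nat ?N + z) * B ?N l"
      unfolding rec' by (simp add: algebra_simps)
    finally show ?case unfolding h2 by (simp add: algebra_simps)
  qed
  define bd where "bd N = (\<Sum>l<N. (-1) ^ l * (?P ^ N * pochhammer (z + of_nat (Suc l)) (N - Suc l) * B (N - 1) l))" for N
  \<comment> \<open>The alternating sum of the column relations leaves column 0, whose limit is
    Gamma(z), against (1 - p) times the trace.\<close>
  have main: "V N 0 = (1 - ?P) * (\<Sum>j<N. (- ?P) ^ j * ?f $ (a + ?Q * j)) + bd N" for N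
  proof -
    have st: "(-1) ^ l * V N l - (-1) ^ Suc l * V N (Suc l) =
        (1 - ?P) * ((- ?P) ^ l * ?f $ (a + ?Q * l)) + (-1) ^ l * (?P ^ N * pochhammer (z + of_nat (Suc l)) (N - Suc l) * B (N - 1) l)"
      if l: "l < N" for l
    proof -
      obtain k where k: "N = Suc l + k" using l less_iff_Suc_add by auto
      have "?p * l + a - l = a + ?Q * l" by (simp add: diff_mult_distrib)
      then have Bl: "B l l = ?f $ (a + ?Q * l)" by (simp only: B_def)
      have "(-1) ^ l * V N l - (-1) ^ Suc l * V N (Suc l) = (-1) ^ l * (V N l + V N (Suc l))" by (simp add: algebra_simps)
      also have "\<dots> = (1 - ?P) * (((-1) ^ l * ?P ^ l) * B l l) + (-1) ^ l * (?P ^ N * pochhammer (z + of_nat (Suc l)) k * B (l + k) l)"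
        unfolding k V by (simp only: algebra_simps)
      also have "(-1) ^ l * ?P ^ l = (- ?P) ^ l" by (simp flip: power_mult_distrib)
      finally show ?thesis using k Bl by simp
    qed
    have "V N 0 = (\<Sum>l<N. (-1) ^ l * V N l - (-1) ^ Suc l * V N (Suc l))"
      by (subst sum_lessThan_telescope') (simp add: V_def)
    also have "\<dots> = (\<Sum>l<N. (1 - ?P) * ((- ?P) ^ l * ?f $ (a + ?Q * l)) +
        (-1) ^ l * (?P ^ N * pochhammer (z + of_nat (Suc l)) (N - Suc l) * B (N - 1) l))"
      by (intro sum.cong refl st) simp
    finally show ?thesis by (simp add: sum.distrib sum_distrib_left bd_def)
  qed
  have z: "padic_norm z \<le> 1" unfolding z_def by (rule padic_norm_of_nat_divide_card_minus_1[OF odd_p])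
  \<comment> \<open>Pochhammer symbols of p-adic integers are integral, and p^N outweighs the growth
    of the coefficients with index near p N because p rho^p > 1.\<close>
  have "bd \<longlonglongrightarrow> 0"
  proof (rule LIMSEQ_imp_Suc, rule padic_tendstoI[OF _ dwork_bound_tendsto_0])
    fix N
    let ?\<rho> = "dwork_radius ?p"
    note p3 = odd_prime_card_ge_3[OF odd_p]
    show "padic_norm (bd (Suc N) - 0) \<le> inverse ?\<rho> ^ a * inverse (real ?p * ?\<rho> ^ ?p) ^ N"
      unfolding bd_def diff_zero
    proof (rule padic_norm_sum_le)
      fix l assume "l \<in> {..<Suc N}"
      have "padic_norm (B N l) \<le> inverse ?\<rho> ^ (?p * N + a - l)" unfolding B_def by (rule padic_norm_dwork_exp_le)
      also have "\<dots> \<le> inverse ?\<rho> ^ (?p * N + a)"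
        using dwork_radius_pos[OF p3] dwork_radius_less_1[OF p3] by (intro power_increasing) (auto simp: one_le_inverse_iff)
      finally have 1: "padic_norm (B N l) \<le> inverse ?\<rho> ^ (?p * N + a)" .
      have "padic_norm ((-1) ^ l * (?P ^ Suc N * pochhammer (z + of_nat (Suc l)) (Suc N - Suc l) * B (Suc N - 1) l)) =
          inverse (real ?p) ^ Suc N * padic_norm (pochhammer (z + of_nat (Suc l)) (N - l)) * padic_norm (B N l)"
        by (simp add: padic_norm_mult padic_norm_power)
      also have "\<dots> \<le> inverse (real ?p) ^ N * 1 * inverse ?\<rho> ^ (?p * N + a)"
        using z by (intro mult_mono 1 inverse_card_power_mono padic_norm_pochhammer_le padic_norm_add_le padic_norm_of_nat_le_1) auto
      also have "\<dots> = inverse ?\<rho> ^ a * inverse (real ?p * ?\<rho> ^ ?p) ^ N"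
        by (simp add: power_add power_mult power_mult_distrib power_inverse)
      finally show "padic_norm ((-1) ^ l * (?P ^ Suc N * pochhammer (z + of_nat (Suc l)) (Suc N - Suc l) * B (Suc N - 1) l)) \<le> \<dots>" .
    qed (use dwork_ratio dwork_radius_pos[OF p3] in \<open>auto simp del: inverse_mult_distrib\<close>)
  qed
  moreover have "(\<lambda>N. V N 0) \<longlonglongrightarrow> padic_Gamma z"
    using dwork_Gamma_limit[OF a] unfolding z_def[symmetric] V_def B_def
    by (simp add: atLeast0LessThan add.commute mult.assoc mult.commute mult.left_commute)
  ultimately have "(\<lambda>N. V N 0 - bd N) \<longlonglongrightarrow> padic_Gamma z - 0" by (rule tendsto_diff[rotated])
  then have "(\<lambda>N. inverse (1 - ?P) * ((1 - ?P) * (\<Sum>j<N. (- ?P) ^ j * ?f $ (a + ?Q * j)))) \<longlonglongrightarrow> inverse (1 - ?P) * padic_Gamma z"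
    unfolding main by (intro tendsto_mult tendsto_const) simp
  moreover have "1 - ?P \<noteq> 0" using Q0 unfolding QP by simp
  ultimately show ?thesis by (simp add: divide_inverse mult.commute flip: mult.assoc)
qed

end

section \<open>Evaluation at a root of \<open>x^(p-1) = -p\<close>\<close>

text \<open>If \<open>\<pi>^(p-1) = -p\<close>, then \<open>F(\<pi>)\<close> is the sum over \<open>c < p - 1\<close> of \<open>ev c F * \<pi>^c\<close>. Working
  with these components keeps everything inside the field of p-adic numbers.\<close>

definition ev :: "nat \<Rightarrow> 'p::prime_card padic fps \<Rightarrow> 'p padic" where
  "ev c F = (\<Sum>k. (- of_nat CARD('p)) ^ k * F $ (c + (CARD('p) - 1) * k))"

text \<open>For t^p = t this is Dwork's series in t x. Scaling the exponent instead of the variable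
  makes sums of parameters into products for all t.\<close>

definition dwork_at :: "'p::prime_card padic \<Rightarrow> 'p padic fps" where
  "dwork_at t = fps_expc (fps_const t * dwork_arg)"

text \<open>The coordinate at pi^c of the additive character sending x to f(pi omega(x)), where f is
  Dwork's series.\<close>

definition dwork_char :: "nat \<Rightarrow> 'p::prime_card mod_ring \<Rightarrow> 'p padic" where
  "dwork_char c x = ev c (dwork_at (teichmueller x))"

definition Gamma_frac :: "nat \<Rightarrow> 'p::prime_card padic" where
  "Gamma_frac k = padic_Gamma (of_nat k / of_nat (CARD('p) - 1))"

definition jacobi :: "nat \<Rightarrow> nat \<Rightarrow> 'p::prime_card padic" where
  "jacobi a b = (\<Sum>x\<in>-{0,1}. teichmueller_bar x ^ a * teichmueller_bar (1 - x :: 'p mod_ring) ^ b)"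

text \<open>Ratio of the geometric series dominating \<open>ev\<close>. It is below 1 because
  \<open>dwork_radius p\<close> exceeds |pi|, where |pi|^(p-1) = 1/p.\<close>

definition ev_ratio :: "nat \<Rightarrow> real" where
  "ev_ratio p = inverse (real p * dwork_radius p ^ (p - 1))"

context
  assumes odd_p: "odd CARD('p::prime_card)"
begin

lemma ev_ratio_pos: "ev_ratio CARD('p) > 0" and ev_ratio_less_1: "ev_ratio CARD('p) < 1"
proof -
  note p3 = odd_prime_card_ge_3[OF odd_p]
  have "dwork_radius CARD('p) ^ CARD('p) \<le> dwork_radius CARD('p) ^ (CARD('p) - 1)"
    using dwork_radius_pos[OF p3] dwork_radius_less_1[OF p3] by (intro power_decreasing) auto
  then have "real CARD('p) * dwork_radius CARD('p) ^ CARD('p) \<le> real CARD('p) * dwork_radius CARD('p) ^ (CARD('p) - 1)"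
    by (intro mult_left_mono) auto
  then have "real CARD('p) * dwork_radius CARD('p) ^ (CARD('p) - 1) > 1" using dwork_radius_gt[OF p3] by linarith
  then show "ev_ratio CARD('p) < 1" unfolding ev_ratio_def by (rule inverse_less_1_iff[THEN iffD2, OF disjI2])
  show "ev_ratio CARD('p) > 0" using dwork_radius_pos[OF p3] by (simp add: ev_ratio_def)
qed

lemma eval_term_le:
  assumes F: "gauss_le (dwork_radius CARD('p)) C F"
  shows "padic_norm ((- of_nat CARD('p)) ^ k * F $ (c + (CARD('p) - 1) * k) :: 'p padic) \<le>
    C / dwork_radius CARD('p) ^ c * ev_ratio CARD('p) ^ k"
proof -
  let ?\<rho> = "dwork_radius CARD('p)" and ?Q = "CARD('p) - 1"
  have "padic_norm ((- of_nat CARD('p)) ^ k * F $ (c + ?Q * k) :: 'p padic) =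
      inverse (real CARD('p)) ^ k * padic_norm (F $ (c + ?Q * k))"
    by (simp add: padic_norm_mult padic_norm_power)
  also have "\<dots> \<le> inverse (real CARD('p)) ^ k * (C / ?\<rho> ^ (c + ?Q * k))"
    by (intro mult_left_mono gauss_leD[OF F dwork_radius_pos[OF odd_prime_card_ge_3[OF odd_p]]]) simp
  also have "\<dots> = C / ?\<rho> ^ c * ev_ratio CARD('p) ^ k"
    by (simp add: power_add power_mult power_mult_distrib power_inverse divide_inverse ev_ratio_def)
  finally show ?thesis .
qed

lemma eval_bound_tendsto_0: "(\<lambda>k. c * ev_ratio CARD('p) ^ k) \<longlonglongrightarrow> 0"
  by (intro tendsto_mult_right_zero LIMSEQ_realpow_zero less_imp_le[OF ev_ratio_pos] ev_ratio_less_1)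

lemma eval_bound_mono:
  "C \<ge> 0 \<Longrightarrow> k \<le> l \<Longrightarrow> C * ev_ratio CARD('p) ^ l \<le> C * ev_ratio CARD('p) ^ k"
  by (intro mult_left_mono power_decreasing less_imp_le[OF ev_ratio_pos] less_imp_le[OF ev_ratio_less_1])

lemma ev_summable:
  assumes F: "gauss_le (dwork_radius CARD('p)) C (F :: 'p padic fps)"
  shows "summable (\<lambda>k. (- of_nat CARD('p)) ^ k * F $ (c + (CARD('p) - 1) * k))"
proof (rule padic_summable[OF eval_term_le[OF F] _ eval_bound_tendsto_0])
  have "C / dwork_radius CARD('p) ^ c \<ge> 0"
    using gauss_le_nonneg[OF F] dwork_radius_pos[OF odd_prime_card_ge_3[OF odd_p]] by simp
  then show "decseq (\<lambda>k. C / dwork_radius CARD('p) ^ c * ev_ratio CARD('p) ^ k)"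
    unfolding decseq_def using eval_bound_mono by blast
qed

lemma ev_limit:
  assumes F: "gauss_le (dwork_radius CARD('p)) C (F :: 'p padic fps)"
  shows "(\<lambda>K. \<Sum>k<K. (- of_nat CARD('p)) ^ k * F $ (c + (CARD('p) - 1) * k)) \<longlonglongrightarrow> ev c F"
  unfolding ev_def by (rule summable_LIMSEQ[OF ev_summable[OF F]])

lemma ev_norm_le:
  assumes F: "gauss_le (dwork_radius CARD('p)) C (F :: 'p padic fps)"
  shows "padic_norm (ev c F) \<le> C / dwork_radius CARD('p) ^ c"
  unfolding ev_def
proof (rule padic_norm_suminf_le[OF ev_summable[OF F]])
  have "C / dwork_radius CARD('p) ^ c \<ge> 0"
    using gauss_le_nonneg[OF F] dwork_radius_pos[OF odd_prime_card_ge_3[OF odd_p]] by simp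
  then show "padic_norm ((- of_nat CARD('p)) ^ k * F $ (c + (CARD('p) - 1) * k)) \<le> C / dwork_radius CARD('p) ^ c" for k
    using order_trans[OF eval_term_le[OF F] eval_bound_mono[of _ 0]] by simp
qed

lemma ev_rec:
  assumes F: "gauss_le (dwork_radius CARD('p)) C (F :: 'p padic fps)"
  shows "ev c F = F $ c - of_nat CARD('p) * ev (c + (CARD('p) - 1)) F"
proof -
  let ?P = "of_nat CARD('p) :: 'p padic" and ?Q = "CARD('p) - 1"
  have "(\<lambda>K. F $ c + (- ?P) * (\<Sum>k<K. (- ?P) ^ k * F $ ((c + ?Q) + ?Q * k))) \<longlonglongrightarrow> F $ c + (- ?P) * ev (c + ?Q) F"
    by (intro tendsto_add tendsto_mult tendsto_const ev_limit[OF F])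
  moreover have "F $ c + (- ?P) * (\<Sum>k<K. (- ?P) ^ k * F $ ((c + ?Q) + ?Q * k)) =
      (\<Sum>k<Suc K. (- ?P) ^ k * F $ (c + ?Q * k))" for K
  proof -
    have "(c + ?Q) + ?Q * k = c + ?Q * Suc k" for k by (simp only: mult_Suc_right add.assoc)
    then show ?thesis
      by (subst sum.lessThan_Suc_shift) (simp only: sum_distrib_left power_Suc mult.assoc power_0 mult_1_left mult_0_right add_0_right)
  qed
  ultimately have "(\<lambda>K. \<Sum>k<Suc K. (- ?P) ^ k * F $ (c + ?Q * k)) \<longlonglongrightarrow> F $ c + (- ?P) * ev (c + ?Q) F" by simp
  from LIMSEQ_unique[OF this LIMSEQ_Suc[OF ev_limit[OF F]]] show ?thesis by simp
qed

lemma ev_add: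
  assumes F: "gauss_le (dwork_radius CARD('p)) C (F :: 'p padic fps)" and G: "gauss_le (dwork_radius CARD('p)) D G"
  shows "ev c (F + G) = ev c F + ev c G"
  unfolding ev_def by (subst suminf_add[OF ev_summable[OF F] ev_summable[OF G]]) (simp add: distrib_left)

lemma ev_const_mult:
  assumes F: "gauss_le (dwork_radius CARD('p)) C (F :: 'p padic fps)"
  shows "ev c (fps_const a * F) = a * ev c F"
proof -
  have "(\<lambda>K. a * (\<Sum>k<K. (- of_nat CARD('p)) ^ k * F $ (c + (CARD('p) - 1) * k))) \<longlonglongrightarrow> a * ev c F"
    by (intro tendsto_mult tendsto_const ev_limit[OF F])
  then have "(\<lambda>k. (- of_nat CARD('p)) ^ k * (fps_const a * F) $ (c + (CARD('p) - 1) * k)) sums (a * ev c F)"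
    unfolding sums_def by (simp add: sum_distrib_left algebra_simps)
  then show ?thesis unfolding ev_def by (rule sums_unique[symmetric])
qed

lemma gauss_le_const: "gauss_le \<rho> (padic_norm a) (fps_const a)"
  by (auto simp: gauss_le_def)

lemma gauss_le_X_power: "gauss_le \<rho> (\<rho> ^ n) (fps_X ^ n :: 'p padic fps)" if "\<rho> > 0"
  using that by (auto simp: gauss_le_def)

lemma gauss_le_X_power_mult:
  assumes "gauss_le (dwork_radius CARD('p)) C (F :: 'p padic fps)"
  shows "\<exists>D. gauss_le (dwork_radius CARD('p)) D (fps_const b * (fps_X ^ a * F))"
proof -
  note \<rho> = dwork_radius_pos[OF odd_prime_card_ge_3[OF odd_p]]
  show ?thesis using gauss_le_mult[OF gauss_le_const gauss_le_mult[OF gauss_le_X_power[OF \<rho>] assms \<rho>] \<rho>] by blast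
qed

lemma ev_sum:
  assumes "finite A" "\<And>i. i \<in> A \<Longrightarrow> \<exists>C. gauss_le (dwork_radius CARD('p)) C (F i :: 'p padic fps)"
  shows "ev c (\<Sum>i\<in>A. F i) = (\<Sum>i\<in>A. ev c (F i)) \<and> (\<exists>C. gauss_le (dwork_radius CARD('p)) C (\<Sum>i\<in>A. F i))"
  using assms
proof (induction A rule: finite_induct)
  case empty
  have "gauss_le (dwork_radius CARD('p)) 0 (0 :: 'p padic fps)" by (simp add: gauss_le_def)
  then show ?case by (auto simp: ev_def)
next
  case (insert i A)
  obtain C where C: "gauss_le (dwork_radius CARD('p)) C (F i)" using insert.prems by blast
  obtain D where D: "gauss_le (dwork_radius CARD('p)) D (\<Sum>i\<in>A. F i)"
    and e: "ev c (\<Sum>i\<in>A. F i) = (\<Sum>i\<in>A. ev c (F i))" using insert.IH insert.prems by blast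
  note \<rho> = dwork_radius_pos[OF odd_prime_card_ge_3[OF odd_p]]
  have "gauss_le (dwork_radius CARD('p)) (max C D) (F i + (\<Sum>i\<in>A. F i))"
    by (intro gauss_le_add \<rho> gauss_le_mono[OF C] gauss_le_mono[OF D]) auto
  then show ?case using insert(1,2) ev_add[OF C D] e by auto
qed

lemma ev_shift:
  assumes "a \<le> c" shows "ev c (fps_X ^ a * (F :: 'p padic fps)) = ev (c - a) F"
proof -
  have "(fps_X ^ a * F) $ (c + (CARD('p) - 1) * k) = F $ (c - a + (CARD('p) - 1) * k)" for k
  proof -
    have "\<not> c + (CARD('p) - 1) * k < a" "c + (CARD('p) - 1) * k - a = c - a + (CARD('p) - 1) * k"
      using assms by linarith+
    then show ?thesis by (simp only: fps_X_power_mult_nth if_False)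
  qed
  then show ?thesis by (simp only: ev_def)
qed

text \<open>Multiplication by pi^a shifts the coordinates cyclically, and each wrap-around produces
  pi^(p-1) = -p.\<close>

lemma ev_X_power_mult:
  assumes F: "gauss_le (dwork_radius CARD('p)) C (F :: 'p padic fps)"
    and a: "a < CARD('p) - 1" and c: "c < CARD('p) - 1"
  shows "ev c (fps_X ^ a * F) = (if a \<le> c then ev (c - a) F else - of_nat CARD('p) * ev (c + (CARD('p) - 1) - a) F)"
proof (cases "a \<le> c")
  case True
  then show ?thesis by (simp only: ev_shift if_True)
next
  case False
  let ?Q = "CARD('p) - 1"
  obtain C' where "gauss_le (dwork_radius CARD('p)) C' (fps_const 1 * (fps_X ^ a * F))"
    using gauss_le_X_power_mult[OF F] by blast
  then have "gauss_le (dwork_radius CARD('p)) C' (fps_X ^ a * F)" by simp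
  from ev_rec[OF this, of c] have "ev c (fps_X ^ a * F) = - of_nat CARD('p) * ev (c + ?Q) (fps_X ^ a * F)"
    using False by (simp only: fps_X_power_mult_nth not_le if_True diff_0 minus_mult_left)
  moreover have "ev (c + ?Q) (fps_X ^ a * F) = ev (c + ?Q - a) F"
    using a by (intro ev_shift) linarith
  ultimately show ?thesis using False by (simp only: if_False)
qed

text \<open>The factor p + x^(p-1) vanishes at pi; in coordinates this is a telescoping
  series.\<close>

lemma ev_kernel:
  assumes F: "gauss_le (dwork_radius CARD('p)) C (F :: 'p padic fps)" and c: "c < CARD('p) - 1"
  shows "ev c ((fps_const (of_nat CARD('p)) + fps_X ^ (CARD('p) - 1)) * F) = 0"
proof -
  let ?P = "of_nat CARD('p) :: 'p padic" and ?Q = "CARD('p) - 1"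
  define u where "u k = (if k = 0 then 0 else (- ?P) ^ k * F $ (c + ?Q * (k - 1)))" for k
  have nth: "((fps_const ?P + fps_X ^ ?Q) * F) $ n = ?P * F $ n + (if n < ?Q then 0 else F $ (n - ?Q))" for n
    by (simp only: distrib_right fps_add_nth fps_mult_left_const_nth fps_X_power_mult_nth)
  have t: "(- ?P) ^ k * ((fps_const ?P + fps_X ^ ?Q) * F) $ (c + ?Q * k) = u k - u (Suc k)" for k
  proof (cases k)
    case 0
    have "u (Suc 0) = - ?P * F $ c" by (simp add: u_def)
    then show ?thesis using c unfolding nth by (simp only: 0 u_def) simp
  next
    case (Suc j)
    have "\<not> c + ?Q * k < ?Q" "c + ?Q * k - ?Q = c + ?Q * j" by (simp_all only: Suc mult_Suc_right)
    then have "((fps_const ?P + fps_X ^ ?Q) * F) $ (c + ?Q * k) = ?P * F $ (c + ?Q * k) + F $ (c + ?Q * j)"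
      unfolding nth by (simp only: if_False)
    moreover have "u k = (- ?P) ^ k * F $ (c + ?Q * j)" by (simp only: u_def Suc diff_Suc_1 nat.distinct if_False)
    moreover have "u (Suc k) = (- ?P) * (- ?P) ^ k * F $ (c + ?Q * k)" by (simp only: u_def diff_Suc_1 nat.distinct if_False power_Suc)
    moreover have "x * (?P * A + B) = x * B - (- ?P) * x * A" for x A B by (simp add: algebra_simps)
    ultimately show ?thesis by (simp only:)
  qed
  have "u \<longlonglongrightarrow> 0"
  proof (rule LIMSEQ_imp_Suc, rule padic_tendstoI[OF _ eval_bound_tendsto_0])
    fix k
    have "padic_norm (u (Suc k) - 0) = padic_norm ((- ?P) ^ k * F $ (c + ?Q * k)) * inverse (real CARD('p))"
      by (simp add: u_def padic_norm_mult padic_norm_power)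
    also have "\<dots> \<le> padic_norm ((- ?P) ^ k * F $ (c + ?Q * k))"
      by (rule mult_left_le) (auto intro: less_imp_le)
    also have "\<dots> \<le> C / dwork_radius CARD('p) ^ c * ev_ratio CARD('p) ^ k"
      by (rule eval_term_le[OF F])
    finally show "padic_norm (u (Suc k) - 0) \<le> \<dots>" .
  qed
  then have "(\<lambda>K. u 0 - u K) \<longlonglongrightarrow> u 0 - 0" by (intro tendsto_diff tendsto_const)
  then have "(\<lambda>k. (- ?P) ^ k * ((fps_const ?P + fps_X ^ ?Q) * F) $ (c + ?Q * k)) sums 0"
    unfolding sums_def t sum_lessThan_telescope' by (simp add: u_def)
  then show ?thesis unfolding ev_def by (rule sums_unique[symmetric])
qed

text \<open>Division by \<open>p + x^(p-1)\<close>, whose remainder is the value at \<open>\<pi>\<close>.\<close>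

lemma ev_division:
  assumes F: "gauss_le (dwork_radius CARD('p)) C (F :: 'p padic fps)"
  obtains F' D where "gauss_le (dwork_radius CARD('p)) D F'"
    "F = (\<Sum>a<CARD('p) - 1. fps_const (ev a F) * fps_X ^ a) + (fps_const (of_nat CARD('p)) + fps_X ^ (CARD('p) - 1)) * F'"
proof -
  let ?P = "of_nat CARD('p) :: 'p padic" and ?Q = "CARD('p) - 1" and ?\<rho> = "dwork_radius CARD('p)"
  note \<rho> = dwork_radius_pos[OF odd_prime_card_ge_3[OF odd_p]]
  \<comment> \<open>By \<open>ev_rec\<close>, these shifted coordinates satisfy the recursion that
    long division prescribes for the quotient.\<close>
  define F' where "F' = Abs_fps (\<lambda>n. ev (n + ?Q) F)"
  have "gauss_le ?\<rho> (C / ?\<rho> ^ ?Q) F'"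
  proof (rule gauss_leI[OF \<rho>])
    show "padic_norm (F' $ n) \<le> C / ?\<rho> ^ ?Q / ?\<rho> ^ n" for n
      using ev_norm_le[OF F, of "n + ?Q"]
      by (simp only: F'_def fps_nth_Abs_fps power_add divide_divide_eq_left mult.commute)
  qed
  moreover have "F = (\<Sum>a<?Q. fps_const (ev a F) * fps_X ^ a) + (fps_const ?P + fps_X ^ ?Q) * F'"
  proof (rule fps_ext)
    fix n
    have "(\<Sum>a<?Q. fps_const (ev a F) * fps_X ^ a) $ n = (if n < ?Q then ev n F else 0)"
      by (simp add: fps_sum_nth if_distrib[of "\<lambda>x. _ * x"] cong: if_cong del: One_nat_def)
    moreover have "((fps_const ?P + fps_X ^ ?Q) * F') $ n = ?P * ev (n + ?Q) F + (if n < ?Q then 0 else ev n F)"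
      by (simp add: distrib_right fps_X_power_mult_nth F'_def del: One_nat_def)
    ultimately show "F $ n = ((\<Sum>a<?Q. fps_const (ev a F) * fps_X ^ a) + (fps_const ?P + fps_X ^ ?Q) * F') $ n"
      using ev_rec[OF F, of n] by (simp del: One_nat_def)
  qed
  ultimately show ?thesis by (rule that)
qed

text \<open>Divide F by p + x^(p-1): the multiple of the divisor contributes nothing and the
  remainder acts through powers of pi. This is multiplicativity of evaluation at pi, written in
  coordinates.\<close>

lemma ev_mult:
  assumes F: "gauss_le (dwork_radius CARD('p)) C (F :: 'p padic fps)" and G: "gauss_le (dwork_radius CARD('p)) D G"
    and c: "c < CARD('p) - 1"
  shows "ev c (F * G) = (\<Sum>a<CARD('p) - 1. ev a F *
    (if a \<le> c then ev (c - a) G else - of_nat CARD('p) * ev (c + (CARD('p) - 1) - a) G))"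
proof -
  let ?P = "fps_const (of_nat CARD('p)) + fps_X ^ (CARD('p) - 1) :: 'p padic fps" and ?\<rho> = "dwork_radius CARD('p)"
  note \<rho> = dwork_radius_pos[OF odd_prime_card_ge_3[OF odd_p]]
  obtain F' D' where F': "gauss_le ?\<rho> D' F'" "F = (\<Sum>a<CARD('p) - 1. fps_const (ev a F) * fps_X ^ a) + ?P * F'"
    by (rule ev_division[OF F])
  have e: "F * G = (\<Sum>a<CARD('p) - 1. fps_const (ev a F) * (fps_X ^ a * G)) + ?P * (F' * G)"
    by (subst (1) F'(2)) (simp add: algebra_simps sum_distrib_left sum_distrib_right)
  have P: "gauss_le ?\<rho> (max (padic_norm (of_nat CARD('p) :: 'p padic)) (?\<rho> ^ (CARD('p) - 1))) ?P"
    by (intro gauss_le_add \<rho> gauss_le_mono[OF gauss_le_const] gauss_le_mono[OF gauss_le_X_power[OF \<rho>]]) auto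
  note FG = gauss_le_mult[OF F'(1) G \<rho>]
  have s: "ev c (\<Sum>a<CARD('p) - 1. fps_const (ev a F) * (fps_X ^ a * G)) = (\<Sum>a<CARD('p) - 1. ev c (fps_const (ev a F) * (fps_X ^ a * G)))"
    "\<exists>C. gauss_le ?\<rho> C (\<Sum>a<CARD('p) - 1. fps_const (ev a F) * (fps_X ^ a * G))"
    using ev_sum[of "{..<CARD('p) - 1}" "\<lambda>a. fps_const (ev a F) * (fps_X ^ a * G)" c] gauss_le_X_power_mult[OF G] by auto
  then obtain E where "gauss_le ?\<rho> E (\<Sum>a<CARD('p) - 1. fps_const (ev a F) * (fps_X ^ a * G))" by blast
  from ev_add[OF this gauss_le_mult[OF P FG \<rho>], of c]
  have "ev c (F * G) = (\<Sum>a<CARD('p) - 1. ev c (fps_const (ev a F) * (fps_X ^ a * G)))"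
    unfolding e[symmetric] using ev_kernel[OF FG c] s(1) by simp
  also have "\<dots> = (\<Sum>a<CARD('p) - 1. ev a F *
    (if a \<le> c then ev (c - a) G else - of_nat CARD('p) * ev (c + (CARD('p) - 1) - a) G))"
  proof (rule sum.cong[OF refl])
    fix a assume "a \<in> {..<CARD('p) - 1}"
    then show "ev c (fps_const (ev a F) * (fps_X ^ a * G)) = ev a F *
        (if a \<le> c then ev (c - a) G else - of_nat CARD('p) * ev (c + (CARD('p) - 1) - a) G)"
      using ev_const_mult[OF gauss_le_mult[OF gauss_le_X_power[OF \<rho>] G \<rho>]] ev_X_power_mult[OF G _ c] by simp
  qed
  finally show ?thesis .
qed

section \<open>Additivity of the Dwork character\<close>

text \<open>Because t^p = t, both terms of x + x^p/p scale by t when x is replaced by t x.\<close>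

lemma dwork_at_nth:
  assumes "(t :: 'p padic) ^ CARD('p) = t" shows "dwork_at t $ n = t ^ n * dwork_exp $ n"
proof -
  have "dwork_arg oo (fps_const t * fps_X) = fps_const t * (dwork_arg :: 'p padic fps)"
    using assms
    by (simp add: dwork_arg_def fps_compose_add_distrib fps_X_fps_compose_startby0 fps_compose_mult_distrib
        power_mult_distrib distrib_left mult.left_commute flip: fps_compose_power)
  then have "dwork_at t = dwork_exp oo (fps_const t * fps_X)"
    unfolding dwork_at_def dwork_exp_def by (subst fps_expc_compose) simp_all
  then show ?thesis by (simp add: fps_compose_linear)
qed

lemma gauss_le_dwork_at:
  assumes "(t :: 'p padic) ^ CARD('p) = t" shows "gauss_le (dwork_radius CARD('p)) 1 (dwork_at t)"
  unfolding gauss_le_def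
proof
  fix n
  have "padic_norm (t ^ n) \<le> 1" by (intro padic_norm_power_le_1 power_card_fixed_norm_le assms)
  then have "padic_norm (dwork_at t $ n) \<le> padic_norm ((dwork_exp :: 'p padic fps) $ n)"
    unfolding dwork_at_nth[OF assms] by (intro padic_norm_mult_le) auto
  then have "padic_norm (dwork_at t $ n) * dwork_radius CARD('p) ^ n \<le>
      padic_norm ((dwork_exp :: 'p padic fps) $ n) * dwork_radius CARD('p) ^ n"
    using dwork_radius_pos[OF odd_prime_card_ge_3[OF odd_p]] by (intro mult_right_mono) auto
  also have "\<dots> \<le> 1" using gauss_le_dwork_exp[OF odd_p] by (simp add: gauss_le_def)
  finally show "padic_norm (dwork_at t $ n) * dwork_radius CARD('p) ^ n \<le> 1" .
qed

lemma dwork_at_0: "dwork_at (0 :: 'p padic) = 1"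
  by (simp add: dwork_at_def)

text \<open>The exponent y = v (x + x^p/p) factors as (v/p) x (p + x^(p-1)), so it vanishes at pi.
  Since p divides v, its Gauss norm is at most \<open>exp_radius\<close>, hence exp(y) - 1 is y
  times a bounded series and vanishes at pi too. For a unit v this bound fails, as it must for the
  character to be nontrivial.\<close>

lemma ev_dwork_at_small:
  assumes t: "(t :: 'p padic) ^ CARD('p) = t" and v: "padic_norm v < 1" and c: "c < CARD('p) - 1"
  shows "ev c (dwork_at t * dwork_at v) = ev c (dwork_at t)"
proof -
  let ?P = "of_nat CARD('p) :: 'p padic" and ?Q = "CARD('p) - 1" and ?\<rho> = "dwork_radius CARD('p)" and ?r = "exp_radius CARD('p)"
  note p3 = odd_prime_card_ge_3[OF odd_p]
  note \<rho> = dwork_radius_pos[OF p3]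
  note r = exp_radius_pos[OF p3]
  define y where "y = fps_const v * (dwork_arg :: 'p padic fps)"
  define E where "E = (Abs_fps (\<lambda>k. 1 / fact (Suc k)) :: 'p padic fps)"
  have y0: "y $ 0 = 0" by (simp add: y_def)
  have ye: "y = (fps_const ?P + fps_X ^ ?Q) * (fps_const (v / ?P) * fps_X)"
  proof -
    have "fps_X ^ CARD('p) = fps_X ^ ?Q * (fps_X :: 'p padic fps)"
      by (rule power_minus_mult[symmetric]) simp
    moreover have "fps_const v * fps_X = fps_const ?P * (fps_const (v / ?P) * fps_X :: 'p padic fps)"
      by (simp flip: mult.assoc)
    moreover have "fps_const v * (fps_const (1 / ?P) * Z) = fps_const (v / ?P) * Z" for Z :: "'p padic fps"
      by (simp flip: mult.assoc)
    ultimately show ?thesis by (simp add: y_def dwork_arg_def algebra_simps)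
  qed
  have v': "padic_norm v \<le> inverse (real CARD('p))" by (rule padic_norm_less_1[OF v])
  have "gauss_le ?\<rho> ?r y"
    unfolding gauss_le_def
  proof
    fix n
    consider "n = 1" | "n = CARD('p)" | "n \<noteq> 1" "n \<noteq> CARD('p)" by blast
    then show "padic_norm (y $ n) * ?\<rho> ^ n \<le> ?r"
    proof cases
      case 1
      then have "y $ n = v"
        using prime_card_neq_Suc_0[where ?'p = 'p, symmetric] by (simp add: y_def dwork_arg_def)
      then have "padic_norm (y $ n) * ?\<rho> ^ n \<le> inverse (real CARD('p)) * 1"
        using v' \<rho> dwork_radius_less_1[OF p3] by (intro mult_mono power_le_one) auto
      then show ?thesis using exp_radius_gt[OF p3] by simp
    next
      case 2
      then have "y $ n = v / ?P" using prime_card_neq_Suc_0[where ?'p = 'p] by (simp add: y_def dwork_arg_def del: prime_card_neq_Suc_0)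
      then have "padic_norm (y $ n) = padic_norm v * real CARD('p)" by (simp add: padic_norm_mult padic_norm_inverse divide_inverse)
      also have "\<dots> \<le> inverse (real CARD('p)) * real CARD('p)" using v' by (intro mult_right_mono) auto
      also have "\<dots> = 1" by simp
      finally have "padic_norm (y $ n) * ?\<rho> ^ n \<le> 1 * ?\<rho> ^ CARD('p)" using \<rho> 2 by (intro mult_mono) auto
      then show ?thesis using dwork_radius_power_le[OF p3] by simp
    next
      case 3
      then have "y $ n = 0" by (simp add: y_def dwork_arg_def)
      then show ?thesis using r by simp
    qed
  qed
  then have gE: "gauss_le ?\<rho> (inverse ?r) (E oo y)"
  proof (rule gauss_le_compose[OF _ \<rho>])
    fix k
    have "padic_norm (E $ k) * ?r ^ k * ?r \<le> 1"
      using padic_norm_inverse_fact_le[OF odd_p, of "Suc k"] by (simp add: E_def mult_ac del: fact_Suc)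
    then show "padic_norm (E $ k) * ?r ^ k \<le> inverse ?r" using r by (simp add: field_simps)
  qed
  have "fps_exp 1 = 1 + fps_X * E"
  proof (rule fps_ext)
    show "fps_exp 1 $ n = (1 + fps_X * E) $ n" for n by (cases n) (simp_all add: E_def algebra_simps)
  qed
  then have "dwork_at v = 1 + y * (E oo y)"
    unfolding dwork_at_def y_def[symmetric] fps_expc_def
    by (simp add: fps_compose_add_distrib fps_compose_mult_distrib[OF y0] fps_X_fps_compose_startby0[OF y0])
  then have e: "dwork_at t * dwork_at v = dwork_at t + (fps_const ?P + fps_X ^ ?Q) *
      ((fps_const (v / ?P) * fps_X ^ 1) * (E oo y) * dwork_at t)"
    by (simp add: algebra_simps) (simp add: ye algebra_simps)
  note t1 = gauss_le_dwork_at[OF t]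
  have K: "gauss_le ?\<rho> (padic_norm (v / ?P) * ?\<rho> ^ 1 * inverse ?r * 1) ((fps_const (v / ?P) * fps_X ^ 1) * (E oo y) * dwork_at t)"
    by (intro gauss_le_mult gauss_le_const gauss_le_X_power gE t1 \<rho>)
  have P: "gauss_le ?\<rho> (max (padic_norm ?P) (?\<rho> ^ ?Q)) (fps_const ?P + fps_X ^ ?Q)"
    by (intro gauss_le_add \<rho> gauss_le_mono[OF gauss_le_const] gauss_le_mono[OF gauss_le_X_power[OF \<rho>]]) auto
  show ?thesis unfolding e ev_add[OF t1 gauss_le_mult[OF P K \<rho>]] ev_kernel[OF K c] by simp
qed

text \<open>omega(x) + omega(y) and omega(x + y) differ by a multiple of p, which does not affect
  the value at pi. The right side is the product of two values in coordinates, wrapped by pi^(p-1) =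
  -p.\<close>

lemma dwork_char_add:
  assumes c: "c < CARD('p) - 1"
  shows "dwork_char c (x + y :: 'p mod_ring) = (\<Sum>a<CARD('p) - 1. dwork_char a x *
    (if a \<le> c then dwork_char (c - a) y else - of_nat CARD('p) * dwork_char (c + (CARD('p) - 1) - a) y))"
proof -
  let ?\<omega> = "teichmueller :: 'p mod_ring \<Rightarrow> 'p padic"
  define v where "v = ?\<omega> x + ?\<omega> y - ?\<omega> (x + y)"
  have "dwork_at (?\<omega> x) * dwork_at (?\<omega> y) = fps_expc (fps_const (?\<omega> x + ?\<omega> y) * dwork_arg)"
    unfolding dwork_at_def by (simp add: distrib_right flip: fps_expc_add fps_const_add)
  also have "?\<omega> x + ?\<omega> y = ?\<omega> (x + y) + v" by (simp add: v_def)
  also have "fps_expc (fps_const (?\<omega> (x + y) + v) * dwork_arg) = dwork_at (?\<omega> (x + y)) * dwork_at v"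
    unfolding dwork_at_def by (simp add: distrib_right flip: fps_expc_add fps_const_add)
  finally have "ev c (dwork_at (?\<omega> x) * dwork_at (?\<omega> y)) = ev c (dwork_at (?\<omega> (x + y)))"
    using ev_dwork_at_small[OF teichmueller_power_card _ c] teichmueller_add_cong[of x y] by (simp add: v_def)
  moreover have "ev c (dwork_at (?\<omega> x) * dwork_at (?\<omega> y)) = (\<Sum>a<CARD('p) - 1. dwork_char a x *
    (if a \<le> c then dwork_char (c - a) y else - of_nat CARD('p) * dwork_char (c + (CARD('p) - 1) - a) y))"
    unfolding dwork_char_def
    by (rule ev_mult[OF gauss_le_dwork_at[OF teichmueller_power_card] gauss_le_dwork_at[OF teichmueller_power_card] c])
  ultimately show ?thesis by (simp add: dwork_char_def)
qed

lemma Gamma_frac_neq_0: "(Gamma_frac k :: 'p padic) \<noteq> 0"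
  unfolding Gamma_frac_def
  by (rule padic_Gamma_neq_0[OF odd_p padic_norm_of_nat_divide_card_minus_1[OF odd_p]])

lemma dwork_char_0: "dwork_char c (0 :: 'p mod_ring) = (if c = 0 then 1 else 0)"
proof -
  have "CARD('p) - 1 \<noteq> 0" using prime_card_gt_1[where ?'p = 'p] by linarith
  then have "dwork_char c (0 :: 'p mod_ring) = (\<Sum>k\<in>{0}. (- of_nat CARD('p)) ^ k * 1 $ (c + (CARD('p) - 1) * k))"
    unfolding dwork_char_def ev_def teichmueller_0 dwork_at_0
    by (intro suminf_finite) (simp_all del: One_nat_def)
  then show ?thesis by simp
qed

text \<open>All exponents met in coordinate c are congruent to c modulo p - 1, so this coordinate is
  omega^c times a constant, and \<open>dwork_trace\<close> supplies the constant.\<close>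

lemma dwork_char_nonzero:
  assumes x: "(x :: 'p mod_ring) \<noteq> 0" and c: "c < CARD('p)"
  shows "dwork_char c x = teichmueller x ^ c * (Gamma_frac c / (1 - of_nat CARD('p)))"
proof -
  let ?P = "of_nat CARD('p) :: 'p padic" and ?Q = "CARD('p) - 1" and ?t = "teichmueller x"
  have "?t ^ (c + ?Q * k) = ?t ^ c" for k
    unfolding power_add power_mult teichmueller_power_card_minus_1[OF x] by simp
  then have "(\<lambda>K. \<Sum>k<K. (- ?P) ^ k * dwork_at ?t $ (c + ?Q * k)) =
      (\<lambda>K. ?t ^ c * (\<Sum>k<K. (- ?P) ^ k * dwork_exp $ (c + ?Q * k)))"
    by (simp only: dwork_at_nth[OF teichmueller_power_card] sum_distrib_left) (simp only: mult_ac)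
  moreover have "(\<lambda>K. ?t ^ c * (\<Sum>k<K. (- ?P) ^ k * dwork_exp $ (c + ?Q * k))) \<longlonglongrightarrow>
      ?t ^ c * (Gamma_frac c / (1 - ?P))"
    unfolding Gamma_frac_def by (intro tendsto_mult tendsto_const dwork_trace[OF odd_p c])
  ultimately have lim: "(\<lambda>K. \<Sum>k<K. (- ?P) ^ k * dwork_at ?t $ (c + ?Q * k)) \<longlonglongrightarrow> ?t ^ c * (Gamma_frac c / (1 - ?P))"
    by (simp only:)
  have "(\<lambda>K. \<Sum>k<K. (- ?P) ^ k * dwork_at ?t $ (c + ?Q * k)) \<longlonglongrightarrow> ev c (dwork_at ?t)"
    by (rule ev_limit[OF gauss_le_dwork_at[OF teichmueller_power_card]])
  from LIMSEQ_unique[OF this lim] show ?thesis unfolding dwork_char_def .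
qed

section \<open>Jacobi sums\<close>

lemma teichmueller_bar_power_mult:
  assumes x: "(x :: 'p mod_ring) \<noteq> 0" and a: "a < CARD('p) - 1"
  shows "teichmueller_bar x ^ a * teichmueller x ^ c = teichmueller x ^ ((CARD('p) - 1 - a) + c)"
proof -
  have "teichmueller_bar x ^ a * teichmueller x ^ a = 1"
    using x by (simp add: teichmueller_bar_def flip: power_mult_distrib)
  moreover have "teichmueller x ^ a * teichmueller x ^ (CARD('p) - 1 - a) = 1"
    using a teichmueller_power_card_minus_1[OF x] by (simp del: One_nat_def flip: power_add)
  ultimately have "teichmueller_bar x ^ a * (teichmueller x ^ a * teichmueller x ^ (CARD('p) - 1 - a)) =
      teichmueller_bar x ^ a" "(teichmueller_bar x ^ a * teichmueller x ^ a) * teichmueller x ^ (CARD('p) - 1 - a) =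
      teichmueller x ^ (CARD('p) - 1 - a)"
    by (simp_all only: mult_1_left mult_1_right)
  then have "teichmueller_bar x ^ a = teichmueller x ^ (CARD('p) - 1 - a)" by (simp only: mult.assoc)
  then show ?thesis by (simp only: power_add)
qed

text \<open>Gauss sums in coordinates: by orthogonality only the coordinate whose index equals the
  exponent of the character survives.\<close>

lemma sum_teichmueller_bar_dwork_char:
  assumes a: "a < CARD('p) - 1" and c: "c < CARD('p) - 1"
  shows "(\<Sum>x\<in>-{0 :: 'p mod_ring}. teichmueller_bar x ^ a * dwork_char c x) =
    (if a = c then of_nat (CARD('p) - 1) * (Gamma_frac a / (1 - of_nat CARD('p))) else 0)"
proof -
  let ?Q = "CARD('p) - 1"
  have "(\<Sum>x\<in>-{0 :: 'p mod_ring}. teichmueller_bar x ^ a * dwork_char c x) =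
      (\<Sum>x\<in>-{0 :: 'p mod_ring}. teichmueller x ^ ((?Q - a) + c) * (Gamma_frac c / (1 - of_nat CARD('p))))"
    using c by (intro sum.cong refl)
      (simp add: dwork_char_nonzero teichmueller_bar_power_mult[OF _ a] del: One_nat_def flip: mult.assoc)
  also have "\<dots> = (if ?Q dvd (?Q - a) + c then of_nat ?Q else 0) * (Gamma_frac c / (1 - of_nat CARD('p)))"
    by (simp only: sum_distrib_right[symmetric] sum_teichmueller_power)
  also have "?Q dvd (?Q - a) + c \<longleftrightarrow> a = c"
  proof
    assume "?Q dvd (?Q - a) + c"
    then obtain k where k: "(?Q - a) + c = ?Q * k" by (elim dvdE)
    have "?Q * k < ?Q * 2" "0 < ?Q * k" using a c k[symmetric] by linarith+
    then have "k < 2" "0 < k" by (simp_all only: mult_less_cancel1) auto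
    then have "k = 1" by simp
    then show "a = c" using k a by simp
  qed (use a in simp)
  finally show ?thesis by auto
qed

text \<open>Coordinate d of a product of two Gauss sums is computed twice: multiplied out in
  coordinates, where orthogonality keeps only k = a and a carry contributes -p, and by collecting u
  = x + y, which yields the Jacobi sum times one Gauss sum. The assumption on a + b disposes of u =
  0, where the character value is 1 and has no coordinate d.\<close>

theorem gross_koblitz_jacobi:
  assumes a: "a < CARD('p) - 1" and b: "b < CARD('p) - 1" and c: "(a + b) mod (CARD('p) - 1) \<noteq> 0"
  shows "(jacobi a b :: 'p padic) = - ((- of_nat CARD('p)) ^ ((a + b) div (CARD('p) - 1)) *
    Gamma_frac a * Gamma_frac b / Gamma_frac ((a + b) mod (CARD('p) - 1)))"
proof -
  let ?P = "of_nat CARD('p) :: 'p padic" and ?Q = "CARD('p) - 1"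
  let ?\<omega> = "teichmueller :: 'p mod_ring \<Rightarrow> 'p padic" and ?\<chi> = "teichmueller_bar :: 'p mod_ring \<Rightarrow> 'p padic"
  define d where "d = (a + b) mod ?Q"
  define G where "G k = Gamma_frac k / (1 - ?P)" for k
  have Q: "?Q > 0" using a by linarith
  then have d: "d < ?Q" unfolding d_def by (rule mod_less_divisor)
  have QP: "of_nat ?Q = ?P - 1" using prime_card_gt_1[where ?'p = 'p] by (simp add: of_nat_diff)
  note Q0 = of_nat_card_minus_1_neq_0[where ?'p = 'p and ?'q = 'p]
  have mult: "?\<chi> (x * y) = ?\<chi> x * ?\<chi> y" for x y by (simp add: teichmueller_bar_def teichmueller_mult)
  define S where "S = (\<Sum>x\<in>-{0}. \<Sum>y\<in>-{0}. ?\<chi> x ^ a * ?\<chi> y ^ b * dwork_char d (x + y))"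
  \<comment> \<open>A carry in a + b occurs exactly when d < a, and in both cases the index left for
    the second factor is b.\<close>
  have carry: "(a + b) div ?Q = (if a \<le> d then 0 else 1) \<and> (if a \<le> d then d - a else d + ?Q - a) = b"
  proof (cases "a + b < ?Q")
    case True
    then show ?thesis by (simp add: d_def del: One_nat_def)
  next
    case False
    then have "d = a + b - ?Q" unfolding d_def using a b by (subst le_mod_geq) (simp_all del: One_nat_def)
    moreover have "(a + b) div ?Q = 1" using False a b Q by (subst le_div_geq) (simp_all del: One_nat_def)
    ultimately show ?thesis using False a b by auto
  qed
  have "S = (\<Sum>x\<in>-{0}. \<Sum>y\<in>-{0}. \<Sum>k<?Q. (?\<chi> x ^ a * dwork_char k x) *
      (?\<chi> y ^ b * (if k \<le> d then dwork_char (d - k) y else - ?P * dwork_char (d + ?Q - k) y)))"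
    unfolding S_def dwork_char_add[OF d] sum_distrib_left by (intro sum.cong refl) (simp only: mult_ac)
  also have "\<dots> = (\<Sum>k<?Q. \<Sum>x\<in>-{0}. \<Sum>y\<in>-{0}. (?\<chi> x ^ a * dwork_char k x) *
      (?\<chi> y ^ b * (if k \<le> d then dwork_char (d - k) y else - ?P * dwork_char (d + ?Q - k) y)))"
    by (subst (2) sum.swap, subst sum.swap) (rule refl)
  also have "\<dots> = (\<Sum>k<?Q. (\<Sum>x\<in>-{0}. ?\<chi> x ^ a * dwork_char k x) *
      (\<Sum>y\<in>-{0}. ?\<chi> y ^ b * (if k \<le> d then dwork_char (d - k) y else - ?P * dwork_char (d + ?Q - k) y)))"
    by (simp only: sum_product)
  also have "\<dots> = (\<Sum>k<?Q. if k = a then of_nat ?Q * G a *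
      (\<Sum>y\<in>-{0}. ?\<chi> y ^ b * (if a \<le> d then dwork_char (d - a) y else - ?P * dwork_char (d + ?Q - a) y)) else 0)"
  proof (rule sum.cong[OF refl])
    fix k assume k: "k \<in> {..<?Q}"
    show "(\<Sum>x\<in>-{0}. ?\<chi> x ^ a * dwork_char k x) *
      (\<Sum>y\<in>-{0}. ?\<chi> y ^ b * (if k \<le> d then dwork_char (d - k) y else - ?P * dwork_char (d + ?Q - k) y)) =
      (if k = a then of_nat ?Q * G a *
      (\<Sum>y\<in>-{0}. ?\<chi> y ^ b * (if a \<le> d then dwork_char (d - a) y else - ?P * dwork_char (d + ?Q - a) y)) else 0)"
    proof (cases "k = a")
      case True
      then show ?thesis by (simp only: True sum_teichmueller_bar_dwork_char[OF a a] G_def simp_thms if_True)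
    next
      case False
      have "(\<Sum>x\<in>-{0 :: 'p mod_ring}. ?\<chi> x ^ a * dwork_char k x) = 0"
        using k False by (subst sum_teichmueller_bar_dwork_char[OF a]) simp_all
      then show ?thesis using False by (simp only: mult_zero_left if_False)
    qed
  qed
  also have "\<dots> = of_nat ?Q * G a * (\<Sum>y\<in>-{0}. ?\<chi> y ^ b * (if a \<le> d then dwork_char (d - a) y else - ?P * dwork_char (d + ?Q - a) y))"
    using a by (subst sum.delta) (simp_all del: One_nat_def)
  also have "(\<Sum>y\<in>-{0}. ?\<chi> y ^ b * (if a \<le> d then dwork_char (d - a) y else - ?P * dwork_char (d + ?Q - a) y)) =
      (- ?P) ^ ((a + b) div ?Q) * (\<Sum>y\<in>-{0}. ?\<chi> y ^ b * dwork_char b y)"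
    using carry by (cases "a \<le> d") (simp_all add: sum_distrib_left algebra_simps sum_negf del: One_nat_def)
  also have "(\<Sum>y\<in>-{0}. ?\<chi> y ^ b * dwork_char b y) = of_nat ?Q * G b"
    by (simp add: sum_teichmueller_bar_dwork_char[OF b b] G_def del: One_nat_def)
  finally have S1: "S = of_nat ?Q * G a * ((- ?P) ^ ((a + b) div ?Q) * (of_nat ?Q * G b))" .

  \<comment> \<open>Scaling x by u extracts the character value at u. The case x = u is set to 0
    explicitly because for b = 0 the power at 0 would be 1.\<close>
  have inner: "(\<Sum>x\<in>-{0}. ?\<chi> x ^ a * (if u = x then 0 else ?\<chi> (u - x) ^ b)) = ?\<chi> u ^ (a + b) * jacobi a b"
    if u: "u \<noteq> 0" for u
  proof -
    have "(\<Sum>x\<in>-{0}. ?\<chi> x ^ a * (if u = x then 0 else ?\<chi> (u - x) ^ b)) =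
        (\<Sum>x\<in>-{0}. ?\<chi> (u * x) ^ a * (if u = u * x then 0 else ?\<chi> (u - u * x) ^ b))"
      by (rule sum_mult_reindex[OF u, symmetric])
    also have "\<dots> = (\<Sum>x\<in>-{0}. if x = 1 then 0 else ?\<chi> u ^ (a + b) * (?\<chi> x ^ a * ?\<chi> (1 - x) ^ b))"
    proof (intro sum.cong refl)
      fix x
      have "u - u * x = u * (1 - x)" by (simp add: algebra_simps)
      then show "?\<chi> (u * x) ^ a * (if u = u * x then 0 else ?\<chi> (u - u * x) ^ b) =
        (if x = 1 then 0 else ?\<chi> u ^ (a + b) * (?\<chi> x ^ a * ?\<chi> (1 - x) ^ b))"
        using u by (simp add: mult power_mult_distrib power_add)
    qed
    also have "\<dots> = (\<Sum>x\<in>-{0,1}. ?\<chi> u ^ (a + b) * (?\<chi> x ^ a * ?\<chi> (1 - x) ^ b))"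
      by (intro sum.mono_neutral_cong_right) auto
    finally show ?thesis by (simp add: jacobi_def sum_distrib_left)
  qed
  have "S = (\<Sum>x\<in>-{0}. \<Sum>u\<in>-{x}. ?\<chi> x ^ a * ?\<chi> (u - x) ^ b * dwork_char d u)"
    unfolding S_def
  proof (rule sum.cong[OF refl])
    fix x :: "'p mod_ring"
    show "(\<Sum>y\<in>-{0}. ?\<chi> x ^ a * ?\<chi> y ^ b * dwork_char d (x + y)) = (\<Sum>u\<in>-{x}. ?\<chi> x ^ a * ?\<chi> (u - x) ^ b * dwork_char d u)"
      by (rule sum.reindex_bij_witness[of _ "\<lambda>u. u - x" "\<lambda>y. x + y"]) auto
  qed
  also have "\<dots> = (\<Sum>x\<in>-{0}. \<Sum>u\<in>-{0}. (?\<chi> x ^ a * (if u = x then 0 else ?\<chi> (u - x) ^ b)) * dwork_char d u)"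
  proof (rule sum.cong[OF refl])
    fix x :: "'p mod_ring" assume "x \<in> -{0}"
    have d0: "dwork_char d (0 :: 'p mod_ring) = 0" using c by (simp add: dwork_char_0 d_def)
    have "(\<Sum>u\<in>-{x}. ?\<chi> x ^ a * ?\<chi> (u - x) ^ b * dwork_char d u) =
        (\<Sum>u\<in>UNIV. (?\<chi> x ^ a * (if u = x then 0 else ?\<chi> (u - x) ^ b)) * dwork_char d u)"
      by (intro sum.mono_neutral_cong_left) auto
    also have "\<dots> = (\<Sum>u\<in>-{0}. (?\<chi> x ^ a * (if u = x then 0 else ?\<chi> (u - x) ^ b)) * dwork_char d u)"
      by (intro sum.mono_neutral_right) (auto simp: d0)
    finally show "(\<Sum>u\<in>-{x}. ?\<chi> x ^ a * ?\<chi> (u - x) ^ b * dwork_char d u) = \<dots>" .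
  qed
  also have "\<dots> = (\<Sum>u\<in>-{0}. \<Sum>x\<in>-{0}. (?\<chi> x ^ a * (if u = x then 0 else ?\<chi> (u - x) ^ b)) * dwork_char d u)"
    by (rule sum.swap)
  also have "\<dots> = (\<Sum>u\<in>-{0}. jacobi a b * (?\<chi> u ^ (a + b) * dwork_char d u))"
  proof (intro sum.cong refl)
    fix u :: "'p mod_ring" assume "u \<in> -{0}"
    then show "(\<Sum>x\<in>-{0}. (?\<chi> x ^ a * (if u = x then 0 else ?\<chi> (u - x) ^ b)) * dwork_char d u) =
        jacobi a b * (?\<chi> u ^ (a + b) * dwork_char d u)"
      unfolding sum_distrib_right[symmetric] by (subst inner) simp_all
  qed
  also have "\<dots> = jacobi a b * (\<Sum>u\<in>-{0}. ?\<chi> u ^ d * dwork_char d u)"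
  proof -
    have "?\<chi> u ^ (a + b) = ?\<chi> u ^ d" if "u \<noteq> 0" for u :: "'p mod_ring"
      unfolding d_def teichmueller_bar_def power_inverse teichmueller_power_mod[OF that] ..
    then show ?thesis by (simp add: sum_distrib_left)
  qed
  also have "(\<Sum>u\<in>-{0}. ?\<chi> u ^ d * dwork_char d u) = of_nat ?Q * G d"
    by (simp add: sum_teichmueller_bar_dwork_char[OF d d] G_def del: One_nat_def)
  finally have S2: "S = jacobi a b * (of_nat ?Q * G d)" .
  have G: "G k = - Gamma_frac k / of_nat ?Q" for k 
  proof -
    have "1 - ?P = - (?P - 1)" by simp
    then show ?thesis unfolding G_def QP by (simp only: divide_minus_right minus_divide_left)
  qed
  have "of_nat ?Q * G a * ((- ?P) ^ ((a + b) div ?Q) * (of_nat ?Q * G b)) = jacobi a b * (of_nat ?Q * G d)"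
    using S1 S2 by simp
  then have "Gamma_frac a * ((- ?P) ^ ((a + b) div ?Q) * Gamma_frac b) = - (jacobi a b * Gamma_frac d)"
    unfolding G using Q0 by (simp del: One_nat_def of_nat_diff)
  then show ?thesis unfolding d_def[symmetric] using Gamma_frac_neq_0[of d]
    by (simp add: field_simps del: One_nat_def of_nat_diff)
qed

end

section \<open>Quadratic character sums over a finite field\<close>

text \<open>Convolution over the multiplicative group, which the Mellin transform turns into a
  product.\<close>

definition conv :: "('a::{field,finite} \<Rightarrow> 'b::comm_ring_1) \<Rightarrow> ('a \<Rightarrow> 'b) \<Rightarrow> 'a \<Rightarrow> 'b" where
  "conv f g x = (\<Sum>y\<in>-{0}. f y * g (x / y))"

text \<open>Characterised through the number of square roots, from which the value on squares,
  orthogonality and the substitution of squares all follow. Any domain of characteristic 0 may hold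
  the values, so no p-adic argument enters this part.\<close>

locale quadratic_character =
  fixes \<phi> :: "'a::{field,finite} \<Rightarrow> 'b::{idom,ring_char_0}"
  assumes phi_0 [simp]: "\<phi> 0 = 0"
    and phi_mult: "\<phi> (x * y) = \<phi> x * \<phi> y"
    and card_sqrt: "of_nat (card {x. x ^ 2 = d}) = 1 + \<phi> d"
    and two_neq_0: "(2 :: 'a) \<noteq> 0"
begin

lemma phi_square: assumes "x \<noteq> 0" shows "\<phi> (x ^ 2) = 1"
proof -
  have "x \<noteq> - x"
  proof
    assume "x = - x"
    then have "2 * x = 0" by (metis add.right_inverse mult_2)
    then show False using assms two_neq_0 by simp
  qed
  moreover have "{y. y ^ 2 = x ^ 2} = {x, - x}" by (auto simp: power2_eq_iff)
  ultimately have "1 + \<phi> (x ^ 2) = 2" using card_sqrt[of "x ^ 2"] by simp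
  then show ?thesis by simp
qed

lemma phi_1 [simp]: "\<phi> 1 = 1"
  using phi_square[of 1] by simp

lemma phi_mult_self: "x \<noteq> 0 \<Longrightarrow> \<phi> x * \<phi> x = 1"
  using phi_square[of x] by (simp add: power2_eq_square phi_mult)

lemma phi_mult_square: "c \<noteq> 0 \<Longrightarrow> \<phi> (x * c ^ 2) = \<phi> x"
  by (simp add: phi_mult phi_square)

lemma phi_eqI: "y = x * c ^ 2 \<Longrightarrow> c \<noteq> 0 \<Longrightarrow> \<phi> y = \<phi> x"
  by (simp add: phi_mult_square)

text \<open>Sorting the elements of the field by their squares counts each once, and each square
  class d holds 1 + phi(d) of them.\<close>

lemma sum_phi: "(\<Sum>x\<in>UNIV. \<phi> x) = 0"
proof -
  have "(\<Sum>d\<in>UNIV. card {x :: 'a. x ^ 2 = d}) = card (UNIV :: 'a set)"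
  proof -
    have "(\<Sum>d\<in>UNIV. card {x :: 'a. x ^ 2 = d}) = (\<Sum>d\<in>UNIV. \<Sum>x\<in>{x \<in> (UNIV :: 'a set). x ^ 2 = d}. 1)"
      by simp
    also have "\<dots> = (\<Sum>x\<in>(UNIV :: 'a set). 1)"
      by (rule sum.group) auto
    finally show ?thesis by simp
  qed
  then have "of_nat (\<Sum>d\<in>UNIV. card {x :: 'a. x ^ 2 = d}) = (of_nat (card (UNIV :: 'a set)) :: 'b)" by simp
  then show ?thesis by (simp add: card_sqrt sum.distrib)
qed

lemma sum_Compl_0: "(\<Sum>x\<in>-{0}. f x) = (\<Sum>x\<in>UNIV. f x) - (f 0 :: 'b)" for f :: "'a \<Rightarrow> 'b"
  by (simp add: Compl_eq_Diff_UNIV sum_diff1)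

lemma sum_reindex_plus: "(\<Sum>x\<in>UNIV. f (x + c)) = (\<Sum>x\<in>UNIV. f x)" for f :: "'a \<Rightarrow> 'b"
  by (rule sum.reindex_bij_witness[of _ "\<lambda>x. x - c" "\<lambda>x. x + c"]) auto

lemma sum_phi_nonzero: "(\<Sum>x\<in>-{0}. \<phi> x) = 0"
  by (simp add: sum_Compl_0 sum_phi)

lemma sum_phi_plus_nonzero: "(\<Sum>y\<in>-{0}. \<phi> (1 + y)) = - 1"
  using sum_reindex_plus[of \<phi> 1] by (simp add: sum_Compl_0 sum_phi add.commute)

text \<open>For c nonzero the summand is phi(1 + c/x) up to a square, and c/x runs over all nonzero
  elements. The jump at c = 0 is the source of the terms linear in the field size.\<close>

lemma sum_phi_phi_plus:
  "(\<Sum>x\<in>UNIV. \<phi> x * \<phi> (x + c)) = (if c = 0 then of_nat CARD('a) - 1 else - 1)"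
proof (cases "c = 0")
  case True
  have "(\<Sum>x\<in>UNIV. \<phi> x * \<phi> x) = (\<Sum>x\<in>-{0}. \<phi> x * \<phi> x)" by (simp add: sum_Compl_0)
  also have "\<dots> = (\<Sum>x\<in>-{0 :: 'a}. 1)" by (intro sum.cong) (auto simp: phi_mult_self)
  also have "\<dots> = of_nat CARD('a) - 1" by (simp only: sum_Compl_0) simp
  finally show ?thesis using True by simp
next
  case False
  have "(\<Sum>x\<in>UNIV. \<phi> x * \<phi> (x + c)) = (\<Sum>x\<in>-{0}. \<phi> x * \<phi> (x + c))" by (simp add: sum_Compl_0)
  also have "\<dots> = (\<Sum>x\<in>-{0}. \<phi> (1 + c / x))"
  proof (rule sum.cong[OF refl])
    fix x :: 'a assume "x \<in> -{0}"
    then show "\<phi> x * \<phi> (x + c) = \<phi> (1 + c / x)"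
      unfolding phi_mult[symmetric] by (intro phi_eqI[of _ _ x]) (auto simp: field_simps power2_eq_square)
  qed
  also have "\<dots> = (\<Sum>y\<in>-{0}. \<phi> (1 + y))"
    by (rule sum.reindex_bij_witness[of _ "\<lambda>y. c / y" "\<lambda>x. c / x"]) (use False in auto)
  finally show ?thesis using False sum_phi_plus_nonzero by simp
qed

lemma sum_square_fibres: "(\<Sum>v\<in>UNIV. g (v ^ 2)) = (\<Sum>t\<in>UNIV. (1 + \<phi> t) * g t)" for g :: "'a \<Rightarrow> 'b"
proof -
  have "(\<Sum>v\<in>UNIV. g (v ^ 2)) = (\<Sum>t\<in>UNIV. \<Sum>v\<in>{v \<in> UNIV. v ^ 2 = t}. g (v ^ 2))"
    by (rule sum.group[symmetric]) auto
  also have "\<dots> = (\<Sum>t\<in>UNIV. \<Sum>v\<in>{v. v ^ 2 = t}. g t)" by (intro sum.cong) auto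
  also have "\<dots> = (\<Sum>t\<in>UNIV. (1 + \<phi> t) * g t)" by (simp flip: card_sqrt)
  finally show ?thesis .
qed

text \<open>Its Mellin transform is, up to sign, the hypergeometric factor with parameter
  1/2.\<close>

definition shift :: "'a \<Rightarrow> 'b" where "shift y = \<phi> (1 + y)"

text \<open>The pairs z and w/z have product w. The Mellin transform is the product of the two
  hypergeometric factors with parameters 1/4 and 3/4.\<close>

definition pair_mean :: "'a \<Rightarrow> 'b" where "pair_mean w = (\<Sum>z\<in>-{0}. \<phi> (1 + (z + w / z) / 2))"

definition triple_shift :: "'a \<Rightarrow> 'b" where "triple_shift = conv shift (conv shift shift)"

definition triple_mean :: "'a \<Rightarrow> 'b" where "triple_mean = conv shift pair_mean"

text \<open>Rescaling b leads from this sum to \<open>triple_mean\<close>; trading y for a new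
  variable w leads to \<open>triple_shift\<close>.\<close>

definition bridge :: "'a \<Rightarrow> 'b" where
  "bridge x = (\<Sum>y\<in>-{0}. \<Sum>b\<in>-{0}. \<phi> ((1 + y) * (1 + x + b - x / (y * b))))"

lemma four_neq_0: "(4 :: 'a) \<noteq> 0"
proof -
  have "(4 :: 'a) = 2 * 2" by simp
  then show ?thesis using two_neq_0 by (metis mult_eq_0_iff)
qed

text \<open>Setting b = (1 + x) z / 2 pulls 1 + x out of the second factor and leaves half the sum
  of z and w/z, with w = -4x/((1 + x)^2 y).\<close>

lemma bridge_eq_triple_mean:
  assumes x: "x \<noteq> -1"
  shows "bridge x = \<phi> (1 + x) * triple_mean (- 4 * x / (1 + x) ^ 2)"
proof -
  have x1: "1 + x \<noteq> 0" using x by (metis add.commute add_eq_0_iff)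
  then have c0: "(1 + x) / 2 \<noteq> 0" using two_neq_0 by simp
  have "(\<Sum>b\<in>-{0}. \<phi> ((1 + y) * (1 + x + b - x / (y * b)))) =
      \<phi> (1 + x) * (shift y * pair_mean (- 4 * x / (1 + x) ^ 2 / y))" if y: "y \<noteq> 0" for y
  proof -
    have "(\<Sum>b\<in>-{0}. \<phi> ((1 + y) * (1 + x + b - x / (y * b)))) =
      (\<Sum>z\<in>-{0}. \<phi> ((1 + y) * (1 + x + ((1 + x) / 2 * z) - x / (y * ((1 + x) / 2 * z)))))"
      by (rule sum_mult_reindex[OF c0, symmetric])
    also have "\<dots> = (\<Sum>z\<in>-{0}. \<phi> (1 + x) * \<phi> (1 + y) * \<phi> (1 + (z + - 4 * x / (1 + x) ^ 2 / y / z) / 2))"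
    proof (rule sum.cong[OF refl])
      fix z :: 'a assume "z \<in> -{0}"
      then have "(1 + y) * (1 + x + ((1 + x) / 2 * z) - x / (y * ((1 + x) / 2 * z))) =
        (1 + x) * (1 + y) * (1 + (z + - 4 * x / (1 + x) ^ 2 / y / z) / 2)"
        using x1 y two_neq_0 by (simp add: divide_simps power2_eq_square) (simp add: algebra_simps)
      then show "\<phi> ((1 + y) * (1 + x + ((1 + x) / 2 * z) - x / (y * ((1 + x) / 2 * z)))) =
        \<phi> (1 + x) * \<phi> (1 + y) * \<phi> (1 + (z + - 4 * x / (1 + x) ^ 2 / y / z) / 2)"
        by (simp only: phi_mult)
    qed
    finally show ?thesis by (simp add: shift_def pair_mean_def sum_distrib_left mult.assoc)
  qed
  then show ?thesis unfolding bridge_def triple_mean_def conv_def sum_distrib_left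
    by (intro sum.cong) auto
qed

text \<open>Clear denominators by squares, then translate by y = b - w; the new variable b is the
  one of the bridge sum.\<close>

lemma conv_shift_shift:
  assumes w: "w \<noteq> 0"
  shows "conv shift shift w = (\<Sum>b\<in>UNIV. \<phi> (b * (w - b) * (w - 1 - b)))"
proof -
  have "conv shift shift w = (\<Sum>y\<in>-{0}. \<phi> (y * (1 + y) * (y + w)))"
    unfolding conv_def
  proof (rule sum.cong[OF refl])
    fix y :: 'a assume "y \<in> -{0}"
    then show "shift y * shift (w / y) = \<phi> (y * (1 + y) * (y + w))"
      unfolding shift_def phi_mult[symmetric]
      by (intro phi_eqI[of _ _ "1 / y"]) (auto simp: field_simps power2_eq_square)
  qed
  also have "\<dots> = (\<Sum>y\<in>UNIV. \<phi> (y * (1 + y) * (y + w)))" by (simp add: sum_Compl_0)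
  also have "\<dots> = (\<Sum>b\<in>UNIV. \<phi> ((b + - w) * (1 + (b + - w)) * ((b + - w) + w)))"
    by (rule sum_reindex_plus[symmetric])
  also have "\<dots> = (\<Sum>b\<in>UNIV. \<phi> (b * (w - b) * (w - 1 - b)))"
    by (intro sum.cong refl arg_cong[of _ _ \<phi>]) (simp add: algebra_simps)
  finally show ?thesis .
qed

lemma triple_shift_alt:
  assumes x: "x \<noteq> 0"
  shows "triple_shift x = (\<Sum>w\<in>-{0}. \<phi> (1 + x / w) * (\<Sum>b\<in>UNIV. \<phi> (b * (w - b) * (w - 1 - b))))"
proof -
  have "triple_shift x = (\<Sum>w\<in>-{0}. shift (x / w) * conv shift shift w)"
    unfolding triple_shift_def conv_def[of shift "conv shift shift"]
    by (rule sum.reindex_bij_witness[of _ "\<lambda>w. x / w" "\<lambda>y. x / y"]) (use x in auto)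
  also have "\<dots> = (\<Sum>w\<in>-{0}. \<phi> (1 + x / w) * (\<Sum>b\<in>UNIV. \<phi> (b * (w - b) * (w - 1 - b))))"
    by (intro sum.cong) (auto simp: shift_def conv_shift_shift)
  finally show ?thesis .
qed

text \<open>The substitution \<open>w = y b (1 + b) / (b y - 1)\<close> is the elementary form of the Pfaff--Saalschuetz
  summation behind Whipple's quadratic transformation.\<close>

lemma bridge_eq_triple_shift:
  assumes x: "x \<noteq> 0"
  shows "bridge x = triple_shift x - (if x = 1 then of_nat CARD('a) * \<phi> (-1) else 0)"
proof -
  define g where "g b y = \<phi> ((1 + y) * (1 + x + b - x / (y * b)))" for b y
  define h where "h w b = \<phi> (b * (w - b) * (w - 1 - b)) * \<phi> (1 + x / w)" for w b
  \<comment> \<open>b = -1 is set aside because the substitution has the factor 1 + b and collapses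
    there.\<close>
  have m1: "(\<Sum>y\<in>-{0}. g (-1) y) = - (\<phi> x * \<phi> (-1))"
  proof -
    have "(\<Sum>y\<in>-{0}. g (-1) y) = (\<Sum>y\<in>-{0}. if y = -1 then 0 else \<phi> x * \<phi> y)"
    proof (rule sum.cong[OF refl])
      fix y :: 'a assume y: "y \<in> -{0}"
      show "g (-1) y = (if y = -1 then 0 else \<phi> x * \<phi> y)"
      proof (cases "y = -1")
        case False
        then have "1 + y \<noteq> 0" by (metis add.commute add_eq_0_iff)
        then show ?thesis using False y unfolding g_def phi_mult[symmetric]
          by (simp, intro phi_eqI[of _ _ "(1 + y) / y"]) (auto simp: field_simps power2_eq_square)
      qed (simp add: g_def)
    qed
    also have "\<dots> = (\<Sum>y\<in>-{0}. \<phi> x * \<phi> y - (if y = -1 then \<phi> x * \<phi> (-1) else 0))"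
      by (intro sum.cong) auto
    also have "\<dots> = \<phi> x * (\<Sum>y\<in>-{0}. \<phi> y) - \<phi> x * \<phi> (-1)"
      by (simp add: sum_subtractf sum_distrib_left)
    finally show ?thesis by (simp add: sum_phi_nonzero)
  qed
  have inner: "(\<Sum>y\<in>-{0}. g b y) = \<phi> b + (\<Sum>w\<in>-{0}. h w b)" if b: "b \<noteq> 0" "b \<noteq> -1" for b
  proof -
    have b1: "1 + b \<noteq> 0" using b by (metis add.commute add_eq_0_iff)
    \<comment> \<open>y = 1/b is the pole of the substitution; its term supplies phi(b). On the
      other side w = 1 + b is never reached, which is harmless since \<open>h\<close> vanishes
      there.\<close>
    have "-{0} = insert (1 / b) (-{0, 1 / b})" using b by auto
    then have "(\<Sum>y\<in>-{0}. g b y) = g b (1 / b) + (\<Sum>y\<in>-{0, 1 / b}. g b y)" by simp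
    also have "g b (1 / b) = \<phi> b"
      unfolding g_def using b b1 by (intro phi_eqI[of _ _ "(1 + b) / b"]) (auto simp: field_simps power2_eq_square)
    also have "(\<Sum>y\<in>-{0, 1 / b}. g b y) = (\<Sum>w\<in>-{0, 1 + b}. h w b)"
    proof (rule sum.reindex_bij_witness[of _ "\<lambda>w. w / (b * (w - 1 - b))" "\<lambda>y. y * b * (1 + b) / (b * y - 1)"])
      fix y assume y: "y \<in> -{0, 1 / b}"
      then have by1: "b * y - 1 \<noteq> 0" using b by (auto simp: field_simps)
      have e: "y * b * (1 + b) / (b * y - 1) - 1 - b = (1 + b) / (b * y - 1)"
        using by1 by (simp add: field_simps)
      show "y * b * (1 + b) / (b * y - 1) / (b * (y * b * (1 + b) / (b * y - 1) - 1 - b)) = y"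
        unfolding e using by1 b b1 by simp
      have "(1 + b) / (b * y - 1) \<noteq> 0" using by1 b1 by simp
      then have "y * b * (1 + b) / (b * y - 1) \<noteq> 1 + b" using e by auto
      then show "y * b * (1 + b) / (b * y - 1) \<in> -{0, 1 + b}" using y b b1 by1 by simp
    next
      fix w assume w: "w \<in> -{0, 1 + b}"
      then have wb: "w - 1 - b \<noteq> 0" by (auto simp: algebra_simps)
      define y where "y = w / (b * (w - 1 - b))"
      have yb: "y * b = w / (w - 1 - b)" using b by (simp add: y_def)
      have "(w - D) / D = w / D - 1" if "D \<noteq> 0" for D using that by (simp add: diff_divide_distrib)
      note this[OF wb]
      moreover have "(1 + b) / (w - 1 - b) = (w - (w - 1 - b)) / (w - 1 - b)" by simp
      ultimately have "(1 + b) / (w - 1 - b) = y * b - 1" unfolding yb by (rule trans[rotated])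
      then have e: "b * y - 1 = (1 + b) / (w - 1 - b)" by (simp add: mult.commute)
      have "y \<noteq> 0" using w wb b by (simp add: y_def)
      moreover have "b * y - 1 \<noteq> 0" unfolding e using wb b1 by simp
      then have "y \<noteq> 1 / b" using b by auto
      ultimately show "w / (b * (w - 1 - b)) \<in> -{0, 1 / b}" unfolding y_def[symmetric] by simp
      show "w / (b * (w - 1 - b)) * b * (1 + b) / (b * (w / (b * (w - 1 - b))) - 1) = w"
        unfolding y_def[symmetric] e yb using wb b1 by simp
    next
      fix y assume y: "y \<in> -{0, 1 / b}"
      then have by1: "b * y - 1 \<noteq> 0" using b by (auto simp: field_simps)
      define w where "w = y * b * (1 + b) / (b * y - 1)"
      have e: "w - 1 - b = (1 + b) / (b * y - 1)" unfolding w_def using by1 by (simp add: field_simps)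
      have e2: "w - b = b * (1 + y) / (b * y - 1)" unfolding w_def using by1 by (simp add: field_simps)
      have "x / w = x * (b * y - 1) / (y * b) / (1 + b)"
        unfolding w_def using by1 b1 by simp
      also have "x * (b * y - 1) / (y * b) = x - x / (y * b)"
        using y b by (simp add: right_diff_distrib diff_divide_distrib mult.commute)
      finally have xw: "x / w = (x - x / (y * b)) / (1 + b)" .
      have "1 + t / B = (B + t) / B" if "B \<noteq> 0" for t B :: 'a using that by (simp add: add_divide_distrib)
      from this[OF b1] have "1 + x / w = ((1 + b) + (x - x / (y * b))) / (1 + b)" unfolding xw .
      then have e3: "1 + x / w = (1 + x + b - x / (y * b)) / (1 + b)" by (simp add: algebra_simps)
      have c: "b / (b * y - 1) \<noteq> 0" using b by1 by simp
      have "(b * (w - b) * (w - 1 - b)) * (1 + x / w) = ((1 + y) * (1 + x + b - x / (y * b))) * (b / (b * y - 1)) ^ 2"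
        unfolding e e2 e3 using b1 by (simp add: power2_eq_square)
      from phi_eqI[OF this c]
      have "\<phi> ((b * (w - b) * (w - 1 - b)) * (1 + x / w)) = \<phi> ((1 + y) * (1 + x + b - x / (y * b)))" .
      then show "h (y * b * (1 + b) / (b * y - 1)) b = g b y"
        unfolding w_def[symmetric] h_def g_def by (simp only: phi_mult)
    qed
    also have "\<dots> = (\<Sum>w\<in>-{0}. h w b)"
      by (rule sum.mono_neutral_left) (auto simp: h_def algebra_simps)
    finally show ?thesis .
  qed
  have split: "(\<Sum>b\<in>-{0}. f b) = f (-1) + (\<Sum>b\<in>-{0,-1}. f b)" for f :: "'a \<Rightarrow> 'b"
  proof -
    have "-{0} = insert (-1) (-{0,-1 :: 'a})" by auto
    then show ?thesis by simp
  qed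
  have neg: "(\<Sum>b\<in>-{0,-1}. f b) = (\<Sum>b\<in>UNIV. f b) - f 0 - f (-1)" for f :: "'a \<Rightarrow> 'b"
    using split[of f] by (simp add: sum_Compl_0 algebra_simps)
  have "bridge x = (\<Sum>b\<in>-{0}. \<Sum>y\<in>-{0}. g b y)"
    unfolding bridge_def g_def by (rule sum.swap)
  also have "\<dots> = (\<Sum>y\<in>-{0}. g (-1) y) + (\<Sum>b\<in>-{0,-1}. \<Sum>y\<in>-{0}. g b y)" by (rule split)
  also have "(\<Sum>y\<in>-{0}. g (-1) y) = - (\<phi> x * \<phi> (-1))" by (rule m1)
  also have "(\<Sum>b\<in>-{0,-1}. \<Sum>y\<in>-{0}. g b y) = (\<Sum>b\<in>-{0,-1}. \<phi> b + (\<Sum>w\<in>-{0}. h w b))"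
    by (intro sum.cong refl inner) auto
  also have "\<dots> = - \<phi> (-1) + (\<Sum>w\<in>-{0}. \<Sum>b\<in>-{0,-1}. h w b)"
  proof -
    have "(\<Sum>b\<in>-{0,-1}. \<phi> b) = - \<phi> (-1)" by (simp add: neg sum_phi)
    moreover have "(\<Sum>b\<in>-{0,-1}. \<Sum>w\<in>-{0}. h w b) = (\<Sum>w\<in>-{0}. \<Sum>b\<in>-{0,-1}. h w b)" by (rule sum.swap)
    ultimately show ?thesis by (simp only: sum.distrib)
  qed
  also have "(\<Sum>w\<in>-{0}. \<Sum>b\<in>-{0,-1}. h w b) = (\<Sum>w\<in>-{0}. (\<Sum>b\<in>UNIV. h w b) - h w (-1))"
    by (intro sum.cong refl) (simp add: neg, simp add: h_def)
  also have "\<dots> = triple_shift x - (\<Sum>w\<in>-{0}. h w (-1))"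
    unfolding triple_shift_alt[OF x] by (simp add: sum_subtractf h_def sum_distrib_left mult.commute)
  \<comment> \<open>The column b = -1, included to complete the sum over b, is a correlation of phi
    with its translate by x - 1, so x = 1 is exceptional.\<close>
  also have "(\<Sum>w\<in>-{0}. h w (-1)) = \<phi> (-1) * ((\<Sum>w\<in>UNIV. \<phi> (w + 1) * \<phi> (w + x)) - \<phi> x)"
  proof -
    have "(\<Sum>w\<in>-{0}. h w (-1)) = (\<Sum>w\<in>-{0}. \<phi> (-1) * (\<phi> (w + 1) * \<phi> (w + x)))"
    proof (rule sum.cong[OF refl])
      fix w :: 'a assume "w \<in> -{0}"
      then have "(-1 * (w - - 1) * (w - 1 - - 1)) * (1 + x / w) = -1 * ((w + 1) * (w + x))"
        by (simp add: field_simps)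
      then show "h w (-1) = \<phi> (-1) * (\<phi> (w + 1) * \<phi> (w + x))"
        unfolding h_def phi_mult[symmetric] by simp
    qed
    also have "\<dots> = \<phi> (-1) * (\<Sum>w\<in>-{0}. \<phi> (w + 1) * \<phi> (w + x))" by (simp add: sum_distrib_left)
    finally show ?thesis by (simp add: sum_Compl_0)
  qed
  also have "(\<Sum>w\<in>UNIV. \<phi> (w + 1) * \<phi> (w + x)) = (if x = 1 then of_nat CARD('a) - 1 else - 1)"
    using sum_reindex_plus[of "\<lambda>w. \<phi> w * \<phi> (w + (x - 1))" 1] sum_phi_phi_plus[of "x - 1"] by (simp add: add.commute add.left_commute)
  finally show ?thesis by (cases "x = 1") (simp_all add: algebra_simps)
qed

text \<open>With w = 2 z v the inner sum correlates phi with its translate by 1 + z/2. Only z = -2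
  gives more than a multiple of phi(z), and those multiples sum to 0.\<close>

lemma sum_phi_pair_mean: "(\<Sum>w\<in>-{0}. \<phi> w * pair_mean w) = of_nat CARD('a) * \<phi> (-1)"
proof -
  have "(\<Sum>w\<in>-{0}. \<phi> w * pair_mean w) = (\<Sum>w\<in>-{0}. \<Sum>z\<in>-{0}. \<phi> w * \<phi> (1 + (z + w / z) / 2))"
    by (simp add: pair_mean_def sum_distrib_left)
  also have "\<dots> = (\<Sum>z\<in>-{0}. \<Sum>w\<in>-{0}. \<phi> w * \<phi> (1 + (z + w / z) / 2))" by (rule sum.swap)
  also have "\<dots> = (\<Sum>z\<in>-{0}. \<Sum>v\<in>-{0}. \<phi> (2 * z * v) * \<phi> (1 + (z + 2 * z * v / z) / 2))"
  proof (rule sum.cong[OF refl])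
    fix z :: 'a assume "z \<in> -{0}"
    then have "2 * z \<noteq> 0" using two_neq_0 by simp
    from sum_mult_reindex[OF this, of "\<lambda>w. \<phi> w * \<phi> (1 + (z + w / z) / 2)"]
    show "(\<Sum>w\<in>-{0}. \<phi> w * \<phi> (1 + (z + w / z) / 2)) = (\<Sum>v\<in>-{0}. \<phi> (2 * z * v) * \<phi> (1 + (z + 2 * z * v / z) / 2))"
      by simp
  qed
  also have "\<dots> = (\<Sum>z\<in>-{0}. \<phi> (2 * z) * (\<Sum>v\<in>UNIV. \<phi> v * \<phi> (v + (1 + z / 2))))"
  proof (rule sum.cong[OF refl])
    fix z :: 'a assume z: "z \<in> -{0}"
    have "(\<Sum>v\<in>-{0}. \<phi> (2 * z * v) * \<phi> (1 + (z + 2 * z * v / z) / 2)) = (\<Sum>v\<in>-{0}. \<phi> (2 * z) * (\<phi> v * \<phi> (v + (1 + z / 2))))"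
    proof (rule sum.cong[OF refl])
      fix v :: 'a
      have "2 * z * v / z = 2 * v" using z by simp
      then have "1 + (z + 2 * z * v / z) / 2 = v + (1 + z / 2)" using two_neq_0 by (simp add: add_divide_distrib)
      then show "\<phi> (2 * z * v) * \<phi> (1 + (z + 2 * z * v / z) / 2) = \<phi> (2 * z) * (\<phi> v * \<phi> (v + (1 + z / 2)))"
        by (simp only: phi_mult mult.assoc)
    qed
    then show "(\<Sum>v\<in>-{0}. \<phi> (2 * z * v) * \<phi> (1 + (z + 2 * z * v / z) / 2)) = \<phi> (2 * z) * (\<Sum>v\<in>UNIV. \<phi> v * \<phi> (v + (1 + z / 2)))"
      by (simp add: sum_Compl_0 sum_distrib_left[symmetric])
  qed
  also have "\<dots> = (\<Sum>z\<in>-{0}. (if z = -2 then of_nat CARD('a) * \<phi> (-1) else 0) - \<phi> 2 * \<phi> z)"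
  proof (rule sum.cong[OF refl])
    fix z :: 'a
    have "1 + z / 2 = 0 \<longleftrightarrow> z = -2" using two_neq_0 by (auto simp: field_simps eq_neg_iff_add_eq_0)
    moreover have "\<phi> (2 * -2) = \<phi> (-1)" using two_neq_0 by (intro phi_eqI[of _ _ 2]) auto
    then have "\<phi> 2 * \<phi> (-2) = \<phi> (-1)" by (simp only: phi_mult)
    ultimately show "\<phi> (2 * z) * (\<Sum>v\<in>UNIV. \<phi> v * \<phi> (v + (1 + z / 2))) =
      (if z = -2 then of_nat CARD('a) * \<phi> (-1) else 0) - \<phi> 2 * \<phi> z"
      unfolding sum_phi_phi_plus by (auto simp: algebra_simps phi_mult)
  qed
  also have "\<dots> = of_nat CARD('a) * \<phi> (-1)"
    using two_neq_0 by (simp add: sum_subtractf sum_distrib_left[symmetric] sum_phi_nonzero)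
  finally show ?thesis .
qed

text \<open>Since phi is multiplicative, summing against it splits the convolution into the product
  of the sums for its two factors.\<close>

lemma sum_phi_triple_mean: "(\<Sum>u\<in>-{0}. \<phi> u * triple_mean u) = - (of_nat CARD('a) * \<phi> (-1))"
proof -
  have "(\<Sum>u\<in>-{0}. \<phi> u * triple_mean u) = (\<Sum>u\<in>-{0}. \<Sum>y\<in>-{0}. \<phi> u * (shift y * pair_mean (u / y)))"
    by (simp add: triple_mean_def conv_def sum_distrib_left)
  also have "\<dots> = (\<Sum>y\<in>-{0}. \<Sum>u\<in>-{0}. \<phi> u * (shift y * pair_mean (u / y)))" by (rule sum.swap)
  also have "\<dots> = (\<Sum>y\<in>-{0}. (\<phi> y * shift y) * (\<Sum>w\<in>-{0}. \<phi> w * pair_mean w))"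
  proof (rule sum.cong[OF refl])
    fix y :: 'a assume y: "y \<in> -{0}"
    then have "(\<Sum>u\<in>-{0}. \<phi> u * (shift y * pair_mean (u / y))) = (\<Sum>w\<in>-{0}. \<phi> (y * w) * (shift y * pair_mean (y * w / y)))"
      by (intro sum_mult_reindex[symmetric]) simp
    also have "\<dots> = (\<Sum>w\<in>-{0}. (\<phi> y * shift y) * (\<phi> w * pair_mean w))"
      using y by (intro sum.cong) (auto simp: phi_mult)
    finally show "(\<Sum>u\<in>-{0}. \<phi> u * (shift y * pair_mean (u / y))) = (\<phi> y * shift y) * (\<Sum>w\<in>-{0}. \<phi> w * pair_mean w)"
      by (simp add: sum_distrib_left)
  qed
  also have "\<dots> = (\<Sum>y\<in>-{0}. \<phi> y * shift y) * (of_nat CARD('a) * \<phi> (-1))"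
    by (simp add: sum_phi_pair_mean sum_distrib_right)
  also have "(\<Sum>y\<in>-{0}. \<phi> y * shift y) = -1"
    using sum_phi_phi_plus[of 1] by (simp add: sum_Compl_0 shift_def add.commute)
  finally show ?thesis by simp
qed

lemma conv_shift_1: "conv shift f 1 = (\<Sum>x\<in>-{0}. \<phi> x * \<phi> (1 + x) * f x)"
proof -
  have "conv shift f 1 = (\<Sum>x\<in>-{0}. shift (1 / x) * f x)"
    unfolding conv_def by (rule sum.reindex_bij_witness[of _ "\<lambda>x. 1 / x" "\<lambda>x. 1 / x"]) auto
  also have "\<dots> = (\<Sum>x\<in>-{0}. \<phi> x * \<phi> (1 + x) * f x)"
  proof (rule sum.cong[OF refl])
    fix x :: 'a assume "x \<in> -{0}"
    then have "\<phi> (1 + 1 / x) = \<phi> (x * (1 + x))"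
      by (intro phi_eqI[of _ _ "1 / x"]) (auto simp: field_simps power2_eq_square)
    then show "shift (1 / x) * f x = \<phi> x * \<phi> (1 + x) * f x" by (simp add: shift_def phi_mult)
  qed
  finally show ?thesis .
qed

text \<open>On X the two sides agree term by term through \<open>bridge\<close>; the terms linear in
  the field size come from the omitted points and from counting v by its square.\<close>

theorem conv_triple_mean_eq_conv_triple_shift:
  "conv shift triple_mean 1 + \<phi> 2 * of_nat CARD('a) = \<phi> (-1) * (conv shift triple_shift 1 + of_nat CARD('a))"
proof -
  let ?q = "of_nat CARD('a) :: 'b"
  \<comment> \<open>The involution m below exchanges 0 and 1 and has its pole at -1, so X is stable
    under it.\<close>
  define X where "X = -{0, 1, -1 :: 'a}"
  have neq: "1 \<noteq> (-1 :: 'a)" using two_neq_0 by (metis add.right_inverse one_add_one)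
  have m1: "\<phi> (-1) * \<phi> (-1) = 1" by (rule phi_mult_self) simp
  have split: "(\<Sum>x\<in>-{0}. f x) = f 1 + f (-1) + (\<Sum>x\<in>X. f x)" for f :: "'a \<Rightarrow> 'b"
  proof -
    have "-{0} = insert 1 (insert (-1) X)" by (auto simp: X_def)
    then show ?thesis using neq by (simp add: X_def add.assoc)
  qed
  \<comment> \<open>x = 1 corresponds to v = 0 and u = -1. It needs separate treatment because
    \<open>bridge\<close> and \<open>triple_shift\<close> differ there.\<close>
  have B1: "triple_mean (-1) = \<phi> 2 * (triple_shift 1 - ?q * \<phi> (-1))"
  proof -
    have "- 4 * 1 / (1 + 1) ^ 2 = (-1 :: 'a)" using four_neq_0 by (simp add: power2_eq_square)
    then have "bridge 1 = \<phi> 2 * triple_mean (-1)" using bridge_eq_triple_mean[OF neq] by simp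
    moreover have "\<phi> 2 * \<phi> 2 = 1" by (rule phi_mult_self[OF two_neq_0])
    ultimately have "triple_mean (-1) = \<phi> 2 * bridge 1" by (simp flip: mult.assoc)
    then show ?thesis using bridge_eq_triple_shift[of 1] by simp
  qed
  \<comment> \<open>Chosen so that -4x/(1 + x)^2 becomes v^2 - 1 for x = m v, which opens the way to
    \<open>sum_square_fibres\<close>.\<close>
  define m where "m v = (1 - v) / (1 + v)" for v :: 'a
  have m: "1 + v \<noteq> 0" "1 + m v = 2 / (1 + v)" "m (m v) = v" "m v \<in> X" if "v \<in> X" for v
  proof -
    have v: "v \<noteq> 0" "v \<noteq> 1" "v \<noteq> -1" using that by (auto simp: X_def)
    then show v1: "1 + v \<noteq> 0" by (metis add.commute add_eq_0_iff)
    show m1: "1 + m v = 2 / (1 + v)" unfolding m_def using v1 by (simp add: field_simps)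
    have m2: "1 - m v = 2 * v / (1 + v)" unfolding m_def using v1 by (simp add: field_simps)
    show "m (m v) = v" unfolding m_def[of "m v"] m1 m2 using v1 two_neq_0 by simp
    have "1 + m v \<noteq> 0" "1 - m v \<noteq> 0" unfolding m1 m2 using v v1 two_neq_0 by auto
    moreover have "m v \<noteq> 0" using v v1 by (simp add: m_def)
    ultimately show "m v \<in> X" by (auto simp: X_def)
  qed
  have "(\<Sum>v\<in>X. \<phi> (v ^ 2 - 1) * triple_mean (v ^ 2 - 1)) = (\<Sum>x\<in>X. \<phi> (-1) * (\<phi> x * \<phi> (1 + x) * triple_shift x))"
  proof (rule sum.reindex_bij_witness[of _ m m])
    fix v assume v: "v \<in> X"
    define x where "x = m v"
    have v1: "1 + v \<noteq> 0" and x1: "1 + x = 2 / (1 + v)" and xX: "x \<in> X" using m[OF v] by (simp_all add: x_def)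
    then have n: "1 + x \<noteq> 0" using two_neq_0 by simp
    have xv: "x * (1 + v) = 1 - v" using v1 by (simp add: x_def m_def)
    have x: "x \<noteq> 0" "x \<noteq> 1" "x \<noteq> -1" using xX by (auto simp: X_def)
    have "- 4 * (a / c) / (2 / c) ^ 2 = - (a * c)" if "c \<noteq> 0" for a c :: 'a
      using that four_neq_0 by (simp add: power2_eq_square)
    from this[OF v1, of "1 - v"] have u: "- 4 * x / (1 + x) ^ 2 = v ^ 2 - 1"
      unfolding x1 by (simp add: x_def m_def algebra_simps power2_eq_square)
    have "(-1 * x) * (1 + v) ^ 2 = - ((x * (1 + v)) * (1 + v))" by (simp add: power2_eq_square)
    also have "\<dots> = v ^ 2 - 1" unfolding xv by (simp add: power2_eq_square algebra_simps)
    finally have "\<phi> (v ^ 2 - 1) = \<phi> (-1 * x)" using phi_eqI[OF _ v1] by metis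
    then have p: "\<phi> (v ^ 2 - 1) = \<phi> (-1) * \<phi> x" by (simp only: phi_mult)
    have "bridge x = \<phi> (1 + x) * triple_mean (v ^ 2 - 1)" using bridge_eq_triple_mean[of x] x(3) u by simp
    then have "\<phi> (1 + x) * bridge x = triple_mean (v ^ 2 - 1)"
      using phi_mult_self[OF n] by (simp flip: mult.assoc)
    moreover have "bridge x = triple_shift x" using bridge_eq_triple_shift[OF x(1)] x(2) by simp
    ultimately show "\<phi> (-1) * (\<phi> (m v) * \<phi> (1 + m v) * triple_shift (m v)) = \<phi> (v ^ 2 - 1) * triple_mean (v ^ 2 - 1)"
      unfolding x_def[symmetric] p by (simp add: mult.assoc)
  qed (auto simp: m)
  also have "\<dots> = \<phi> (-1) * (conv shift triple_shift 1 - \<phi> 2 * triple_shift 1)"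
    using split[of "\<lambda>x. \<phi> x * \<phi> (1 + x) * triple_shift x"] by (simp add: conv_shift_1 sum_distrib_left)
  finally have L: "(\<Sum>v\<in>X. \<phi> (v ^ 2 - 1) * triple_mean (v ^ 2 - 1)) = \<dots>" .
  define g where "g u = \<phi> u * triple_mean u" for u
  \<comment> \<open>v = 0 gives u = -1, while v = 1 and v = -1 give u = 0, where g vanishes.\<close>
  have "(\<Sum>v\<in>UNIV. g (v ^ 2 - 1)) = g (-1) + (\<Sum>v\<in>X. g (v ^ 2 - 1))"
  proof -
    have "g 0 = 0" by (simp add: g_def)
    then show ?thesis using sum_Compl_0[of "\<lambda>v. g (v ^ 2 - 1)"] split[of "\<lambda>v. g (v ^ 2 - 1)"]
      by (simp add: diff_eq_eq add.commute)
  qed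
  moreover have "(\<Sum>v\<in>UNIV. g (v ^ 2 - 1)) = (\<Sum>t\<in>UNIV. (1 + \<phi> t) * g (t - 1))"
    by (rule sum_square_fibres[of "\<lambda>t. g (t - 1)"])
  moreover have "\<dots> = (\<Sum>u\<in>UNIV. (1 + \<phi> (1 + u)) * g u)"
    using sum_reindex_plus[of "\<lambda>t. (1 + \<phi> t) * g (t - 1)" 1] by (simp add: add.commute)
  moreover have "\<dots> = (\<Sum>u\<in>-{0}. g u) + conv shift triple_mean 1"
  proof -
    have "(\<Sum>u\<in>UNIV. (1 + \<phi> (1 + u)) * g u) = (\<Sum>u\<in>-{0}. (1 + \<phi> (1 + u)) * g u)"
      by (simp add: sum_Compl_0 g_def)
    also have "\<dots> = (\<Sum>u\<in>-{0}. g u) + (\<Sum>u\<in>-{0}. \<phi> (1 + u) * g u)"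
      by (simp only: distrib_right mult_1_left sum.distrib)
    also have "(\<Sum>u\<in>-{0}. \<phi> (1 + u) * g u) = conv shift triple_mean 1"
      unfolding conv_shift_1 g_def by (intro sum.cong) (simp_all only: mult_ac)
    finally show ?thesis .
  qed
  ultimately have "g (-1) + (\<Sum>v\<in>X. g (v ^ 2 - 1)) = - (?q * \<phi> (-1)) + conv shift triple_mean 1"
    using sum_phi_triple_mean by (simp add: g_def)
  then have "conv shift triple_mean 1 = ?q * \<phi> (-1) + \<phi> (-1) * (\<phi> 2 * (triple_shift 1 - ?q * \<phi> (-1))) +
      \<phi> (-1) * (conv shift triple_shift 1 - \<phi> 2 * triple_shift 1)"
    using L B1 by (simp add: g_def algebra_simps)
  moreover have "\<phi> (-1) * (\<phi> (-1) * z) = z" for z using m1 by (simp flip: mult.assoc)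
  ultimately show ?thesis by (simp add: algebra_simps)
qed

end

section \<open>Mellin transforms\<close>

definition mellin :: "('p::prime_card mod_ring \<Rightarrow> 'p padic) \<Rightarrow> nat \<Rightarrow> 'p padic" where
  "mellin f j = (\<Sum>x\<in>-{0}. teichmueller_bar x ^ j * f x)"

lemma teichmueller_bar_mult: "teichmueller_bar (x * y) = teichmueller_bar x * teichmueller_bar (y :: 'p::prime_card mod_ring)"
  by (simp add: teichmueller_bar_def teichmueller_mult)

lemma teichmueller_bar_eq: "teichmueller_bar x = teichmueller (inverse (x :: 'p::prime_card mod_ring))"
  by (simp add: teichmueller_bar_def teichmueller_inverse)

lemma teichmueller_bar_power_mod:
  "(x :: 'p::prime_card mod_ring) \<noteq> 0 \<Longrightarrow> teichmueller_bar x ^ (k mod (CARD('p) - 1)) = teichmueller_bar x ^ k"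
  unfolding teichmueller_bar_eq by (rule teichmueller_power_mod) simp

lemma mellin_mod: "mellin f (j mod (CARD('p) - 1)) = mellin (f :: 'p::prime_card mod_ring \<Rightarrow> 'p padic) j"
  unfolding mellin_def by (intro sum.cong refl) (simp add: teichmueller_bar_power_mod del: One_nat_def)

lemma mellin_conv: "mellin (conv f g) j = mellin f j * mellin g j"
proof -
  have "mellin (conv f g) j = (\<Sum>x\<in>-{0}. \<Sum>y\<in>-{0}. teichmueller_bar x ^ j * (f y * g (x / y)))"
    by (simp add: mellin_def conv_def sum_distrib_left)
  also have "\<dots> = (\<Sum>y\<in>-{0}. \<Sum>x\<in>-{0}. teichmueller_bar x ^ j * (f y * g (x / y)))" by (rule sum.swap)
  also have "\<dots> = (\<Sum>y\<in>-{0}. \<Sum>z\<in>-{0}. (teichmueller_bar y ^ j * f y) * (teichmueller_bar z ^ j * g z))"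
  proof (rule sum.cong[OF refl])
    fix y :: "'a mod_ring" assume y: "y \<in> -{0}"
    then have "(\<Sum>x\<in>-{0}. teichmueller_bar x ^ j * (f y * g (x / y))) =
        (\<Sum>z\<in>-{0}. teichmueller_bar (y * z) ^ j * (f y * g (y * z / y)))"
      by (intro sum_mult_reindex[symmetric]) simp
    also have "\<dots> = (\<Sum>z\<in>-{0}. (teichmueller_bar y ^ j * f y) * (teichmueller_bar z ^ j * g z))"
      using y by (intro sum.cong) (auto simp: teichmueller_bar_mult power_mult_distrib)
    finally show "(\<Sum>x\<in>-{0}. teichmueller_bar x ^ j * (f y * g (x / y))) = \<dots>" .
  qed
  finally show ?thesis by (simp add: mellin_def sum_product)
qed

text \<open>Orthogonality in j isolates x = 1. This Fourier inversion turns hypergeometric sums at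
  argument 1 into values of convolutions.\<close>

lemma sum_mellin: "(\<Sum>j<CARD('p) - 1. mellin f j) = of_nat (CARD('p) - 1) * f (1 :: 'p::prime_card mod_ring)"
proof -
  have "(\<Sum>j<CARD('p) - 1. mellin f j) = (\<Sum>x\<in>-{0}. \<Sum>j<CARD('p) - 1. teichmueller_bar x ^ j * f x)"
    unfolding mellin_def by (rule sum.swap)
  also have "\<dots> = (\<Sum>x\<in>-{0 :: 'p mod_ring}. if x = 1 then of_nat (CARD('p) - 1) * f x else 0)"
  proof (rule sum.cong[OF refl])
    fix x :: "'p mod_ring" assume "x \<in> -{0}"
    then have "(\<Sum>j<CARD('p) - 1. teichmueller_bar x ^ j) = (if inverse x = 1 then of_nat (CARD('p) - 1) else 0)"
      unfolding teichmueller_bar_eq by (intro sum_power_teichmueller_exponents) simp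
    then show "(\<Sum>j<CARD('p) - 1. teichmueller_bar x ^ j * f x) = (if x = 1 then of_nat (CARD('p) - 1) * f x else 0)"
      unfolding sum_distrib_right[symmetric] by simp
  qed
  finally show ?thesis by simp
qed

context
  assumes odd_p: "odd CARD('p::prime_card)"
begin

lemma two_neq_0_mod_ring: "(2 :: 'p mod_ring) \<noteq> 0"
proof
  assume "(2 :: 'p mod_ring) = 0"
  then have "CARD('p) dvd 2" using of_nat_0_mod_ring_dvd[of 2, where ?'a = 'p] by simp
  then have "CARD('p) \<le> 2" by (rule dvd_imp_le) simp
  then show False using odd_prime_card_ge_3[OF odd_p] by simp
qed

lemma half_card: "2 * ((CARD('p) - 1) div 2) = CARD('p) - 1" "0 < (CARD('p) - 1) div 2"
  "(CARD('p) - 1) div 2 < CARD('p) - 1"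
proof -
  show e: "2 * ((CARD('p) - 1) div 2) = CARD('p) - 1" using odd_p by simp
  then show "0 < (CARD('p) - 1) div 2" "(CARD('p) - 1) div 2 < CARD('p) - 1"
    using odd_prime_card_ge_3[OF odd_p] by linarith+
qed

text \<open>Square roots of d are detected by averaging omega(x^2/d)^j over j. Summing over x first
  leaves only j = 0 and j = (p - 1)/2, which contribute 1 and the character value.\<close>

lemma quadratic_character_teichmueller:
  "quadratic_character (\<lambda>x :: 'p mod_ring. teichmueller x ^ ((CARD('p) - 1) div 2))"
proof
  let ?Q = "CARD('p) - 1" and ?m = "(CARD('p) - 1) div 2"
  note m = half_card
  show "teichmueller (0 :: 'p mod_ring) ^ ?m = 0" using m(2) by (simp del: One_nat_def)
  show "teichmueller (x * y) ^ ?m = teichmueller x ^ ?m * teichmueller y ^ ?m" for x y :: "'p mod_ring"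
    by (simp add: teichmueller_mult power_mult_distrib)
  show "(2 :: 'p mod_ring) \<noteq> 0" by (rule two_neq_0_mod_ring)
  show "of_nat (card {x. x ^ 2 = d}) = 1 + teichmueller d ^ ?m" for d :: "'p mod_ring"
  proof (cases "d = 0")
    case True
    then show ?thesis using m(2) by (simp del: One_nat_def)
  next
    case False
    note Q0 = of_nat_card_minus_1_neq_0[where ?'p = 'p and ?'q = 'p]
    have "of_nat ?Q * of_nat (card {x. x ^ 2 = d}) = (\<Sum>x\<in>{x. x ^ 2 = d}. of_nat ?Q :: 'p padic)" by simp
    also have "\<dots> = (\<Sum>x\<in>-{0}. \<Sum>j<?Q. teichmueller (inverse d * x ^ 2) ^ j)"
    proof (rule sum.mono_neutral_cong_left)
      have *: "(\<Sum>j<?Q. teichmueller (inverse d * x ^ 2) ^ j) = (if x ^ 2 = d then of_nat ?Q else 0)" if "x \<noteq> 0" for x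
        using that False sum_power_teichmueller_exponents[of "inverse d * x ^ 2"] by (simp add: field_simps del: One_nat_def)
      show "{x. x ^ 2 = d} \<subseteq> -{0}" using False by auto
      then show "of_nat ?Q = (\<Sum>j<?Q. teichmueller (inverse d * x ^ 2) ^ j)" if "x \<in> {x. x ^ 2 = d}" for x
        using * that by auto
      show "\<forall>x\<in>-{0} - {x. x ^ 2 = d}. (\<Sum>j<?Q. teichmueller (inverse d * x ^ 2) ^ j) = 0" using * by auto
    qed simp
    also have "\<dots> = (\<Sum>j<?Q. \<Sum>x\<in>-{0}. teichmueller (inverse d * x ^ 2) ^ j)" by (rule sum.swap)
    also have "\<dots> = (\<Sum>j<?Q. teichmueller (inverse d) ^ j * (\<Sum>x\<in>-{0 :: 'p mod_ring}. teichmueller x ^ (2 * j)))"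
      by (simp add: teichmueller_mult teichmueller_power power_mult_distrib sum_distrib_left power_mult)
    also have "\<dots> = (\<Sum>j<?Q. teichmueller (inverse d) ^ j * (if ?Q dvd 2 * j then of_nat ?Q else 0))"
      unfolding sum_teichmueller_power ..
    also have "\<dots> = (\<Sum>j\<in>{0, ?m}. teichmueller (inverse d) ^ j * of_nat ?Q)"
    proof (rule sum.mono_neutral_cong_right)
      show "{0, ?m} \<subseteq> {..<?Q}" using m by auto
      show "teichmueller (inverse d) ^ j * (if ?Q dvd 2 * j then of_nat ?Q else 0) = teichmueller (inverse d) ^ j * of_nat ?Q"
        if "j \<in> {0, ?m}" for j using that m(1) by (elim insertE) (simp_all del: One_nat_def)
      show "\<forall>j\<in>{..<?Q} - {0, ?m}. teichmueller (inverse d) ^ j * (if ?Q dvd 2 * j then of_nat ?Q else 0) = 0"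
      proof
        fix j assume j: "j \<in> {..<?Q} - {0, ?m}"
        have "\<not> ?Q dvd 2 * j"
        proof
          assume "?Q dvd 2 * j"
          then obtain k where k: "2 * j = ?Q * k" by (elim dvdE)
          moreover have "2 * j < ?Q * 2" using j by auto
          ultimately have "?Q * k < ?Q * 2" by simp
          then have "k < 2" by (simp only: mult_less_cancel1)
          then have "k = 0 \<or> k = 1" by auto
          then show False using k j m(1) by auto
        qed
        then show "teichmueller (inverse d) ^ j * (if ?Q dvd 2 * j then of_nat ?Q else 0) = 0" by simp
      qed
    qed simp
    also have "\<dots> = of_nat ?Q * (1 + teichmueller (inverse d) ^ ?m)" using m(2) by (simp add: algebra_simps del: One_nat_def of_nat_diff)
    finally have "of_nat (card {x. x ^ 2 = d}) = 1 + teichmueller (inverse d) ^ ?m"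
      using Q0 by (simp only: mult_cancel_left) simp
    moreover have "(teichmueller d ^ ?m) * (teichmueller d ^ ?m) = 1"
      using teichmueller_power_card_minus_1[OF False] m(1) by (simp only: power_add[symmetric] mult_2[symmetric])
    then have "inverse (teichmueller d ^ ?m) = teichmueller d ^ ?m" by (rule inverse_unique)
    ultimately show ?thesis by (simp add: teichmueller_inverse power_inverse)
  qed
qed

definition phi :: "'p mod_ring \<Rightarrow> 'p padic" where
  "phi x = teichmueller x ^ ((CARD('p) - 1) div 2)"

lemma phi_quadratic: "quadratic_character phi"
  using quadratic_character_teichmueller unfolding phi_def[abs_def] .

lemma phi_eq_bar: "phi x = teichmueller_bar x ^ ((CARD('p) - 1) div 2)" if "x \<noteq> 0"
proof -
  interpret quadratic_character phi by (rule phi_quadratic)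
  have "inverse (phi x) = phi x" by (rule inverse_unique[OF phi_mult_self[OF that]])
  then show ?thesis by (simp add: phi_def teichmueller_bar_def power_inverse)
qed

section \<open>The factors of the hypergeometric sum\<close>

text \<open>With t = y/(1 + y) one has 1 - t = 1/(1 + y), so the power of omega(1 + y) can be
  distributed over the two Jacobi characters. The second exponent is reduced modulo p - 1 to fit the
  range of Gross-Koblitz.\<close>

lemma mellin_shift_jacobi:
  assumes j: "j < CARD('p) - 1"
  shows "mellin (quadratic_character.shift phi) j =
    jacobi j (((CARD('p) - 1) div 2 + (CARD('p) - 1) - j) mod (CARD('p) - 1))"
proof -
  interpret quadratic_character phi by (rule phi_quadratic)
  let ?Q = "CARD('p) - 1" and ?m = "(CARD('p) - 1) div 2"
  let ?\<chi> = "teichmueller_bar :: 'p mod_ring \<Rightarrow> 'p padic"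
  have "mellin shift j = (\<Sum>y\<in>-{0,-1}. ?\<chi> y ^ j * phi (1 + y))"
    unfolding mellin_def shift_def by (rule sum.mono_neutral_right) auto
  also have "\<dots> = (\<Sum>t\<in>-{0,1}. ?\<chi> t ^ j * ?\<chi> (1 - t) ^ ((?m + ?Q - j) mod ?Q))"
  proof (rule sum.reindex_bij_witness[of _ "\<lambda>t. t / (1 - t)" "\<lambda>y. y / (1 + y)"])
    fix y :: "'p mod_ring" assume y: "y \<in> -{0,-1}"
    then have y1: "1 + y \<noteq> 0" by (metis ComplD add.commute add_eq_0_iff insert_iff)
    have e: "1 - y / (1 + y) = 1 / (1 + y)" using y1 by (simp add: field_simps)
    show "y / (1 + y) / (1 - y / (1 + y)) = y" unfolding e using y1 by simp
    have "y / (1 + y) \<noteq> 1" using e y1 by auto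
    then show "y / (1 + y) \<in> -{0,1}" using y y1 by auto
    have bar: "?\<chi> (1 / (1 + y)) ^ ((?m + ?Q - j) mod ?Q) = teichmueller (1 + y) ^ (?m + (?Q - j))"
      using y1 j by (subst teichmueller_bar_power_mod) (simp_all add: teichmueller_bar_eq del: One_nat_def)
    have "?\<chi> (y / (1 + y)) ^ j = ?\<chi> y ^ j * teichmueller (1 + y) ^ j"
      by (simp add: teichmueller_bar_eq teichmueller_mult divide_inverse power_mult_distrib)
    then have "?\<chi> (y / (1 + y)) ^ j * ?\<chi> (1 / (1 + y)) ^ ((?m + ?Q - j) mod ?Q) =
        ?\<chi> y ^ j * (teichmueller (1 + y) ^ j * teichmueller (1 + y) ^ (?m + (?Q - j)))"
      unfolding bar by (simp only: mult.assoc)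
    also have "teichmueller (1 + y) ^ j * teichmueller (1 + y) ^ (?m + (?Q - j)) = teichmueller (1 + y) ^ (?m + ?Q)"
      unfolding power_add[symmetric] using j by (intro arg_cong[of _ _ "\<lambda>k. _ ^ k"]) linarith
    also have "\<dots> = phi (1 + y)"
      unfolding power_add teichmueller_power_card_minus_1[OF y1] by (simp add: phi_def)
    finally show "?\<chi> (y / (1 + y)) ^ j * ?\<chi> (1 - y / (1 + y)) ^ ((?m + ?Q - j) mod ?Q) = ?\<chi> y ^ j * phi (1 + y)"
      unfolding e .
  next
    fix t :: "'p mod_ring" assume t: "t \<in> -{0,1}"
    then have t1: "1 - t \<noteq> 0" by auto
    have e: "1 + t / (1 - t) = 1 / (1 - t)" using t1 by (simp add: field_simps)
    show "t / (1 - t) / (1 + t / (1 - t)) = t" unfolding e using t1 by simp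
    have "1 + t / (1 - t) \<noteq> 0" unfolding e using t1 by simp
    then have "t / (1 - t) \<noteq> -1" by auto
    then show "t / (1 - t) \<in> -{0,-1}" using t t1 by auto
  qed
  finally show ?thesis by (simp add: jacobi_def)
qed

text \<open>k complements j to the quadratic exponent and e is the carry. As (p - 1)/2 is not 0
  modulo p - 1, Gross-Koblitz covers every j.\<close>

lemma mellin_shift:
  assumes j: "j < CARD('p) - 1" and k: "k < CARD('p) - 1"
    and jk: "j + k = (CARD('p) - 1) div 2 + (CARD('p) - 1) * e"
  shows "mellin (quadratic_character.shift phi) j =
    - ((- of_nat CARD('p)) ^ e * Gamma_frac j * Gamma_frac k / Gamma_frac ((CARD('p) - 1) div 2))"
proof -
  let ?Q = "CARD('p) - 1" and ?m = "(CARD('p) - 1) div 2"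
  have "?m + ?Q * e + ?Q = (?m + ?Q - j) + ?Q * e + j" using j by linarith
  then have "k + ?Q = (?m + ?Q - j) + ?Q * e" using jk by linarith
  then have "(k + ?Q) mod ?Q = ((?m + ?Q - j) + ?Q * e) mod ?Q" by simp
  then have k': "(?m + ?Q - j) mod ?Q = k" using k by (simp only: mod_mult_self2 mod_add_self2 mod_less)
  have d: "(j + k) div ?Q = e" "(j + k) mod ?Q = ?m" unfolding jk using half_card(3)
    by (simp_all only: div_mult_self2 div_less mod_mult_self2 mod_less add_0_left add_0_right)
  have "mellin (quadratic_character.shift phi) j = jacobi j k"
    unfolding mellin_shift_jacobi[OF j] k' ..
  also have "\<dots> = - ((- of_nat CARD('p)) ^ e * Gamma_frac j * Gamma_frac k / Gamma_frac ?m)"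
    using gross_koblitz_jacobi[OF odd_p j k] half_card(2) unfolding d by linarith
  finally show ?thesis .
qed

text \<open>Writing z = 2x and w = 4xy turns the half sum into x + y. The variables x + y and t =
  x/(x + y) then separate the double sum into a Jacobi sum and a Mellin transform of
  \<open>shift\<close>.\<close>

lemma mellin_pair_mean_jacobi:
  assumes j: "\<not> (CARD('p) - 1) dvd 2 * j"
  shows "mellin (quadratic_character.pair_mean phi) j =
    teichmueller_bar 2 ^ (2 * j) * jacobi j j * mellin (quadratic_character.shift phi) (2 * j)"
proof -
  interpret quadratic_character phi by (rule phi_quadratic)
  let ?\<chi> = "teichmueller_bar :: 'p mod_ring \<Rightarrow> 'p padic"
  define c where "c = ?\<chi> 2 ^ j"
  have "mellin pair_mean j = (\<Sum>w\<in>-{0}. \<Sum>z\<in>-{0}. ?\<chi> w ^ j * phi (1 + (z + w / z) / 2))"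
    by (simp add: mellin_def pair_mean_def sum_distrib_left)
  also have "\<dots> = (\<Sum>z\<in>-{0}. \<Sum>w\<in>-{0}. ?\<chi> w ^ j * phi (1 + (z + w / z) / 2))" by (rule sum.swap)
  also have "\<dots> = (\<Sum>z\<in>-{0}. \<Sum>y\<in>-{0}. (c * ?\<chi> z ^ j) * (?\<chi> y ^ j * phi (1 + z / 2 + y)))"
  proof (rule sum.cong[OF refl])
    fix z :: "'p mod_ring" assume z: "z \<in> -{0}"
    then have "2 * z \<noteq> 0" using two_neq_0 by simp
    then have "(\<Sum>w\<in>-{0}. ?\<chi> w ^ j * phi (1 + (z + w / z) / 2)) =
        (\<Sum>y\<in>-{0}. ?\<chi> (2 * z * y) ^ j * phi (1 + (z + 2 * z * y / z) / 2))"
      by (rule sum_mult_reindex[symmetric])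
    also have "\<dots> = (\<Sum>y\<in>-{0}. (c * ?\<chi> z ^ j) * (?\<chi> y ^ j * phi (1 + z / 2 + y)))"
    proof (rule sum.cong[OF refl])
      fix y :: "'p mod_ring"
      have "2 * z * y / z = 2 * y" using z by simp
      then have "1 + (z + 2 * z * y / z) / 2 = 1 + z / 2 + y" using two_neq_0 by (simp add: add_divide_distrib)
      then show "?\<chi> (2 * z * y) ^ j * phi (1 + (z + 2 * z * y / z) / 2) = (c * ?\<chi> z ^ j) * (?\<chi> y ^ j * phi (1 + z / 2 + y))"
        by (simp only: teichmueller_bar_mult power_mult_distrib c_def mult.assoc)
    qed
    finally show "(\<Sum>w\<in>-{0}. ?\<chi> w ^ j * phi (1 + (z + w / z) / 2)) = \<dots>" .
  qed
  also have "\<dots> = (\<Sum>x\<in>-{0}. \<Sum>y\<in>-{0}. (c * c) * (?\<chi> x ^ j * ?\<chi> y ^ j * phi (1 + (x + y))))"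
  proof -
    have "(\<Sum>z\<in>-{0}. \<Sum>y\<in>-{0}. (c * ?\<chi> z ^ j) * (?\<chi> y ^ j * phi (1 + z / 2 + y))) =
        (\<Sum>x\<in>-{0}. \<Sum>y\<in>-{0}. (c * ?\<chi> (2 * x) ^ j) * (?\<chi> y ^ j * phi (1 + 2 * x / 2 + y)))"
      by (rule sum_mult_reindex[OF two_neq_0, symmetric])
    also have "\<dots> = (\<Sum>x\<in>-{0}. \<Sum>y\<in>-{0}. (c * c) * (?\<chi> x ^ j * ?\<chi> y ^ j * phi (1 + (x + y))))"
    proof (intro sum.cong refl)
      fix x y :: "'p mod_ring"
      have "1 + 2 * x / 2 + y = 1 + (x + y)" using two_neq_0 by simp
      then show "(c * ?\<chi> (2 * x) ^ j) * (?\<chi> y ^ j * phi (1 + 2 * x / 2 + y)) = (c * c) * (?\<chi> x ^ j * ?\<chi> y ^ j * phi (1 + (x + y)))"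
        by (simp only: teichmueller_bar_mult power_mult_distrib c_def mult_ac)
    qed
    finally show ?thesis .
  qed
  also have "\<dots> = (c * c) * (\<Sum>x\<in>-{0}. \<Sum>y\<in>-{0}. ?\<chi> x ^ j * ?\<chi> y ^ j * phi (1 + (x + y)))"
    by (simp add: sum_distrib_left)
  also have "(\<Sum>x\<in>-{0}. \<Sum>y\<in>-{0}. ?\<chi> x ^ j * ?\<chi> y ^ j * phi (1 + (x + y))) =
      jacobi j j * mellin shift (2 * j)"
  proof -
    \<comment> \<open>The term with x + y = 0 is split off. It is a multiple of the character power
      2j at x, whose sum over x vanishes by the assumption on j.\<close>
    have x: "(\<Sum>y\<in>-{0}. ?\<chi> x ^ j * ?\<chi> y ^ j * phi (1 + (x + y))) =
        ?\<chi> (-1) ^ j * ?\<chi> x ^ (2 * j) + (\<Sum>t\<in>-{0,1}. (?\<chi> t ^ j * ?\<chi> (1 - t) ^ j) * (?\<chi> (x / t) ^ (2 * j) * phi (1 + x / t)))"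
      if x0: "x \<in> -{0}" for x
    proof -
      have "- x \<in> -{0}" using x0 by simp
      then have "-{0} = insert (- x) (-{0, - x})" by auto
      then have "(\<Sum>y\<in>-{0}. ?\<chi> x ^ j * ?\<chi> y ^ j * phi (1 + (x + y))) =
        ?\<chi> x ^ j * ?\<chi> (- x) ^ j * phi (1 + (x + - x)) + (\<Sum>y\<in>-{0, - x}. ?\<chi> x ^ j * ?\<chi> y ^ j * phi (1 + (x + y)))"
        by simp
      moreover have "?\<chi> x ^ j * ?\<chi> (- x) ^ j * phi (1 + (x + - x)) = ?\<chi> (-1) ^ j * ?\<chi> x ^ (2 * j)"
        using teichmueller_bar_mult[of "-1" x] by (simp add: power_mult_distrib power_mult power2_eq_square power_mult_distrib)
      moreover have "(\<Sum>y\<in>-{0, - x}. ?\<chi> x ^ j * ?\<chi> y ^ j * phi (1 + (x + y))) =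
        (\<Sum>t\<in>-{0,1}. (?\<chi> t ^ j * ?\<chi> (1 - t) ^ j) * (?\<chi> (x / t) ^ (2 * j) * phi (1 + x / t)))"
      proof (rule sum.reindex_bij_witness[of _ "\<lambda>t. x / t - x" "\<lambda>y. x / (x + y)"])
        fix y assume y: "y \<in> -{0, - x}"
        then have xy: "x + y \<noteq> 0" by (auto simp: add_eq_0_iff)
        have x': "x \<noteq> 0" using x0 by simp
        show "x / (x / (x + y)) - x = y" using xy x' by simp
        show "x / (x + y) \<in> -{0,1}" using xy x' y by auto
        define t where "t = x / (x + y)"
        have t0: "t \<noteq> 0" using xy x' by (simp add: t_def)
        have r: "x / t = x + y" using xy x' by (simp add: t_def)
        have "1 - t = y / (x + y)" unfolding t_def using xy by (simp add: field_simps)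
        then have "x * y = t * (1 - t) * (x + y) ^ 2" unfolding t_def using xy by (simp add: power2_eq_square)
        then have "?\<chi> x ^ j * ?\<chi> y ^ j = ?\<chi> t ^ j * ?\<chi> (1 - t) ^ j * ?\<chi> (x + y) ^ (2 * j)"
          unfolding power_mult_distrib[symmetric] teichmueller_bar_mult[symmetric] power_mult
          by (simp add: teichmueller_bar_mult power_mult_distrib power2_eq_square)
        then show "?\<chi> (x / (x + y)) ^ j * ?\<chi> (1 - x / (x + y)) ^ j * (?\<chi> (x / (x / (x + y))) ^ (2 * j) * phi (1 + x / (x / (x + y)))) =
            ?\<chi> x ^ j * ?\<chi> y ^ j * phi (1 + (x + y))"
          unfolding t_def[symmetric] r by (simp only: mult.assoc)
      next
        fix t :: "'p mod_ring" assume t: "t \<in> -{0, 1}"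
        have x': "x \<noteq> 0" using x0 by simp
        show "x / (x + (x / t - x)) = t" using t x' by simp
        show "x / t - x \<in> -{0, - x}" using t x' by (auto simp: divide_eq_eq)
      qed
      ultimately show ?thesis by simp
    qed
    have z: "(\<Sum>x\<in>-{0}. ?\<chi> x ^ (2 * j)) = 0"
    proof -
      have "(\<Sum>x\<in>-{0}. ?\<chi> x ^ (2 * j)) = (\<Sum>x\<in>-{0 :: 'p mod_ring}. teichmueller x ^ (2 * j))"
        unfolding teichmueller_bar_eq by (rule sum.reindex_bij_witness[of _ inverse inverse]) auto
      then show ?thesis using j by (simp add: sum_teichmueller_power del: One_nat_def)
    qed
    have "(\<Sum>x\<in>-{0}. \<Sum>y\<in>-{0}. ?\<chi> x ^ j * ?\<chi> y ^ j * phi (1 + (x + y))) =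
        (\<Sum>x\<in>-{0}. ?\<chi> (-1) ^ j * ?\<chi> x ^ (2 * j) + (\<Sum>t\<in>-{0,1}. (?\<chi> t ^ j * ?\<chi> (1 - t) ^ j) * (?\<chi> (x / t) ^ (2 * j) * phi (1 + x / t))))"
      by (rule sum.cong[OF refl x])
    also have "\<dots> = (\<Sum>x\<in>-{0}. \<Sum>t\<in>-{0,1}. (?\<chi> t ^ j * ?\<chi> (1 - t) ^ j) * (?\<chi> (x / t) ^ (2 * j) * phi (1 + x / t)))"
      by (simp add: sum.distrib z flip: sum_distrib_left)
    also have "\<dots> = (\<Sum>t\<in>-{0,1}. \<Sum>x\<in>-{0}. (?\<chi> t ^ j * ?\<chi> (1 - t) ^ j) * (?\<chi> (x / t) ^ (2 * j) * phi (1 + x / t)))"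
      by (rule sum.swap)
    also have "\<dots> = (\<Sum>t\<in>-{0,1}. (?\<chi> t ^ j * ?\<chi> (1 - t) ^ j) * mellin shift (2 * j))"
    proof (rule sum.cong[OF refl])
      fix t :: "'p mod_ring" assume "t \<in> -{0,1}"
      then have "inverse t \<noteq> 0" by simp
      from sum_mult_reindex[OF this, of "\<lambda>x. ?\<chi> x ^ (2 * j) * phi (1 + x)"]
      show "(\<Sum>x\<in>-{0}. (?\<chi> t ^ j * ?\<chi> (1 - t) ^ j) * (?\<chi> (x / t) ^ (2 * j) * phi (1 + x / t))) =
        (?\<chi> t ^ j * ?\<chi> (1 - t) ^ j) * mellin shift (2 * j)"
        by (simp add: mellin_def shift_def divide_inverse mult.commute flip: sum_distrib_left)
    qed
    finally show ?thesis by (simp add: jacobi_def sum_distrib_right)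
  qed
  also have "c * c = ?\<chi> 2 ^ (2 * j)" by (simp add: c_def mult_2 flip: power_add)
  finally show ?thesis by (simp only: mult.assoc)
qed

text \<open>The exponents 0 and (p - 1)/2 are those with 2j divisible by p - 1, outside the reach of
  Gross-Koblitz for the Jacobi sum; they are evaluated directly.\<close>

lemma mellin_pair_mean_0: "mellin (quadratic_character.pair_mean phi) 0 = 1"
proof -
  interpret quadratic_character phi by (rule phi_quadratic)
  have inner: "(\<Sum>w\<in>-{0}. phi (1 + (z + w / z) / 2)) = - phi (1 + z / 2)" if z: "z \<noteq> 0" for z
  proof -
    have "2 * z \<noteq> 0" using two_neq_0 z by simp
    then have "(\<Sum>w\<in>-{0}. phi (1 + (z + w / z) / 2)) = (\<Sum>y\<in>-{0}. phi (1 + (z + 2 * z * y / z) / 2))"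
      by (rule sum_mult_reindex[symmetric])
    also have "\<dots> = (\<Sum>y\<in>-{0}. phi (y + (1 + z / 2)))"
      using two_neq_0 z by (intro sum.cong refl arg_cong[of _ _ phi]) (simp add: add_divide_distrib)
    also have "\<dots> = - phi (1 + z / 2)"
      using sum_reindex_plus[of phi "1 + z / 2"] by (simp add: sum_Compl_0 sum_phi)
    finally show ?thesis .
  qed
  have "mellin pair_mean 0 = (\<Sum>w\<in>-{0}. \<Sum>z\<in>-{0}. phi (1 + (z + w / z) / 2))"
    by (simp add: mellin_def pair_mean_def)
  also have "\<dots> = (\<Sum>z\<in>-{0}. \<Sum>w\<in>-{0}. phi (1 + (z + w / z) / 2))" by (rule sum.swap)
  also have "\<dots> = (\<Sum>z\<in>-{0}. - phi (1 + z / 2))" by (intro sum.cong refl inner) simp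
  also have "\<dots> = (\<Sum>y\<in>-{0}. - phi (1 + 2 * y / 2))" by (rule sum_mult_reindex[OF two_neq_0, symmetric])
  also have "\<dots> = - (\<Sum>y\<in>-{0}. phi (1 + y))" using two_neq_0 by (simp add: sum_negf)
  finally show ?thesis by (simp add: sum_phi_plus_nonzero)
qed

lemma mellin_pair_mean_half:
  "mellin (quadratic_character.pair_mean phi) ((CARD('p) - 1) div 2) = of_nat CARD('p) * phi (-1)"
proof -
  interpret quadratic_character phi by (rule phi_quadratic)
  have "mellin pair_mean ((CARD('p) - 1) div 2) = (\<Sum>w\<in>-{0}. phi w * pair_mean w)"
    unfolding mellin_def by (intro sum.cong refl) (simp add: phi_eq_bar)
  then show ?thesis by (simp add: sum_phi_pair_mean)
qed

lemma Gamma_frac_half: "Gamma_frac ((CARD('p) - 1) div 2) = padic_Gamma (1 / 2 :: 'p padic)"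
proof -
  let ?m = "(CARD('p) - 1) div 2"
  have "(2 * of_nat ?m :: 'p padic) = of_nat (CARD('p) - 1)" using half_card(1) by (metis of_nat_mult of_nat_numeral)
  moreover have "(of_nat ?m :: 'p padic) \<noteq> 0" unfolding of_nat_eq_0_iff using half_card(2) by linarith
  ultimately have "of_nat ?m / of_nat (CARD('p) - 1) = (1 / 2 :: 'p padic)"
    by (metis divide_divide_eq_left divide_self mult.commute)
  then show ?thesis by (simp only: Gamma_frac_def)
qed

text \<open>Generically the gamma values at 2j modulo p - 1 cancel between the Jacobi sum and
  \<open>shift\<close>, and the carries d of 2j and e - d of the second step add up to e. The powers
  of omega(2) are arranged as duplication delivers them.\<close>

lemma mellin_pair_mean:
  assumes j: "j < CARD('p) - 1" and k: "k < CARD('p) - 1"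
    and jk: "2 * j + k = (CARD('p) - 1) div 2 + (CARD('p) - 1) * e"
  shows "mellin (quadratic_character.pair_mean phi) j =
    (- of_nat CARD('p)) ^ e * Gamma_frac j ^ 2 * (teichmueller 2 ^ k * Gamma_frac k) /
      (teichmueller 2 ^ ((CARD('p) - 1) div 2) * Gamma_frac ((CARD('p) - 1) div 2))"
proof -
  let ?Q = "CARD('p) - 1" and ?m = "(CARD('p) - 1) div 2" and ?t = "teichmueller (2 :: 'p mod_ring)"
  note Gamma0 = Gamma_frac_neq_0[OF odd_p]
  have t0: "?t ^ n \<noteq> 0" for n using two_neq_0_mod_ring by simp
  show ?thesis
  proof (cases "?Q dvd 2 * j")
    case True
    then obtain l where l: "2 * j = ?Q * l" by (elim dvdE)
    moreover have "2 * j < ?Q * 2" using j by auto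
    ultimately have "?Q * l < ?Q * 2" by simp
    then have "l < 2" by (simp only: mult_less_cancel1)
    then consider "l = 0" | "l = 1" by linarith
    then show ?thesis
    proof cases
      case 1
      then have j0: "j = 0" using l by simp
      have "k mod ?Q = (?m + ?Q * e) mod ?Q" using jk j0 by simp
      then have km: "k = ?m" using k half_card(3) by (simp only: mod_mult_self2 mod_less)
      then have "?Q * e = 0" using jk j0 by simp
      then have "e = 0" using half_card(2,3) by (simp only: mult_eq_0_iff) linarith
      moreover have "Gamma_frac 0 = (1 :: 'p padic)" by (simp add: Gamma_frac_def padic_Gamma_0[OF odd_p])
      ultimately show ?thesis using Gamma0[of ?m] t0 unfolding j0 km mellin_pair_mean_0 by simp
    next
      case 2
      then have l2: "2 * j = ?Q" using l by (simp only: mult_1_right)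
      then have jm: "j = ?m" using half_card(1) by linarith
      have "(k + ?Q * 1) mod ?Q = (?m + ?Q * e) mod ?Q" using jk l 2 by (simp only: add.commute)
      then have km: "k = ?m" using k half_card(3) by (simp only: mod_mult_self2 mod_less)
      then have "?Q * e = ?Q * 1" using jk l2 by linarith
      then have e1: "e = 1" using half_card(2,3) by (simp only: mult_cancel1) linarith
      \<comment> \<open>At j = (p - 1)/2 the general formula matches the direct value because
        Gamma(1/2)^2 = -phi(-1).\<close>
      have "(CARD('p) + 1) div 2 = ?m + 1" using half_card(1) prime_card_gt_1[where ?'p = 'p] by linarith
      then have "Gamma_frac ?m ^ 2 = - ((-1) ^ ?m :: 'p padic)"
        unfolding Gamma_frac_half padic_Gamma_half_square[OF odd_p] by simp
      moreover have "phi (-1) = (-1) ^ ?m" by (simp add: phi_def teichmueller_minus_1[OF odd_p])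
      ultimately show ?thesis using Gamma0[of ?m] t0 unfolding jm km e1 mellin_pair_mean_half by simp
    qed
  next
    case False
    define c where "c = 2 * j mod ?Q"
    define d where "d = 2 * j div ?Q"
    have jc: "2 * j = c + ?Q * d" by (simp only: c_def d_def mod_mult_div_eq)
    have Q: "?Q > 0" using j by linarith
    have c: "c < ?Q" unfolding c_def using Q by (rule mod_less_divisor)
    have "c \<noteq> 0" unfolding c_def using False by (simp only: dvd_eq_mod_eq_0 not_False_eq_True)
    have de: "d \<le> e"
    proof (rule ccontr)
      assume "\<not> d \<le> e"
      then have "?Q * (e + 1) \<le> ?Q * d" by (intro mult_le_mono) auto
      then show False using jc jk half_card(3) by simp
    qed
    then have "?Q * e = ?Q * d + ?Q * (e - d)" by (simp flip: distrib_left)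
    then have ck: "c + k = ?m + ?Q * (e - d)" using jk jc by linarith
    have "?t ^ k * ?t ^ (2 * j) = ?t ^ ?m * (?t ^ ?Q) ^ e"
      using jk by (simp only: power_add[symmetric] power_mult[symmetric] add.commute)
    then have "?t ^ k * ?t ^ (2 * j) = ?t ^ ?m" unfolding teichmueller_power_card_minus_1[OF two_neq_0_mod_ring] by simp
    then have tk: "teichmueller_bar (2 :: 'p mod_ring) ^ (2 * j) = ?t ^ k / ?t ^ ?m"
      using t0 by (simp add: teichmueller_bar_def power_inverse field_simps)
    have "(j + j) mod ?Q \<noteq> 0" using \<open>c \<noteq> 0\<close> unfolding c_def mult_2 .
    from gross_koblitz_jacobi[OF odd_p j j this]
    have jac: "jacobi j j = - ((- of_nat CARD('p)) ^ d * Gamma_frac j * Gamma_frac j / Gamma_frac c :: 'p padic)"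
      by (simp only: c_def d_def mult_2)
    have "mellin (quadratic_character.shift phi) (2 * j) = mellin (quadratic_character.shift phi) c"
      unfolding c_def by (rule mellin_mod[symmetric])
    also have "\<dots> = - ((- of_nat CARD('p)) ^ (e - d) * Gamma_frac c * Gamma_frac k / Gamma_frac ?m)"
      by (rule mellin_shift[OF c k ck])
    finally have sh: "mellin (quadratic_character.shift phi) (2 * j) = \<dots>" .
    have "(- of_nat CARD('p) :: 'p padic) ^ e = (- of_nat CARD('p)) ^ d * (- of_nat CARD('p)) ^ (e - d)"
      using de by (simp flip: power_add)
    then show ?thesis unfolding mellin_pair_mean_jacobi[OF False] tk jac sh
      using Gamma0[of c] by (simp add: power2_eq_square)
  qed
qed

section \<open>Matching the hypergeometric factors with Mellin transforms\<close>

definition G_factor :: "rat \<Rightarrow> rat \<Rightarrow> nat \<Rightarrow> 'p padic" where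
  "G_factor a b j = padic_Gamma (of_rat (frac (a - of_nat j / (of_nat CARD('p) - 1)))) / padic_Gamma (of_rat (frac a)) *
    (padic_Gamma (of_rat (frac (- b + of_nat j / (of_nat CARD('p) - 1)))) / padic_Gamma (of_rat (frac (- b)))) *
    (- of_nat CARD('p)) powi (- \<lfloor>frac a - of_nat j / (of_nat CARD('p) - 1)\<rfloor> -
      \<lfloor>frac (- b) + of_nat j / (of_nat CARD('p) - 1)\<rfloor>)"

text \<open>For n = 4 the sign (-1)^(j n) is 1, and at argument 1 the character value is 1.\<close>

lemma padic_G_4:
  "padic_G [a, b, c, d] [1, 1, 1, 1] (1 :: 'p mod_ring) = - 1 / (of_nat CARD('p) - 1) *
    (\<Sum>j<CARD('p) - 1. G_factor a 1 j * G_factor b 1 j * (G_factor c 1 j * G_factor d 1 j))"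
proof -
  have s: "{0..CARD('p) - 2} = {..<CARD('p) - 1}" using prime_card_ge_2[where ?'p = 'p] by auto
  have "prod f {..<4} = f 0 * f 1 * (f 2 * f 3)" for f :: "nat \<Rightarrow> 'p padic"
    by (simp add: numeral_eq_Suc lessThan_Suc mult_ac)
  then show ?thesis
    by (simp add: padic_G_def Let_def s G_factor_def character_power_def teichmueller_bar_def mult.assoc)
qed

lemma fracI:
  fixes y :: "'a::floor_ceiling"
  assumes "0 \<le> r" "r < 1" "y = r + of_int n"
  shows "frac y = r" "\<lfloor>y\<rfloor> = n"
proof -
  show f: "\<lfloor>y\<rfloor> = n" using assms by (intro floor_unique) auto
  show "frac y = r" using assms by (simp add: frac_def f[unfolded assms(3)])
qed

lemma of_rat_of_nat_divide:
  "(of_rat (of_nat k / of_nat n) :: 'p padic) = of_nat k / of_nat n"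
  by (simp add: of_rat_divide)

text \<open>For lower parameter 1 the fractional part of -1 is 0, so the second gamma ratio is
  \<open>Gamma_frac j\<close> and only the first floor contributes to the power of -p.\<close>

lemma G_factor_eq:
  assumes a: "0 \<le> a" "a < 1" and j: "j < CARD('p) - 1" and r: "0 \<le> r" "r < 1"
    and e: "a - of_nat j / of_nat (CARD('p) - 1) = r - of_nat e"
  shows "G_factor a 1 j = padic_Gamma (of_rat r) / padic_Gamma (of_rat a) * Gamma_frac j * (- of_nat CARD('p)) ^ e"
proof -
  define x :: rat where "x = of_nat j / of_nat (CARD('p) - 1)"
  have Q: "of_nat CARD('p) - 1 = (of_nat (CARD('p) - 1) :: rat)"
    using prime_card_gt_1[where ?'p = 'p] by (simp add: of_nat_diff)
  have x: "0 \<le> x" "x < 1" using j by (auto simp: x_def simp del: of_nat_diff One_nat_def)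
  have fa: "frac a = a" using fracI(1)[of a a 0] a by simp
  have f1: "frac (a - x) = r" "\<lfloor>a - x\<rfloor> = - int e"
    using fracI[of r "a - x" "- int e"] r e by (simp_all add: x_def)
  have f2: "frac (- 1 + x) = x" using fracI(1)[of x "- 1 + x" "-1"] x by simp
  have f3: "frac (- 1) = (0 :: rat)" using fracI(1)[of 0 "- 1" "-1"] by simp
  have f4: "\<lfloor>0 + x\<rfloor> = 0" using fracI(2)[of x "0 + x" 0] x by simp
  show ?thesis
    unfolding G_factor_def Q x_def[symmetric] fa f1 f2 f3 f4
    by (simp add: padic_Gamma_0[OF odd_p] Gamma_frac_def x_def of_rat_of_nat_divide del: of_nat_diff One_nat_def)
qed

lemma half_card_rat: "(of_nat ((CARD('p) - 1) div 2) :: rat) / of_nat (CARD('p) - 1) = 1 / 2"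
proof -
  have "(2 * of_nat ((CARD('p) - 1) div 2) :: rat) = of_nat (CARD('p) - 1)" using half_card(1) by (metis of_nat_mult of_nat_numeral)
  moreover have "(of_nat ((CARD('p) - 1) div 2) :: rat) \<noteq> 0" unfolding of_nat_eq_0_iff using half_card(2) by linarith
  ultimately show ?thesis by (metis divide_divide_eq_left divide_self mult.commute)
qed

text \<open>k is the residue of (p - 1)/2 - n j modulo p - 1 and e the carry; a large multiple of p
  - 1 is added to keep the subtraction of naturals exact.\<close>

lemma exists_complement:
  assumes j: "j < CARD('p) - 1"
  obtains k e where "k < CARD('p) - 1" "n * j + k = (CARD('p) - 1) div 2 + (CARD('p) - 1) * e"
proof -
  let ?Q = "CARD('p) - 1" and ?m = "(CARD('p) - 1) div 2"
  define k where "k = (?m + ?Q * (n * j) - n * j) mod ?Q"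
  define e where "e = n * j - (?m + ?Q * (n * j) - n * j) div ?Q"
  have Q: "?Q > 0" using j by linarith
  have le: "1 * (n * j) \<le> ?Q * (n * j)" using Q by (intro mult_le_mono1) linarith
  have "(?m + ?Q * (n * j) - n * j) div ?Q \<le> (?m + ?Q * (n * j)) div ?Q" by (intro div_le_mono) simp
  also have "\<dots> = n * j" using half_card(3)
    by (simp only: div_mult_self2 div_less add_0_left add_0_right)
  finally have d: "(?m + ?Q * (n * j) - n * j) div ?Q \<le> n * j" .
  have "?Q * ((?m + ?Q * (n * j) - n * j) div ?Q) + k = ?m + ?Q * (n * j) - n * j" by (simp only: k_def mult_div_mod_eq)
  moreover have "?Q * (n * j) = ?Q * e + ?Q * ((?m + ?Q * (n * j) - n * j) div ?Q)"
    using d by (simp add: e_def flip: distrib_left)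
  ultimately have "n * j + k = ?m + ?Q * e" using le by linarith
  moreover have "k < ?Q" unfolding k_def using Q by (rule mod_less_divisor)
  ultimately show ?thesis using that by blast
qed

lemma G_factor_half:
  assumes j: "j < CARD('p) - 1"
  shows "G_factor (1 / 2) 1 j = - mellin (quadratic_character.shift phi) j"
proof -
  let ?Q = "CARD('p) - 1" and ?m = "(CARD('p) - 1) div 2"
  obtain k e where k: "k < ?Q" and jk: "1 * j + k = ?m + ?Q * e" by (rule exists_complement[OF j])
  have Q0: "(of_nat ?Q :: rat) \<noteq> 0" unfolding of_nat_eq_0_iff using j by linarith
  have "(of_nat j + of_nat k :: rat) = of_nat ?m + of_nat ?Q * of_nat e" using jk by (metis mult_1 of_nat_add of_nat_mult)
  then have "(of_nat j + of_nat k) / of_nat ?Q = (of_nat ?m + of_nat ?Q * of_nat e) / (of_nat ?Q :: rat)" by simp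
  then have e: "1 / 2 - of_nat j / of_nat ?Q = of_nat k / of_nat ?Q - (of_nat e :: rat)"
    using Q0 by (simp add: add_divide_distrib half_card_rat del: of_nat_diff One_nat_def)
  have "of_nat k / of_nat ?Q < (1 :: rat)" using k by (simp del: of_nat_diff One_nat_def)
  then have "G_factor (1 / 2) 1 j = padic_Gamma (of_rat (of_nat k / of_nat ?Q)) / padic_Gamma (of_rat (1 / 2)) * Gamma_frac j * (- of_nat CARD('p)) ^ e"
    by (intro G_factor_eq[OF _ _ j _ _ e]) auto
  also have "\<dots> = (- of_nat CARD('p)) ^ e * Gamma_frac j * Gamma_frac k / Gamma_frac ?m"
    unfolding of_rat_of_nat_divide Gamma_frac_half by (simp add: Gamma_frac_def of_rat_divide del: of_nat_diff One_nat_def)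
  also have "\<dots> = - mellin (quadratic_character.shift phi) j"
    unfolding mellin_shift[OF j k jk[unfolded mult_1]] by (simp only: minus_minus)
  finally show ?thesis .
qed

text \<open>With w = k/(p - 1) one finds 1/4 - j/(p-1) = (w - e)/2 and 3/4 - j/(p-1) = (w + 1 -
  e)/2. For e = 0, 1, 2 the fractional parts are w/2 and (w + 1)/2 in some order and the floors sum
  to -e, so duplication applies.\<close>

lemma G_factor_quarters:
  assumes j: "j < CARD('p) - 1"
  shows "G_factor (1 / 4) 1 j * G_factor (3 / 4) 1 j = mellin (quadratic_character.pair_mean phi) j"
proof -
  let ?Q = "CARD('p) - 1" and ?m = "(CARD('p) - 1) div 2" and ?t = "teichmueller (2 :: 'p mod_ring)"
  let ?P = "- of_nat CARD('p) :: 'p padic" and ?\<Gamma> = "\<lambda>x. padic_Gamma (of_rat x) :: 'p padic"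
  obtain k e where k: "k < ?Q" and jk: "2 * j + k = ?m + ?Q * e" by (rule exists_complement[OF j])
  define w :: rat where "w = of_nat k / of_nat ?Q"
  have w: "0 \<le> w" "w < 1" using k by (simp_all add: w_def del: of_nat_diff One_nat_def)
  have Q0: "(of_nat ?Q :: rat) \<noteq> 0" unfolding of_nat_eq_0_iff using j by linarith
  have "(2 * of_nat j + of_nat k :: rat) = of_nat ?m + of_nat ?Q * of_nat e"
    using jk by (metis of_nat_add of_nat_mult of_nat_numeral)
  then have "(2 * of_nat j + of_nat k) / of_nat ?Q = (of_nat ?m + of_nat ?Q * of_nat e) / (of_nat ?Q :: rat)" by simp
  then have x: "of_nat j / of_nat ?Q = (1 / 2 + of_nat e - w) / 2"
    using Q0 by (simp add: add_divide_distrib half_card_rat w_def del: of_nat_diff One_nat_def)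
  have "?Q * e < ?Q * 3" using jk j k by linarith
  then have "e < 3" by (simp only: mult_less_cancel1)
  then consider "e = 0" | "e = 1" | "e = 2" by linarith
  then have "G_factor (1 / 4) 1 j * G_factor (3 / 4) 1 j =
    ?\<Gamma> (w / 2) * ?\<Gamma> ((w + 1) / 2) / (?\<Gamma> (1 / 4) * ?\<Gamma> (3 / 4)) * Gamma_frac j ^ 2 * ?P ^ e"
  proof cases
    case 1
    have "G_factor (1 / 4) 1 j = ?\<Gamma> (w / 2) / ?\<Gamma> (1 / 4) * Gamma_frac j * ?P ^ 0"
      using w by (intro G_factor_eq[OF _ _ j]) (auto simp: x 1 field_simps simp del: of_nat_diff One_nat_def)
    moreover have "G_factor (3 / 4) 1 j = ?\<Gamma> ((w + 1) / 2) / ?\<Gamma> (3 / 4) * Gamma_frac j * ?P ^ 0"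
      using w by (intro G_factor_eq[OF _ _ j]) (auto simp: x 1 field_simps simp del: of_nat_diff One_nat_def)
    ultimately show ?thesis by (simp add: 1 power2_eq_square)
  next
    case 2
    have "G_factor (1 / 4) 1 j = ?\<Gamma> ((w + 1) / 2) / ?\<Gamma> (1 / 4) * Gamma_frac j * ?P ^ 1"
      using w by (intro G_factor_eq[OF _ _ j]) (auto simp: x 2 field_simps simp del: of_nat_diff One_nat_def)
    moreover have "G_factor (3 / 4) 1 j = ?\<Gamma> (w / 2) / ?\<Gamma> (3 / 4) * Gamma_frac j * ?P ^ 0"
      using w by (intro G_factor_eq[OF _ _ j]) (auto simp: x 2 field_simps simp del: of_nat_diff One_nat_def)
    ultimately show ?thesis by (simp add: 2 power2_eq_square)
  next
    case 3
    have "G_factor (1 / 4) 1 j = ?\<Gamma> (w / 2) / ?\<Gamma> (1 / 4) * Gamma_frac j * ?P ^ 1"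
      using w by (intro G_factor_eq[OF _ _ j]) (auto simp: x 3 field_simps simp del: of_nat_diff One_nat_def)
    moreover have "G_factor (3 / 4) 1 j = ?\<Gamma> ((w + 1) / 2) / ?\<Gamma> (3 / 4) * Gamma_frac j * ?P ^ 1"
      using w by (intro G_factor_eq[OF _ _ j]) (auto simp: x 3 field_simps simp del: of_nat_diff One_nat_def)
    ultimately show ?thesis by (simp add: 3 power2_eq_square)
  qed
  also have "?\<Gamma> (w / 2) * ?\<Gamma> ((w + 1) / 2) = ?t ^ k * padic_Gamma (1 / 2) * Gamma_frac k"
    using padic_Gamma_duplication[OF odd_p k]
    unfolding w_def of_rat_divide of_rat_add of_rat_of_nat_eq of_rat_1 of_rat_numeral_eq Gamma_frac_def .
  also have "?\<Gamma> (1 / 4) * ?\<Gamma> (3 / 4) = ?t ^ ?m * padic_Gamma (1 / 2) * Gamma_frac ?m"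
  proof -
    have h: "of_nat ?m / of_nat ?Q = (1 / 2 :: 'p padic)"
      using arg_cong[OF half_card_rat, of "of_rat :: rat \<Rightarrow> 'p padic"] unfolding of_rat_of_nat_divide by (simp add: of_rat_divide)
    show ?thesis using padic_Gamma_duplication[OF odd_p half_card(3)]
      unfolding h Gamma_frac_def by (simp add: of_rat_divide)
  qed
  also have "?t ^ k * padic_Gamma (1 / 2) * Gamma_frac k / (?t ^ ?m * padic_Gamma (1 / 2) * Gamma_frac ?m) * Gamma_frac j ^ 2 * ?P ^ e =
      ?P ^ e * Gamma_frac j ^ 2 * (?t ^ k * Gamma_frac k) / (?t ^ ?m * Gamma_frac ?m)"
    using Gamma_frac_neq_0[OF odd_p, of ?m, unfolded Gamma_frac_half] by (simp add: Gamma_frac_half)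
  also have "\<dots> = mellin (quadratic_character.pair_mean phi) j"
    by (rule mellin_pair_mean[OF j k jk, symmetric])
  finally show ?thesis .
qed

text \<open>The signs of the four factors cancel; the prefactor -1/(p - 1) and Fourier inversion
  leave a single minus sign.\<close>

lemma padic_G_triple_shift:
  "padic_G [1/2, 1/2, 1/2, 1/2] [1, 1, 1, 1] (1 :: 'p mod_ring) =
    - conv (quadratic_character.shift phi) (quadratic_character.triple_shift phi) 1"
proof -
  interpret quadratic_character phi by (rule phi_quadratic)
  note Q0 = of_nat_card_minus_1_neq_0[where ?'p = 'p and ?'q = 'p]
  have Q: "of_nat CARD('p) - 1 = (of_nat (CARD('p) - 1) :: 'p padic)"
    using prime_card_gt_1[where ?'p = 'p] by (simp add: of_nat_diff)
  have "(\<Sum>j<CARD('p) - 1. G_factor (1/2) 1 j * G_factor (1/2) 1 j * (G_factor (1/2) 1 j * G_factor (1/2) 1 j)) =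
      (\<Sum>j<CARD('p) - 1. mellin (conv shift triple_shift) j)"
    by (intro sum.cong refl) (simp add: G_factor_half mellin_conv triple_shift_def)
  then show ?thesis unfolding padic_G_4 sum_mellin Q using Q0 by (simp del: of_nat_diff One_nat_def)
qed

lemma padic_G_triple_mean:
  "padic_G [1/2, 1/2, 1/4, 3/4] [1, 1, 1, 1] (1 :: 'p mod_ring) =
    - conv (quadratic_character.shift phi) (quadratic_character.triple_mean phi) 1"
proof -
  interpret quadratic_character phi by (rule phi_quadratic)
  note Q0 = of_nat_card_minus_1_neq_0[where ?'p = 'p and ?'q = 'p]
  have Q: "of_nat CARD('p) - 1 = (of_nat (CARD('p) - 1) :: 'p padic)"
    using prime_card_gt_1[where ?'p = 'p] by (simp add: of_nat_diff)
  have "(\<Sum>j<CARD('p) - 1. G_factor (1/2) 1 j * G_factor (1/2) 1 j * (G_factor (1/4) 1 j * G_factor (3/4) 1 j)) =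
      (\<Sum>j<CARD('p) - 1. mellin (conv shift triple_mean) j)"
    by (intro sum.cong refl) (simp add: G_factor_half G_factor_quarters mellin_conv triple_mean_def)
  then show ?thesis unfolding padic_G_4 sum_mellin Q using Q0 by (simp del: of_nat_diff One_nat_def)
qed

end

theorem theorem2p4:
  fixes p :: nat and s :: "'p::prime_card padic"
  assumes "p = CARD('p)" and "prime p" and "odd p"
    and "s = padic_Gamma (1/4) * padic_Gamma (3/4) * padic_Gamma (1/2) ^ 2"
  shows "s = (-1) powi (\<lfloor>(real p - 1) / 4\<rfloor> + \<lfloor>(real p - 1) / 2\<rfloor>) \<and>
    padic_G [1/2, 1/2, 1/4, 3/4] [1, 1, 1, 1] (1 :: 'p mod_ring) - s * of_nat p =
      character_power teichmueller ((p - 1) div 2) (-1 :: 'p mod_ring) *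
      (padic_G [1/2, 1/2, 1/2, 1/2] [1, 1, 1, 1] (1 :: 'p mod_ring) - of_nat p)"
proof
  have odd_p: "odd CARD('p)" using assms by simp
  show "s = (-1) powi (\<lfloor>(real p - 1) / 4\<rfloor> + \<lfloor>(real p - 1) / 2\<rfloor>)"
    unfolding assms(1,4) by (rule padic_Gamma_quarters_sign[OF odd_p])
  interpret quadratic_character "phi :: 'p mod_ring \<Rightarrow> 'p padic" by (rule phi_quadratic[OF odd_p])
  \<comment> \<open>In this form s is the coefficient of the field size in the character sum
    identity.\<close>
  have "s = phi (2 :: 'p mod_ring)"
    unfolding assms(4) phi_def[OF odd_p] by (rule padic_Gamma_quarters_teichmueller[OF odd_p])
  moreover have "character_power teichmueller ((p - 1) div 2) (-1 :: 'p mod_ring) = phi (-1)"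
    by (simp add: character_power_def phi_def[OF odd_p] assms(1))
  \<comment> \<open>Negating this identity gives the claim, since both hypergeometric values are
    minus a convolution at 1.\<close>
  moreover have "conv shift triple_mean 1 + phi (2 :: 'p mod_ring) * of_nat p = phi (-1) * (conv shift triple_shift 1 + of_nat p)"
    using conv_triple_mean_eq_conv_triple_shift by (simp add: assms(1))
  ultimately show "padic_G [1/2, 1/2, 1/4, 3/4] [1, 1, 1, 1] (1 :: 'p mod_ring) - s * of_nat p =
      character_power teichmueller ((p - 1) div 2) (-1 :: 'p mod_ring) *
      (padic_G [1/2, 1/2, 1/2, 1/2] [1, 1, 1, 1] (1 :: 'p mod_ring) - of_nat p)"
    unfolding padic_G_triple_shift[OF odd_p] padic_G_triple_mean[OF odd_p] by (simp add: algebra_simps)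
qed

end
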